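(* Let $d\ge2$, let $H_1=-i\psi\frac{\partial}{\partial x_1}$ on $L^2(\mathbb{R}^d)$ be a regular shear flow with spectral family $\{E(\lambda)\}_{\lambda\in\mathbb{R}}$, and let $\sigma>\frac12$. The density of states of $H_1$ at $\lambda_0\in\mathbb{R}$ is estimated, for $f,g\in\mathcal{X}^\sigma$, by $$\left|\frac{d}{d\lambda}\Big|_{\lambda=\lambda_0}\left(E(\lambda)f,g\right)_{L^2(\mathbb{R}^d)}\right|\leq C(\sigma,\psi,\lambda_0)\,\|f\|_{\mathcal{X}^\sigma}\|g\|_{\mathcal{X}^\sigma},$$ where $$C(\sigma,\psi,\lambda_0)=C(\sigma,\ell)\left(1+\frac{|\lambda_0|L}{\ell^2}\right)>0$$ is a constant depending on $\sigma$, $\ell$, $L$ and $\lambda_0$, but not on $f$ or $g$ (and $C(\sigma,\ell)$ depends only on $\sigma$ and $\ell$).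
   Context: Points of $\mathbb{R}^d$ are written $(x_1,x')$, $x'=(x_2,\dots,x_d)$. A shear flow is an operator $H_1=-i\psi\frac{\partial}{\partial x_1}$ on $L^2(\mathbb{R}^d)$, where $0<\psi\in L^\infty(\mathbb{R}^d)$ depends only on $x'$; $H_1$ denotes its self-adjoint realization (unique self-adjoint extension from $C_0^\infty(\mathbb{R}^d)$). It is a regular shear flow if there are constants $\ell>0$ and $L$ such that (A1) $\psi(x')>\ell>0$ for all $x'\in\mathbb{R}^{d-1}$, and (A2) $|\psi(x')-\psi(y')|\le L|x'-y'|$ for all $x',y'\in\mathbb{R}^{d-1}$. The spectral family (resolution of the identity) of $H_1$ is $E(\lambda)=\mathbf{1}_{(-\infty,\lambda]}(H_1)$. The density of states at $\lambda_0$ is the bilinear (sesquilinear) form $(f,g)\mapsto\frac{d}{d\lambda}\big|_{\lambda=\lambda_0}(E(\lambda)f,g)_{L^2(\mathbb{R}^d)}$. $\mathcal{X}^\sigma=L^{2,\sigma}(\mathbb{R};L^2(\mathbb{R}^{d-1}))=\left\{r:\mathbb{R}^d\to\mathbb{C}\ \big|\ \|r\|_{\mathcal{X}^\sigma}^2:=\int_{\mathbb{R}^d}(1+x_1^2)^\sigma|r(x)|^2\,dx<\infty\right\}$. *)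

theory Defs
  imports "HOL-Analysis.Analysis"
begin

section \<open>Square-integrable functions\<close>

text \<open>
  Elements of \<open>L\<^sup>2\<close> are represented by measurable functions. Equality in \<open>L\<^sup>2\<close> is almost-everywhere
  equality and is written out where it is needed. The inner product is linear in its first argument.
\<close>

definition L2 :: "'a measure \<Rightarrow> ('a \<Rightarrow> complex) set" where
  "L2 M = {f \<in> borel_measurable M. integrable M (\<lambda>x. (cmod (f x))\<^sup>2)}"

definition L2_inner :: "'a measure \<Rightarrow> ('a \<Rightarrow> complex) \<Rightarrow> ('a \<Rightarrow> complex) \<Rightarrow> complex" where
  "L2_inner M f g = (\<integral>x. f x * cnj (g x) \<partial>M)"

definition L2_norm :: "'a measure \<Rightarrow> ('a \<Rightarrow> complex) \<Rightarrow> real" where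
  "L2_norm M f = sqrt (\<integral>x. (cmod (f x))\<^sup>2 \<partial>M)"


section \<open>Unbounded self-adjoint operators\<close>

text \<open>
  An operator in \<open>L\<^sup>2(M)\<close> is given by its graph, a set of pairs \<open>(f, h)\<close> with the meaning \<open>h = H f\<close>.
  The adjoint \<open>H\<^sup>*\<close> is again given as a graph. Any adjoint is a linear subspace that is closed and
  invariant under almost-everywhere equality, and the adjoint of a densely defined operator is
  single-valued up to almost-everywhere equality; so linearity and single-valuedness
  need not be required separately of a densely defined \<open>H\<close> with \<open>H = H\<^sup>*\<close>.
\<close>

type_synonym 'a graph = "(('a \<Rightarrow> complex) \<times> ('a \<Rightarrow> complex)) set"

definition densely_defined :: "'a measure \<Rightarrow> 'a graph \<Rightarrow> bool" where
  "densely_defined M H \<longleftrightarrow>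
     (\<forall>f \<in> L2 M. \<forall>e>0. \<exists>u \<in> Domain H. L2_norm M (\<lambda>x. f x - u x) < e)"

definition adjoint_graph :: "'a measure \<Rightarrow> 'a graph \<Rightarrow> 'a graph" where
  "adjoint_graph M H =
     {(g, k). g \<in> L2 M \<and> k \<in> L2 M \<and> (\<forall>(f, h) \<in> H. L2_inner M h g = L2_inner M f k)}"

definition self_adjoint :: "'a measure \<Rightarrow> 'a graph \<Rightarrow> bool" where
  "self_adjoint M H \<longleftrightarrow> H \<subseteq> L2 M \<times> L2 M \<and> densely_defined M H \<and> H = adjoint_graph M H"


section \<open>Spectral families\<close>

text \<open>
  Symmetry on all of \<open>L\<^sup>2\<close> implies that \<open>P\<close> is linear, and compatible with
  almost-everywhere equality, up to null sets.
\<close>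

definition orthogonal_projection ::
    "'a measure \<Rightarrow> (('a \<Rightarrow> complex) \<Rightarrow> ('a \<Rightarrow> complex)) \<Rightarrow> bool" where
  "orthogonal_projection M P \<longleftrightarrow>
     (\<forall>f \<in> L2 M. P f \<in> L2 M) \<and>
     (\<forall>f \<in> L2 M. \<forall>g \<in> L2 M. L2_inner M (P f) g = L2_inner M f (P g)) \<and>
     (\<forall>f \<in> L2 M. AE x in M. P (P f) x = P f x)"

definition resolution_of_identity ::
    "'a measure \<Rightarrow> (real \<Rightarrow> ('a \<Rightarrow> complex) \<Rightarrow> ('a \<Rightarrow> complex)) \<Rightarrow> bool" where
  "resolution_of_identity M E \<longleftrightarrow>
     (\<forall>\<nu>. orthogonal_projection M (E \<nu>)) \<and>
     (\<forall>\<nu> \<mu>. \<nu> \<le> \<mu> \<longrightarrow> (\<forall>f \<in> L2 M. AE x in M. E \<nu> (E \<mu> f) x = E \<nu> f x)) \<and>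
     (\<forall>f \<in> L2 M. \<forall>\<nu>. ((\<lambda>\<mu>. L2_norm M (\<lambda>x. E \<mu> f x - E \<nu> f x)) \<longlongrightarrow> 0) (at_right \<nu>)) \<and>
     (\<forall>f \<in> L2 M. ((\<lambda>\<mu>. L2_norm M (E \<mu> f)) \<longlongrightarrow> 0) at_bot) \<and>
     (\<forall>f \<in> L2 M. ((\<lambda>\<mu>. L2_norm M (\<lambda>x. E \<mu> f x - f x)) \<longlongrightarrow> 0) at_top)"

text \<open>
  The Lebesgue--Stieltjes measure \<open>d(E(\<nu>)f,f)\<close>; for a resolution of the identity its
  distribution function is nondecreasing and right-continuous, as \<^const>\<open>interval_measure\<close> needs.
\<close>

definition spectral_measure ::
    "'a measure \<Rightarrow> (real \<Rightarrow> ('a \<Rightarrow> complex) \<Rightarrow> ('a \<Rightarrow> complex)) \<Rightarrow> ('a \<Rightarrow> complex) \<Rightarrow> real measure" where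
  "spectral_measure M E f = interval_measure (\<lambda>\<nu>. Re (L2_inner M (E \<nu> f) f))"

text \<open>
  \<open>E(\<nu>) = 1\<^bsub>(-\<infinity>,\<nu>]\<^esub>(H)\<close>, that is, \<open>H = \<integral> \<nu> dE(\<nu>)\<close>: the domain of \<open>H\<close> consists of the \<open>f\<close> with
  \<open>\<integral> \<nu>\<^sup>2 d(E(\<nu>)f,f) < \<infinity>\<close>, and \<open>(H f, f) = \<integral> \<nu> d(E(\<nu>)f,f)\<close> there. The off-diagonal forms
  \<open>d(E(\<nu>)f,g)\<close> are given by the diagonal ones through polarization.
\<close>

definition spectral_family ::
    "'a measure \<Rightarrow> 'a graph \<Rightarrow> (real \<Rightarrow> ('a \<Rightarrow> complex) \<Rightarrow> ('a \<Rightarrow> complex)) \<Rightarrow> bool" where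
  "spectral_family M H E \<longleftrightarrow>
     resolution_of_identity M E \<and>
     (\<forall>f \<in> L2 M. f \<in> Domain H \<longleftrightarrow> integrable (spectral_measure M E f) (\<lambda>t. t\<^sup>2)) \<and>
     (\<forall>(f, h) \<in> H. L2_inner M h f = complex_of_real (\<integral>t. t \<partial>spectral_measure M E f))"

definition density_of_states ::
    "'a measure \<Rightarrow> (real \<Rightarrow> ('a \<Rightarrow> complex) \<Rightarrow> ('a \<Rightarrow> complex)) \<Rightarrow> real
      \<Rightarrow> ('a \<Rightarrow> complex) \<Rightarrow> ('a \<Rightarrow> complex) \<Rightarrow> complex" where
  "density_of_states M E \<nu>\<^sub>0 f g = vector_derivative (\<lambda>\<nu>. L2_inner M (E \<nu> f) g) (at \<nu>\<^sub>0)"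


section \<open>The space \<open>\<real>\<^sup>d = \<real> \<times> \<real>\<^sup>d\<^sup>-\<^sup>1\<close>\<close>

text \<open>
  The dimension is a natural number and not a type, since the constant in the main estimate must
  not depend on it. A point is a pair \<open>(x\<^sub>1, x')\<close>, where \<open>x' = (x\<^sub>2, \<dots>, x\<^sub>d)\<close> is an extensional
  function on \<open>{2..d}\<close>. The topology is the product topology of \<^typ>\<open>real \<times> (nat \<Rightarrow> real)\<close>, which
  on these points is the Euclidean one.
\<close>

type_synonym point = "real \<times> (nat \<Rightarrow> real)"

definition cross_space :: "nat \<Rightarrow> (nat \<Rightarrow> real) set" where
  "cross_space d = (\<Pi>\<^sub>E i\<in>{2..d}. UNIV)"

definition cross_measure :: "nat \<Rightarrow> (nat \<Rightarrow> real) measure" where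
  "cross_measure d = (\<Pi>\<^sub>M i\<in>{2..d}. lborel)"

definition Rd :: "nat \<Rightarrow> point set" where
  "Rd d = UNIV \<times> cross_space d"

definition Rd_measure :: "nat \<Rightarrow> point measure" where
  "Rd_measure d = lborel \<Otimes>\<^sub>M cross_measure d"

definition cross_dist :: "nat \<Rightarrow> (nat \<Rightarrow> real) \<Rightarrow> (nat \<Rightarrow> real) \<Rightarrow> real" where
  "cross_dist d x' y' = L2_set (\<lambda>i. x' i - y' i) {2..d}"

text \<open>
  \<open>C\<^sup>k\<close>: all iterated partial derivatives up to order \<open>k\<close> exist and are continuous.
\<close>

primrec Ck :: "nat \<Rightarrow> nat \<Rightarrow> (point \<Rightarrow> complex) \<Rightarrow> bool" where
  "Ck d 0 f \<longleftrightarrow> continuous_on (Rd d) f"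
| "Ck d (Suc k) f \<longleftrightarrow>
     continuous_on (Rd d) f \<and>
     (\<exists>g. (\<forall>(x\<^sub>1, x') \<in> Rd d. ((\<lambda>t. f (t, x')) has_vector_derivative g (x\<^sub>1, x')) (at x\<^sub>1)) \<and>
          Ck d k g) \<and>
     (\<forall>i \<in> {2..d}. \<exists>g. (\<forall>(x\<^sub>1, x') \<in> Rd d.
             ((\<lambda>t. f (x\<^sub>1, x'(i := t))) has_vector_derivative g (x\<^sub>1, x')) (at (x' i))) \<and>
          Ck d k g)"

definition test_functions :: "nat \<Rightarrow> (point \<Rightarrow> complex) set" where
  "test_functions d =
     {\<phi>. (\<forall>k. Ck d k \<phi>) \<and> (\<exists>K. compact K \<and> K \<subseteq> Rd d \<and> (\<forall>x \<in> Rd d - K. \<phi> x = 0))}"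


section \<open>Shear flows\<close>

definition shear_on_test_functions :: "nat \<Rightarrow> ((nat \<Rightarrow> real) \<Rightarrow> real) \<Rightarrow> point graph" where
  "shear_on_test_functions d \<psi> =
     {(\<phi>, \<lambda>(x\<^sub>1, x'). - \<i> * complex_of_real (\<psi> x') * vector_derivative (\<lambda>t. \<phi> (t, x')) (at x\<^sub>1)) | \<phi>.
        \<phi> \<in> test_functions d}"

definition shear_flow :: "nat \<Rightarrow> ((nat \<Rightarrow> real) \<Rightarrow> real) \<Rightarrow> point graph \<Rightarrow> bool" where
  "shear_flow d \<psi> H \<longleftrightarrow>
     \<psi> \<in> borel_measurable (cross_measure d) \<and>
     (\<exists>B. AE x' in cross_measure d. \<bar>\<psi> x'\<bar> \<le> B) \<and>
     (\<forall>x' \<in> cross_space d. 0 < \<psi> x') \<and>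
     self_adjoint (Rd_measure d) H \<and>
     shear_on_test_functions d \<psi> \<subseteq> H"

definition regular_shear_flow ::
    "nat \<Rightarrow> real \<Rightarrow> real \<Rightarrow> ((nat \<Rightarrow> real) \<Rightarrow> real) \<Rightarrow> point graph \<Rightarrow> bool" where
  "regular_shear_flow d \<l> L \<psi> H \<longleftrightarrow>
     shear_flow d \<psi> H \<and>
     0 < \<l> \<and>
     (\<forall>x' \<in> cross_space d. \<l> < \<psi> x') \<and>
     (\<forall>x' \<in> cross_space d. \<forall>y' \<in> cross_space d. \<bar>\<psi> x' - \<psi> y'\<bar> \<le> L * cross_dist d x' y')"


section \<open>Weighted spaces\<close>

definition weighted_space :: "nat \<Rightarrow> real \<Rightarrow> (point \<Rightarrow> complex) set" where
  "weighted_space d \<sigma> =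
     {r \<in> borel_measurable (Rd_measure d).
        integrable (Rd_measure d) (\<lambda>x. (1 + (fst x)\<^sup>2) powr \<sigma> * (cmod (r x))\<^sup>2)}"

definition weighted_norm :: "nat \<Rightarrow> real \<Rightarrow> (point \<Rightarrow> complex) \<Rightarrow> real" where
  "weighted_norm d \<sigma> r =
     sqrt (\<integral>x. (1 + (fst x)\<^sup>2) powr \<sigma> * (cmod (r x))\<^sup>2 \<partial>Rd_measure d)"

end

theory Submission
  imports Defs "HOL-Probability.Levy"
begin

text \<open>
  The unitary group generated by \<open>H\<close> should be \<open>U(t) f (x\<^sub>1, x') = f (x\<^sub>1 + t \<psi>(x'), x')\<close>. To see that
  \<open>(U(t) f, f)\<close> is the Fourier transform of the spectral measure of \<open>f\<close>, cut \<open>f\<close> into pieces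
  \<open>u = (E(b) - E(a)) f\<close> with \<open>b - a\<close> small: each is an approximate eigenvector, that is
  \<open>\<parallel>H u - a u\<parallel> \<le> (b - a) \<parallel>u\<parallel>\<close>, and since \<open>H = H\<^sup>*\<close> extends the operator on test functions, \<open>H u = -\<i> \<psi> \<partial>\<^sub>1 u\<close>
  weakly, so that \<open>\<parallel>U(t) u - exp (\<i> a t) u\<parallel> \<le> \<bar>t\<bar> (b - a) \<parallel>u\<parallel>\<close>.

  For \<open>f\<close> and \<open>g\<close> in the weighted space, \<open>\<sigma> > 1/2\<close> makes \<open>f(\<cdot>, x')\<close> and \<open>g(\<cdot>, x')\<close> integrable, and the substitution
  \<open>s = x\<^sub>1 + t \<psi>(x')\<close> shows that \<open>t \<mapsto> (U(t) f, g)\<close> is integrable with norm at most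
  \<open>\<ell>\<^sup>-\<^sup>1 \<parallel>f\<parallel> \<parallel>g\<parallel> \<integral> (1 + x\<^sup>2)\<^sup>-\<^sup>\<sigma> dx\<close>. By the inversion theorem of Levy the spectral measures then have
  the continuous densities \<open>(2\<pi>)\<^sup>-\<^sup>1 \<integral> exp (-\<i> t \<nu>) (U(t) f, g) dt\<close>.
\<close>

section \<open>Square-integrable functions\<close>

text \<open>The obstacle is that \<open>spectral_family\<close> speaks of H only through its domain
  and the diagonal values (H f, f), while the flow is tied to H only through test functions. The two
  sides meet in one inequality, assumed in \<open>spectral_group\<close>: exp(-\<i> c t) U(t) f
  departs from f at a speed of at most \<parallel>(H - c) f\<parallel>. On a band the form of H - a
  lies between 0 and b - a. A symmetric form with such bounds obeys a Cauchy-Schwarz inequality, and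
  this turns diagonal information into a norm bound on (H - a) u. For the flow, the weak equation is
  first localised to almost every line x' = const. There the flow is a translation with constant
  speed, and no derivative of \<psi> is ever taken. Levy's theorem gives densities for the diagonal
  forms; polarization carries them over to f and g. The resulting bound is uniform in the spectral
  parameter, and the factor 1 + \<open>\<bar>\<nu>\<^sub>0\<bar> * L / \<l>\<^sup>2\<close>, which
  is at least 1, is attached at the very end.\<close>

lemma le_sqrt_mult_sqrt:
  fixes x a b :: real
  assumes le: "\<And>s. 0 < s \<Longrightarrow> x \<le> (s * a + b / s) / 2" and a: "0 \<le> a" and b: "0 \<le> b"
  shows "x \<le> sqrt a * sqrt b"
proof (rule field_le_epsilon)
  fix e :: real assume e: "0 < e"
  define p q where "p = sqrt a" and "q = sqrt b"
  have pq: "0 \<le> p" "0 \<le> q" "a = p\<^sup>2" "b = q\<^sup>2" using a b by (auto simp: p_def q_def)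
  \<comment> \<open>The bound is smallest at s = q / p. Shifting both numbers by
    \<open>\<delta>\<close> keeps \<open>s\<close> positive and well defined when p or q vanishes,
    at a cost of at most \<open>\<delta> * (p + q + 1)\<close>, which the choice of
    \<open>\<delta>\<close> makes at most \<open>e\<close>.\<close>
  define \<delta> where "\<delta> = e / (p + q + e + 1)"
  have \<delta>: "0 < \<delta>" "\<delta> < 1" "\<delta> * (p + q + 1) \<le> e" 
  proof -
    have D: "0 < p + q + e + 1" using e pq by linarith
    show "0 < \<delta>" using D e by (simp add: \<delta>_def)
    show "\<delta> < 1" using D pq by (simp add: \<delta>_def)
    have "\<delta> * (p + q + 1) \<le> \<delta> * (p + q + e + 1)" using \<open>0 < \<delta>\<close> e by (intro mult_left_mono) auto
    also have "\<dots> = e" using D by (simp add: \<delta>_def)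
    finally show "\<delta> * (p + q + 1) \<le> e" .
  qed
  define s where "s = (q + \<delta>) / (p + \<delta>)"
  have s: "0 < s" using pq \<delta> unfolding s_def by (intro divide_pos_pos add_nonneg_pos) auto
  have "s * a \<le> (q + \<delta>) * p"
  proof -
    have "p * p \<le> p * (p + \<delta>)" using pq \<delta> by (intro mult_left_mono) auto
    hence "p * p / (p + \<delta>) \<le> p" using pq \<delta> by (subst pos_divide_le_eq) (auto intro: add_nonneg_pos)
    hence "(q + \<delta>) * (p * p / (p + \<delta>)) \<le> (q + \<delta>) * p" using pq \<delta> by (intro mult_left_mono) auto
    thus ?thesis by (simp add: s_def pq power2_eq_square)
  qed
  moreover have "b / s \<le> (p + \<delta>) * q"
  proof -
    have "q * q \<le> q * (q + \<delta>)" using pq \<delta> by (intro mult_left_mono) auto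
    hence "q * q / (q + \<delta>) \<le> q" using pq \<delta> by (subst pos_divide_le_eq) (auto intro: add_nonneg_pos)
    hence "(p + \<delta>) * (q * q / (q + \<delta>)) \<le> (p + \<delta>) * q" using pq \<delta> by (intro mult_left_mono) auto
    thus ?thesis by (simp add: s_def pq power2_eq_square mult.commute)
  qed
  ultimately have "(s * a + b / s) / 2 \<le> ((q + \<delta>) * p + (p + \<delta>) * q) / 2"
    by (intro divide_right_mono add_mono) auto
  hence "x \<le> ((q + \<delta>) * p + (p + \<delta>) * q) / 2" using le[OF s] by (rule order_trans[rotated])
  also have "\<dots> = p * q + \<delta> * (p + q) / 2" by (simp add: field_simps)
  also have "\<dots> \<le> p * q + \<delta> * (p + q + 1)" using pq \<delta> by (simp add: algebra_simps)
  also have "\<dots> \<le> p * q + e" using \<delta> by simp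
  finally show "x \<le> sqrt a * sqrt b + e" by (simp add: p_def q_def)
qed

lemma borel_measurable_cnj [measurable (raw)]:
  "f \<in> borel_measurable M \<Longrightarrow> (\<lambda>x. cnj (f x)) \<in> borel_measurable M"
  using measurable_compose[of f M borel cnj borel]
  by (simp add: borel_measurable_continuous_onI continuous_on_cnj continuous_on_id)

lemma L2_measurable: "f \<in> L2 M \<Longrightarrow> f \<in> borel_measurable M"
  and L2_integrable: "f \<in> L2 M \<Longrightarrow> integrable M (\<lambda>x. (cmod (f x))\<^sup>2)"
  by (auto simp: L2_def)

lemma L2I: "f \<in> borel_measurable M \<Longrightarrow> integrable M (\<lambda>x. (cmod (f x))\<^sup>2) \<Longrightarrow> f \<in> L2 M"
  by (auto simp: L2_def)

lemma L2_dominated: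
  assumes "g \<in> L2 M" "f \<in> borel_measurable M" "\<And>x. x \<in> space M \<Longrightarrow> cmod (f x) \<le> C * cmod (g x)"
  shows "f \<in> L2 M"
proof (rule L2I[OF assms(2)], rule Bochner_Integration.integrable_bound)
  show "integrable M (\<lambda>x. C\<^sup>2 * (cmod (g x))\<^sup>2)" using L2_integrable[OF assms(1)] by simp
  show "AE x in M. norm ((cmod (f x))\<^sup>2) \<le> norm (C\<^sup>2 * (cmod (g x))\<^sup>2)"
    using assms(3) by (auto simp: power_mult_distrib[symmetric] intro!: AE_I2 power_mono)
qed (use assms in measurable)

lemma L2_scale [intro]: "f \<in> L2 M \<Longrightarrow> (\<lambda>x. c * f x) \<in> L2 M"
  by (rule L2_dominated[where C = "cmod c"]) (auto simp: norm_mult dest: L2_measurable)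

lemma L2_add [intro]:
  assumes "f \<in> L2 M" "g \<in> L2 M" shows "(\<lambda>x. f x + g x) \<in> L2 M"
proof (rule L2I, use assms[THEN L2_measurable] in measurable, rule Bochner_Integration.integrable_bound)
  show "integrable M (\<lambda>x. 2 * (cmod (f x))\<^sup>2 + 2 * (cmod (g x))\<^sup>2)"
    using assms[THEN L2_integrable] by simp
  show "AE x in M. norm ((cmod (f x + g x))\<^sup>2) \<le> norm (2 * (cmod (f x))\<^sup>2 + 2 * (cmod (g x))\<^sup>2)"
  proof (rule AE_I2)
    fix x
    have "(cmod (f x + g x))\<^sup>2 \<le> (cmod (f x) + cmod (g x))\<^sup>2"
      by (intro power_mono norm_triangle_ineq) auto
    also have "\<dots> \<le> 2 * (cmod (f x))\<^sup>2 + 2 * (cmod (g x))\<^sup>2"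
      using zero_le_power2[of "cmod (f x) - cmod (g x)"] by (simp add: power2_sum power2_diff)
    finally show "norm ((cmod (f x + g x))\<^sup>2) \<le> norm (2 * (cmod (f x))\<^sup>2 + 2 * (cmod (g x))\<^sup>2)"
      by simp
  qed
qed (use assms[THEN L2_measurable] in measurable)

lemma L2_diff [intro]: "f \<in> L2 M \<Longrightarrow> g \<in> L2 M \<Longrightarrow> (\<lambda>x. f x - g x) \<in> L2 M"
  using L2_add[OF _ L2_scale[of g M "-1"]] by simp

lemma L2_zero [simp]: "(\<lambda>x. 0) \<in> L2 M"
  by (auto simp: L2_def)

lemma L2_mult_integrable:
  assumes "f \<in> L2 M" "g \<in> L2 M" shows "integrable M (\<lambda>x. f x * cnj (g x))"
proof (rule Bochner_Integration.integrable_bound)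
  show "integrable M (\<lambda>x. (cmod (f x))\<^sup>2 + (cmod (g x))\<^sup>2)"
    using assms[THEN L2_integrable] by simp
  show "AE x in M. norm (f x * cnj (g x)) \<le> norm ((cmod (f x))\<^sup>2 + (cmod (g x))\<^sup>2)"
  proof (rule AE_I2)
    fix x have "cmod (f x) * cmod (g x) \<le> (cmod (f x))\<^sup>2 + (cmod (g x))\<^sup>2"
      using zero_le_power2[of "cmod (f x) - cmod (g x)"] 
        mult_nonneg_nonneg[OF norm_ge_zero norm_ge_zero, of "f x" "g x"]
      unfolding power2_diff by linarith
    thus "norm (f x * cnj (g x)) \<le> norm ((cmod (f x))\<^sup>2 + (cmod (g x))\<^sup>2)"
      by (simp add: norm_mult)
  qed
qed (use assms[THEN L2_measurable] in measurable)

lemma L2_inner_add_left: "f \<in> L2 M \<Longrightarrow> g \<in> L2 M \<Longrightarrow> h \<in> L2 M \<Longrightarrow>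
    L2_inner M (\<lambda>x. f x + g x) h = L2_inner M f h + L2_inner M g h"
  by (simp add: L2_inner_def distrib_right L2_mult_integrable)

lemma L2_inner_diff_left: "f \<in> L2 M \<Longrightarrow> g \<in> L2 M \<Longrightarrow> h \<in> L2 M \<Longrightarrow>
    L2_inner M (\<lambda>x. f x - g x) h = L2_inner M f h - L2_inner M g h"
  by (simp add: L2_inner_def left_diff_distrib L2_mult_integrable)

lemma L2_inner_scale_left: "L2_inner M (\<lambda>x. c * f x) h = c * L2_inner M f h"
  by (simp add: L2_inner_def mult.assoc)

lemma L2_inner_cnj: "cnj (L2_inner M f g) = L2_inner M g f"
  using Bochner_Integration.integral_cnj[of M "\<lambda>x. f x * cnj (g x)"] by (simp add: L2_inner_def mult.commute)

lemma L2_inner_add_right: "f \<in> L2 M \<Longrightarrow> g \<in> L2 M \<Longrightarrow> h \<in> L2 M \<Longrightarrow>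
    L2_inner M h (\<lambda>x. f x + g x) = L2_inner M h f + L2_inner M h g"
  by (subst (1 2 3) L2_inner_cnj[symmetric]) (simp add: L2_inner_add_left)

lemma L2_inner_diff_right: "f \<in> L2 M \<Longrightarrow> g \<in> L2 M \<Longrightarrow> h \<in> L2 M \<Longrightarrow>
    L2_inner M h (\<lambda>x. f x - g x) = L2_inner M h f - L2_inner M h g"
  by (subst (1 2 3) L2_inner_cnj[symmetric]) (simp add: L2_inner_diff_left)

lemma L2_inner_scale_right: "L2_inner M h (\<lambda>x. c * f x) = cnj c * L2_inner M h f"
  by (subst (1 2) L2_inner_cnj[symmetric]) (simp add: L2_inner_scale_left)

lemmas L2_inner_linear =
  L2_inner_add_left L2_inner_diff_left L2_inner_scale_left
  L2_inner_add_right L2_inner_diff_right L2_inner_scale_right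

lemma L2_inner_cong_AE:
  assumes "f \<in> L2 M" "f' \<in> L2 M" "AE x in M. f x = f' x" "h \<in> L2 M"
  shows "L2_inner M f h = L2_inner M f' h"
  unfolding L2_inner_def
proof (rule integral_cong_AE)
  note [measurable] = assms(1,2,4)[THEN L2_measurable]
  show "(\<lambda>x. f x * cnj (h x)) \<in> borel_measurable M" "(\<lambda>x. f' x * cnj (h x)) \<in> borel_measurable M"
    by measurable
qed (use assms(3) in eventually_elim, simp)

lemma L2_norm_nonneg [simp]: "0 \<le> L2_norm M f"
  by (auto simp: L2_norm_def)

lemma L2_norm_power2: "(L2_norm M f)\<^sup>2 = (\<integral>x. (cmod (f x))\<^sup>2 \<partial>M)"
  by (simp add: L2_norm_def)

lemma L2_inner_self: "L2_inner M f f = of_real ((L2_norm M f)\<^sup>2)"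
  unfolding L2_inner_def L2_norm_power2 complex_norm_square[symmetric] of_real_power[symmetric]
  by (rule integral_complex_of_real)

lemma L2_norm_scale: "L2_norm M (\<lambda>x. c * f x) = cmod c * L2_norm M f"
  by (simp add: L2_norm_def norm_mult power_mult_distrib real_sqrt_mult)

lemma L2_norm_zero [simp]: "L2_norm M (\<lambda>x. 0) = 0"
  by (simp add: L2_norm_def)

lemma L2_Cauchy_Schwarz:
  assumes "f \<in> L2 M" "g \<in> L2 M" shows "cmod (L2_inner M f g) \<le> L2_norm M f * L2_norm M g"
  unfolding L2_norm_def
proof (rule le_sqrt_mult_sqrt)
  fix s :: real assume s: "0 < s"
  have "cmod (L2_inner M f g) \<le> (\<integral>x. cmod (f x * cnj (g x)) \<partial>M)"
    unfolding L2_inner_def by (rule integral_norm_bound)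
  also have "\<dots> \<le> (\<integral>x. (s * (cmod (f x))\<^sup>2 + (cmod (g x))\<^sup>2 / s) / 2 \<partial>M)"
  proof (rule integral_mono)
    show "integrable M (\<lambda>x. cmod (f x * cnj (g x)))"
      using L2_mult_integrable[OF assms] by (rule integrable_norm)
    show "integrable M (\<lambda>x. (s * (cmod (f x))\<^sup>2 + (cmod (g x))\<^sup>2 / s) / 2)"
      using assms[THEN L2_integrable] by simp
    fix x
    have "0 \<le> (s * cmod (f x) - cmod (g x))\<^sup>2 / s" using s by simp
    thus "cmod (f x * cnj (g x)) \<le> (s * (cmod (f x))\<^sup>2 + (cmod (g x))\<^sup>2 / s) / 2"
      using s by (simp add: power2_diff norm_mult field_simps power2_eq_square)
  qed
  also have "\<dots> = (s * (\<integral>x. (cmod (f x))\<^sup>2 \<partial>M) + (\<integral>x. (cmod (g x))\<^sup>2 \<partial>M) / s) / 2"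
    using assms[THEN L2_integrable] by simp
  finally show "cmod (L2_inner M f g) \<le> \<dots>" .
qed auto

lemma L2_norm_add_square:
  assumes "f \<in> L2 M" "g \<in> L2 M"
  shows "(L2_norm M (\<lambda>x. f x + g x))\<^sup>2 = (L2_norm M f)\<^sup>2 + (L2_norm M g)\<^sup>2 + 2 * Re (L2_inner M f g)"
proof -
  have "complex_of_real ((L2_norm M (\<lambda>x. f x + g x))\<^sup>2) = 
    of_real ((L2_norm M f)\<^sup>2) + of_real ((L2_norm M g)\<^sup>2) + (L2_inner M f g + cnj (L2_inner M f g))"
    unfolding L2_inner_self[symmetric] L2_inner_cnj using assms by (simp add: L2_inner_linear L2_add)
  also have "L2_inner M f g + cnj (L2_inner M f g) = of_real (2 * Re (L2_inner M f g))"
    by (simp add: complex_add_cnj)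
  finally show ?thesis unfolding of_real_add[symmetric] of_real_eq_iff .
qed

lemma L2_norm_triangle:
  assumes "f \<in> L2 M" "g \<in> L2 M"
  shows "L2_norm M (\<lambda>x. f x + g x) \<le> L2_norm M f + L2_norm M g"
proof (rule power2_le_imp_le)
  have "Re (L2_inner M f g) \<le> L2_norm M f * L2_norm M g"
    using L2_Cauchy_Schwarz[OF assms] complex_Re_le_cmod order_trans by blast
  thus "(L2_norm M (\<lambda>x. f x + g x))\<^sup>2 \<le> (L2_norm M f + L2_norm M g)\<^sup>2"
    unfolding L2_norm_add_square[OF assms] power2_sum by simp
qed simp

lemma L2_norm_minus_commute: "L2_norm M (\<lambda>x. f x - g x) = L2_norm M (\<lambda>x. g x - f x)"
  by (simp add: L2_norm_def norm_minus_commute)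

lemma L2_norm_triangle3:
  assumes "f \<in> L2 M" "g \<in> L2 M" "h \<in> L2 M"
  shows "L2_norm M (\<lambda>x. f x - h x) \<le> L2_norm M (\<lambda>x. f x - g x) + L2_norm M (\<lambda>x. g x - h x)"
  using L2_norm_triangle[of "\<lambda>x. f x - g x" M "\<lambda>x. g x - h x"] assms by (simp add: L2_diff)

lemma L2_norm_cong_AE:
  assumes "f \<in> L2 M" "f' \<in> L2 M" "AE x in M. f x = f' x"
  shows "L2_norm M f = L2_norm M f'"
  unfolding L2_norm_def
proof (rule arg_cong[where f = sqrt], rule integral_cong_AE)
  note [measurable] = assms(1,2)[THEN L2_measurable]
  show "(\<lambda>x. (cmod (f x))\<^sup>2) \<in> borel_measurable M" "(\<lambda>x. (cmod (f' x))\<^sup>2) \<in> borel_measurable M"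
    by measurable
qed (use assms(3) in eventually_elim, simp)

text \<open>The functional h \<mapsto> (v, h) can be estimated directly only on a dense set: on
  \<open>Domain H\<close> for approximate eigenvectors, on \<open>evolution_tests\<close> for the
  flow. Continuity carries the bound to all h, in particular to h = v, where
  \<open>L2_norm_le_of_inner\<close> turns it into a norm bound.\<close>

lemma L2_bound_by_dense:
  assumes v: "v \<in> L2 M" and S: "S \<subseteq> L2 M" and C: "0 \<le> C"
    and dense: "\<And>f e. f \<in> L2 M \<Longrightarrow> 0 < e \<Longrightarrow> \<exists>h\<in>S. L2_norm M (\<lambda>x. f x - h x) < e"
    and bound: "\<And>h. h \<in> S \<Longrightarrow> cmod (L2_inner M v h) \<le> C * L2_norm M h"
    and h: "h \<in> L2 M"
  shows "cmod (L2_inner M v h) \<le> C * L2_norm M h"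
proof (rule field_le_epsilon)
  fix e :: real assume e: "0 < e"
  define \<delta> where "\<delta> = e / (L2_norm M v + C + 1)"
  have pos: "0 < L2_norm M v + C + 1" using C by (simp add: add_nonneg_pos)
  have \<delta>: "0 < \<delta>" using e pos by (simp add: \<delta>_def)
  obtain g where g: "g \<in> S" "L2_norm M (\<lambda>x. h x - g x) < \<delta>" using dense[OF h \<delta>] by blast
  have gL: "g \<in> L2 M" using g S by blast
  have "L2_norm M g \<le> L2_norm M h + L2_norm M (\<lambda>x. g x - h x)"
    using L2_norm_triangle[OF h L2_diff[OF gL h]] by simp
  also have "L2_norm M (\<lambda>x. g x - h x) = L2_norm M (\<lambda>x. h x - g x)" by (rule L2_norm_minus_commute)
  finally have ng: "L2_norm M g \<le> L2_norm M h + \<delta>" using g by linarith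
  have "L2_inner M v h = L2_inner M v g + L2_inner M v (\<lambda>x. h x - g x)"
    using v h gL by (simp add: L2_inner_linear)
  hence "cmod (L2_inner M v h) \<le> cmod (L2_inner M v g) + cmod (L2_inner M v (\<lambda>x. h x - g x))"
    by (simp add: norm_triangle_ineq)
  also have "\<dots> \<le> C * (L2_norm M h + \<delta>) + L2_norm M v * \<delta>"
  proof (rule add_mono)
    show "cmod (L2_inner M v g) \<le> C * (L2_norm M h + \<delta>)"
      using bound[OF g(1)] mult_left_mono[OF ng C] by linarith
    show "cmod (L2_inner M v (\<lambda>x. h x - g x)) \<le> L2_norm M v * \<delta>"
      by (rule order_trans[OF L2_Cauchy_Schwarz[OF v L2_diff[OF h gL]]])
         (use g in \<open>auto intro!: mult_left_mono\<close>)
  qed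
  also have "\<dots> \<le> C * L2_norm M h + \<delta> * (L2_norm M v + C + 1)" using \<delta> by (simp add: algebra_simps)
  also have "\<dots> = C * L2_norm M h + e" using pos by (simp add: \<delta>_def)
  finally show "cmod (L2_inner M v h) \<le> C * L2_norm M h + e" .
qed

lemma L2_norm_le_of_inner:
  assumes "v \<in> L2 M" "cmod (L2_inner M v v) \<le> C * L2_norm M v" "0 \<le> C"
  shows "L2_norm M v \<le> C"
proof (cases "L2_norm M v = 0")
  case False
  hence "L2_norm M v * L2_norm M v \<le> C * L2_norm M v" 
    using assms(2) by (simp add: L2_inner_self power2_eq_square norm_mult)
  thus ?thesis using False L2_norm_nonneg[of M v] by (simp add: less_le)
qed (use assms in simp)

section \<open>Spectral families\<close>

lemma iexp_diff_le: "cmod (iexp x - iexp y) \<le> \<bar>x - y\<bar>"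
proof -
  have "iexp x - iexp y = 
      iexp y * (iexp (x - y) - 1)"
    by (simp add: exp_add[symmetric] algebra_simps)
  thus ?thesis using iexp_approx1[of "x - y" 0] by (simp add: norm_mult)
qed

text \<open>Finite Borel measures on the line are determined by their distribution functions, so the
  sum is built as a measure \<open>N\<close> and identified with \<open>M\<close> through
  \<open>cdf\<close>. It serves to split the spectral measure of a sum of two spectrally orthogonal
  vectors.\<close>

lemma emeasure_interval_measure_add:
  fixes M1 M2 M :: "real measure"
  assumes "finite_borel_measure M1" "finite_borel_measure M2" "finite_borel_measure M"
    and cdf: "\<And>x. cdf M x = cdf M1 x + cdf M2 x" and A: "A \<in> sets borel"
  shows "emeasure M A = emeasure M1 A + emeasure M2 A"
proof -
  interpret M1: finite_borel_measure M1 by fact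
  interpret M2: finite_borel_measure M2 by fact
  interpret M: finite_borel_measure M by fact
  define N where "N = measure_of UNIV (sets borel) (\<lambda>A. emeasure M1 A + emeasure M2 A)"
  have sN: "sets N = sets borel" unfolding N_def
    using sets.sigma_sets_eq[of "borel :: real measure"] by (simp add: sets_measure_of)
  have eN: "emeasure N A = emeasure M1 A + emeasure M2 A" if "A \<in> sets borel" for A
  proof (rule emeasure_measure_of[OF N_def])
    show "A \<in> sets N" using that sN by simp
    show "positive (sets N) (\<lambda>A. emeasure M1 A + emeasure M2 A)" by (simp add: positive_def)
    show "countably_additive (sets N) (\<lambda>A. emeasure M1 A + emeasure M2 A)"
      unfolding sN countably_additive_def
    proof (intro allI impI)
      fix A :: "nat \<Rightarrow> real set" assume A: "range A \<subseteq> sets borel" "disjoint_family A" 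
      show "(\<Sum>i. emeasure M1 (A i) + emeasure M2 (A i)) = emeasure M1 (\<Union>(range A)) + emeasure M2 (\<Union>(range A))"
        using A by (subst suminf_add[symmetric]) (auto simp: suminf_emeasure M1.M_is_borel M2.M_is_borel)
    qed
  qed simp
  have "emeasure N (space N) \<noteq> \<infinity>" 
    using sets_eq_imp_space_eq[OF sN] M1.emeasure_finite M2.emeasure_finite by (simp add: eN)
  hence "finite_measure N" by (rule finite_measureI)
  hence fN: "finite_borel_measure N"
    using sN by (simp add: finite_borel_measure_def finite_borel_measure_axioms_def)
  have "cdf N = cdf M"
  proof (rule ext)
    fix x show "cdf N x = cdf M x" unfolding cdf unfolding cdf_def measure_def
      by (simp add: eN enn2real_plus M1.emeasure_finite M2.emeasure_finite less_top[symmetric])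
  qed
  hence "N = M" by (rule cdf_unique'[OF fN assms(3)])
  thus ?thesis using eN[OF A] by simp
qed

lemma nn_integral_measure_add:
  assumes "sets M1 = sets M" "sets M2 = sets M"
    and "\<And>A. A \<in> sets M \<Longrightarrow> emeasure M A = emeasure M1 A + emeasure M2 A"
    and f: "f \<in> borel_measurable M"
  shows "nn_integral M f = nn_integral M1 f + nn_integral M2 f"
  using f
proof (induction rule: borel_measurable_induct)
  have [measurable_cong]: "sets M1 = sets M" "sets M2 = sets M" by fact+
  have sp: "space M1 = space M" "space M2 = space M" using assms(1,2) by (auto dest: sets_eq_imp_space_eq)
  {
    case (cong f g)
    have "nn_integral M f = nn_integral M g" "nn_integral M1 f = nn_integral M1 g"
      "nn_integral M2 f = nn_integral M2 g"
      using cong(3) by (auto intro!: nn_integral_cong simp: sp)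
    thus ?case using cong(4) by simp
  next
    case (set A)
    thus ?case using assms by simp
  next
    case (mult u c)
    note [measurable] = mult.hyps(2)
    show ?case using mult.IH by (simp add: nn_integral_cmult distrib_left)
  next
    case (add u v)
    have [measurable]: "u \<in> borel_measurable M" "v \<in> borel_measurable M" by fact+
    show ?case using add.IH by (simp add: nn_integral_add algebra_simps)
  next
    case (seq U)
    have [measurable]: "\<And>i. U i \<in> borel_measurable M" by fact
    have inc: "incseq (\<lambda>i. integral\<^sup>N N (U i))" for N
      using \<open>incseq U\<close> by (auto simp: incseq_def le_fun_def intro!: nn_integral_mono)
    show ?case
      using seq.IH \<open>incseq U\<close> by (simp add: nn_integral_monotone_convergence_SUP image_comp SUP_apply ennreal_SUP_add inc)
  }
qed

lemma integral_measure_add: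
  fixes f :: "'a \<Rightarrow> real"
  assumes "sets M1 = sets M" "sets M2 = sets M"
    and "\<And>A. A \<in> sets M \<Longrightarrow> emeasure M A = emeasure M1 A + emeasure M2 A"
    and "integrable M f" "integrable M1 f" "integrable M2 f"
  shows "integral\<^sup>L M f = integral\<^sup>L M1 f + integral\<^sup>L M2 f"
proof -
  have [measurable]: "f \<in> borel_measurable M" using assms(4) by auto
  note nn_integral_measure_add[OF assms(1-3)]
  moreover have "(\<integral>\<^sup>+x. ennreal (f x) \<partial>N) \<noteq> \<infinity>" "(\<integral>\<^sup>+x. ennreal (- f x) \<partial>N) \<noteq> \<infinity>" if "integrable N f" for N
    using that by (auto simp: real_integrable_def)
  ultimately show ?thesis
    using assms(4-6) by (simp add: real_lebesgue_integral_def enn2real_plus less_top)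
qed

section \<open>Calculus of a resolution of the identity and its self-adjoint operator\<close>

locale spectral =
  fixes M :: "'a measure" and H :: "'a graph" and E :: "real \<Rightarrow> ('a \<Rightarrow> complex) \<Rightarrow> ('a \<Rightarrow> complex)"
  assumes self_adjoint: "self_adjoint M H" and spectral_family: "spectral_family M H E"
begin

abbreviation inn where "inn \<equiv> L2_inner M"
abbreviation nrm where "nrm \<equiv> L2_norm M"
abbreviation spm where "spm f \<equiv> spectral_measure M E f"

lemma H_L2: assumes "(f, k) \<in> H" shows "f \<in> L2 M" "k \<in> L2 M"
  using assms self_adjoint by (auto simp: self_adjoint_def)

lemma H_iff: "(g, k) \<in> H \<longleftrightarrow> g \<in> L2 M \<and> k \<in> L2 M \<and> (\<forall>(f, h) \<in> H. inn h g = inn f k)"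
proof -
  have "H = adjoint_graph M H" using self_adjoint by (simp add: self_adjoint_def)
  hence "(g, k) \<in> H \<longleftrightarrow> (g, k) \<in> adjoint_graph M H" by simp
  thus ?thesis by (simp add: adjoint_graph_def)
qed

lemma H_sym: "(f, k) \<in> H \<Longrightarrow> (g, m) \<in> H \<Longrightarrow> inn k g = inn f m"
  using H_iff[of g m] by auto

lemma H_add:
  assumes "(f, k) \<in> H" "(g, m) \<in> H" shows "((\<lambda>x. f x + g x), (\<lambda>x. k x + m x)) \<in> H"
  unfolding H_iff using assms
  by (auto simp: L2_inner_linear H_L2 H_sym)

lemma H_scale:
  assumes "(f, k) \<in> H" shows "((\<lambda>x. c * f x), (\<lambda>x. c * k x)) \<in> H"
  unfolding H_iff using assms by (auto simp: L2_inner_linear H_L2 H_sym)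

lemma H_diff: "(f, k) \<in> H \<Longrightarrow> (g, m) \<in> H \<Longrightarrow> ((\<lambda>x. f x - g x), (\<lambda>x. k x - m x)) \<in> H"
  using H_add[OF _ H_scale[of g m "-1"]] by simp

lemma H_dense: "f \<in> L2 M \<Longrightarrow> 0 < e \<Longrightarrow> \<exists>u \<in> Domain H. nrm (\<lambda>x. f x - u x) < e"
  using self_adjoint by (auto simp: self_adjoint_def densely_defined_def)

lemma roi: "resolution_of_identity M E"
  using spectral_family by (simp add: spectral_family_def)

lemma E_L2 [simp]: "f \<in> L2 M \<Longrightarrow> E \<nu> f \<in> L2 M"
  and E_sym: "f \<in> L2 M \<Longrightarrow> g \<in> L2 M \<Longrightarrow> inn (E \<nu> f) g = inn f (E \<nu> g)"
  using roi by (auto simp: resolution_of_identity_def orthogonal_projection_def)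

text \<open>The definition of a resolution covers only the case where the outer index is the smaller
  one; the other order follows by passing to adjoints. Equality is stated inside an inner product
  because it holds only almost everywhere.\<close>

lemma E_E:
  assumes f: "f \<in> L2 M" and g: "g \<in> L2 M"
  shows "inn (E \<kappa> (E \<nu> f)) g = inn (E (min \<kappa> \<nu>) f) g"
proof -
  have *: "inn (E \<kappa> (E \<nu> f)) g = inn (E \<kappa> f) g" if "\<kappa> \<le> \<nu>" "f \<in> L2 M" "g \<in> L2 M" for \<kappa> \<nu> f g
  proof (rule L2_inner_cong_AE)
    show "AE x in M. E \<kappa> (E \<nu> f) x = E \<kappa> f x"
      using roi that by (simp add: resolution_of_identity_def)
  qed (use that in simp_all)
  show ?thesis
  proof (cases "\<kappa> \<le> \<nu>")
    case False
    have "inn (E \<kappa> (E \<nu> f)) g = cnj (inn (E \<nu> (E \<kappa> g)) f)"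
      using f g by (simp add: E_sym L2_inner_cnj)
    also have "inn (E \<nu> (E \<kappa> g)) f = inn (E \<nu> g) f" using False by (intro *) (auto simp: f g)
    also have "cnj \<dots> = inn (E \<nu> f) g" using f g by (simp add: E_sym L2_inner_cnj)
    finally show ?thesis using False by simp
  qed (use * f g in simp)
qed

lemma E_E_inner: "f \<in> L2 M \<Longrightarrow> g \<in> L2 M \<Longrightarrow> inn (E \<kappa> f) (E \<nu> g) = inn (E (min \<kappa> \<nu>) f) g"
  using E_E[of f g \<nu> \<kappa>] by (simp add: E_sym min.commute)

lemma E_add: "f \<in> L2 M \<Longrightarrow> g \<in> L2 M \<Longrightarrow> h \<in> L2 M \<Longrightarrow>
    inn (E \<nu> (\<lambda>x. f x + g x)) h = inn (E \<nu> f) h + inn (E \<nu> g) h"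
  by (simp add: E_sym L2_inner_linear L2_add)

lemma E_diff: "f \<in> L2 M \<Longrightarrow> g \<in> L2 M \<Longrightarrow> h \<in> L2 M \<Longrightarrow>
    inn (E \<nu> (\<lambda>x. f x - g x)) h = inn (E \<nu> f) h - inn (E \<nu> g) h"
  by (simp add: E_sym L2_inner_linear L2_diff)

lemma E_scale: "f \<in> L2 M \<Longrightarrow> h \<in> L2 M \<Longrightarrow> inn (E \<nu> (\<lambda>x. c * f x)) h = c * inn (E \<nu> f) h"
  by (simp add: E_sym L2_inner_linear L2_scale)

definition F :: "('a \<Rightarrow> complex) \<Rightarrow> real \<Rightarrow> real" where
  "F f \<nu> = Re (inn (E \<nu> f) f)"

lemma spm_eq: "spm f = interval_measure (F f)"
  by (simp add: spectral_measure_def F_def[abs_def])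

lemma inner_E_self: "f \<in> L2 M \<Longrightarrow> inn (E \<nu> f) f = of_real ((nrm (E \<nu> f))\<^sup>2)"
  using E_E_inner[of f f \<nu> \<nu>] by (simp add: L2_inner_self)

lemma F_eq_norm: "f \<in> L2 M \<Longrightarrow> F f \<nu> = (nrm (E \<nu> f))\<^sup>2"
  by (simp add: F_def inner_E_self)

lemma inner_E_F: "f \<in> L2 M \<Longrightarrow> inn (E \<nu> f) f = of_real (F f \<nu>)"
  by (simp add: F_eq_norm inner_E_self)

text \<open>The spectral projection onto the half-open interval (a, b].\<close>

definition band :: "real \<Rightarrow> real \<Rightarrow> ('a \<Rightarrow> complex) \<Rightarrow> ('a \<Rightarrow> complex)" where
  "band a b f = (\<lambda>x. E b f x - E a f x)"

lemma band_L2 [simp]: "f \<in> L2 M \<Longrightarrow> band a b f \<in> L2 M"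
  by (auto simp: band_def)

lemma band_inner: "f \<in> L2 M \<Longrightarrow> g \<in> L2 M \<Longrightarrow> inn (band a b f) g = inn (E b f) g - inn (E a f) g"
  by (simp add: band_def L2_inner_linear)

lemma band_sym: "f \<in> L2 M \<Longrightarrow> g \<in> L2 M \<Longrightarrow> inn (band a b f) g = inn f (band a b g)"
  by (simp add: band_def L2_inner_linear E_sym)

lemma E_band: "f \<in> L2 M \<Longrightarrow> g \<in> L2 M \<Longrightarrow>
    inn (E \<nu> (band a b f)) g = inn (E (min \<nu> b) f) g - inn (E (min \<nu> a) f) g"
  unfolding band_def by (simp add: E_diff E_E)

lemma band_band:
  assumes "a \<le> b" "f \<in> L2 M" "g \<in> L2 M"
  shows "inn (band a b (band a b f)) g = inn (band a b f) g"
  using assms by (simp add: band_inner E_band min_absorb1 min_absorb2)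

lemma norm_band:
  assumes "a \<le> b" "f \<in> L2 M" shows "(nrm (band a b f))\<^sup>2 = F f b - F f a"
proof -
  have "complex_of_real ((nrm (band a b f))\<^sup>2) = inn (band a b (band a b f)) f"
    using assms by (simp only: L2_inner_self[symmetric]) (simp add: band_sym)
  also have "\<dots> = of_real (F f b - F f a)" using assms by (simp only: band_band) (simp add: band_inner inner_E_F)
  finally show ?thesis using of_real_eq_iff by blast
qed

lemma F_mono: assumes "f \<in> L2 M" "a \<le> b" shows "F f a \<le> F f b"
  using norm_band[OF assms(2,1)] zero_le_power2[of "nrm (band a b f)"] by linarith

lemma F_right_cont: assumes f: "f \<in> L2 M" shows "continuous (at_right a) (F f)"
  unfolding continuous_within
proof (rule LIM_zero_cancel, rule Lim_null_comparison)
  have "((\<lambda>\<kappa>. nrm (\<lambda>x. E \<kappa> f x - E a f x)) \<longlongrightarrow> 0) (at_right a)"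
    using roi f by (simp add: resolution_of_identity_def)
  from tendsto_mult_left_zero[OF this, of "nrm f"]
  show "((\<lambda>\<kappa>. nrm (\<lambda>x. E \<kappa> f x - E a f x) * nrm f) \<longlongrightarrow> 0) (at_right a)" by simp
  show "\<forall>\<^sub>F \<kappa> in at_right a. norm (F f \<kappa> - F f a) \<le> nrm (\<lambda>x. E \<kappa> f x - E a f x) * nrm f"
  proof (rule always_eventually, rule allI)
    fix \<kappa>
    have "F f \<kappa> - F f a = Re (inn (\<lambda>x. E \<kappa> f x - E a f x) f)"
      using f by (simp add: F_def L2_inner_linear)
    hence "norm (F f \<kappa> - F f a) \<le> cmod (inn (\<lambda>x. E \<kappa> f x - E a f x) f)"
      using abs_Re_le_cmod by simp
    also have "\<dots> \<le> nrm (\<lambda>x. E \<kappa> f x - E a f x) * nrm f"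
      using f by (intro L2_Cauchy_Schwarz) auto
    finally show "norm (F f \<kappa> - F f a) \<le> nrm (\<lambda>x. E \<kappa> f x - E a f x) * nrm f" .
  qed
qed

lemma F_at_bot: assumes f: "f \<in> L2 M" shows "(F f \<longlongrightarrow> 0) at_bot"
proof -
  have "((\<lambda>\<kappa>. nrm (E \<kappa> f)) \<longlongrightarrow> 0) at_bot"
    using roi f by (simp add: resolution_of_identity_def)
  moreover have "F f = (\<lambda>\<nu>. (nrm (E \<nu> f))\<^sup>2)" using f by (intro ext) (rule F_eq_norm)
  ultimately show ?thesis using tendsto_power[of _ 0 _ 2] by fastforce
qed

lemma F_at_top: assumes f: "f \<in> L2 M" shows "(F f \<longlongrightarrow> (nrm f)\<^sup>2) at_top"
proof (rule LIM_zero_cancel, rule Lim_null_comparison)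
  have "((\<lambda>\<kappa>. nrm (\<lambda>x. E \<kappa> f x - f x)) \<longlongrightarrow> 0) at_top"
    using roi f by (simp add: resolution_of_identity_def)
  from tendsto_mult_left_zero[OF this, of "nrm f"]
  show "((\<lambda>\<kappa>. nrm (\<lambda>x. E \<kappa> f x - f x) * nrm f) \<longlongrightarrow> 0) at_top" by simp
  show "\<forall>\<^sub>F \<kappa> in at_top. norm (F f \<kappa> - (nrm f)\<^sup>2) \<le> nrm (\<lambda>x. E \<kappa> f x - f x) * nrm f"
  proof (rule always_eventually, rule allI)
    fix \<kappa>
    have "F f \<kappa> - (nrm f)\<^sup>2 = Re (inn (\<lambda>x. E \<kappa> f x - f x) f)"
      using f by (simp add: F_def L2_inner_linear L2_inner_self)
    hence "norm (F f \<kappa> - (nrm f)\<^sup>2) \<le> cmod (inn (\<lambda>x. E \<kappa> f x - f x) f)"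
      using abs_Re_le_cmod by simp
    also have "\<dots> \<le> nrm (\<lambda>x. E \<kappa> f x - f x) * nrm f"
      using f by (intro L2_Cauchy_Schwarz) auto
    finally show "norm (F f \<kappa> - (nrm f)\<^sup>2) \<le> nrm (\<lambda>x. E \<kappa> f x - f x) * nrm f" .
  qed
qed

lemmas F_cdf = F_mono F_right_cont F_at_bot F_at_top

lemma spm_finite: "f \<in> L2 M \<Longrightarrow> finite_borel_measure (spm f)"
  unfolding spm_eq by (rule finite_borel_measure_interval_measure) (auto intro: F_cdf)

lemma spm_UNIV: "f \<in> L2 M \<Longrightarrow> emeasure (spm f) UNIV = ennreal ((nrm f)\<^sup>2)"
  unfolding spm_eq by (rule interval_measure_UNIV) (auto intro: F_cdf)

lemma spm_Ioc: "f \<in> L2 M \<Longrightarrow> a \<le> b \<Longrightarrow> emeasure (spm f) {a<..b} = ennreal (F f b - F f a)"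
  unfolding spm_eq by (rule emeasure_interval_measure_Ioc) (auto intro: F_cdf)

lemma cdf_spm: "f \<in> L2 M \<Longrightarrow> cdf (spm f) = F f"
  unfolding spm_eq by (rule cdf_interval_measure) (auto intro: F_cdf)

lemma spm_sets [simp, measurable_cong]: "sets (spm f) = sets borel"
  and spm_space [simp]: "space (spm f) = UNIV"
  by (simp_all add: spm_eq)

lemma Domain_iff: "f \<in> L2 M \<Longrightarrow> f \<in> Domain H \<longleftrightarrow> integrable (spm f) (\<lambda>t. t\<^sup>2)"
  using spectral_family by (auto simp: spectral_family_def)

lemma inner_H: "(f, k) \<in> H \<Longrightarrow> inn k f = of_real (\<integral>t. t \<partial>spm f)"
  using spectral_family by (auto simp: spectral_family_def)

lemma H_integrable: assumes "(f, k) \<in> H" shows "integrable (spm f) (\<lambda>t. t)"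
proof -
  have f: "f \<in> L2 M" using assms by (rule H_L2)
  interpret finite_borel_measure "spm f" using f by (rule spm_finite)
  show ?thesis
    by (rule square_integrable_imp_integrable) (use assms Domain_iff[OF f] in auto)
qed

text \<open>The cross terms are (E(\<nu>) u, h) and its conjugate, so \<open>orth\<close> has to be
  imposed at every level \<nu> and not only for u and h themselves.\<close>

lemma F_add_orthogonal:
  assumes u: "u \<in> L2 M" and h: "h \<in> L2 M" and orth: "\<And>\<nu>. inn (E \<nu> u) h = 0"
  shows "F (\<lambda>x. u x + h x) \<nu> = F u \<nu> + F h \<nu>"
proof -
  have "inn (E \<nu> h) u = cnj (inn (E \<nu> u) h)" using u h by (simp add: E_sym L2_inner_cnj)
  thus ?thesis using assms by (simp add: F_def E_add L2_inner_linear L2_add)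
qed

text \<open>
  The spectral family determines \<open>H\<close> only through its diagonal form, so every statement about \<open>(H u, h)\<close>
  with \<open>u \<noteq> h\<close> has to come from polarization.
\<close>

lemma inner_H_add_orthogonal:
  assumes u: "(u, k) \<in> H" and h: "(h, m) \<in> H" and orth: "\<And>\<nu>. inn (E \<nu> u) h = 0"
  shows "Re (inn k h) = 0"
proof -
  note L = H_L2[OF u] H_L2[OF h]
  have uh: "((\<lambda>x. u x + h x), (\<lambda>x. k x + m x)) \<in> H" using H_add[OF u h] .
  have "(\<integral>t. t \<partial>spm (\<lambda>x. u x + h x)) = (\<integral>t. t \<partial>spm u) + (\<integral>t. t \<partial>spm h)"
  proof (rule integral_measure_add)
    fix A assume "A \<in> sets (spm (\<lambda>x. u x + h x))"
    thus "emeasure (spm (\<lambda>x. u x + h x)) A = emeasure (spm u) A + emeasure (spm h) A"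
      using L by (intro emeasure_interval_measure_add spm_finite)
        (auto simp: cdf_spm F_add_orthogonal orth L2_add)
  qed (use H_integrable u h uh in auto)
  hence "inn (\<lambda>x. k x + m x) (\<lambda>x. u x + h x) = inn k u + inn m h"
    using inner_H[OF u] inner_H[OF h] inner_H[OF uh] by simp
  hence "inn k h + inn m u = 0" using L by (simp add: L2_inner_linear L2_add)
  moreover have "inn m u = cnj (inn k h)" using H_sym[OF h u] by (simp add: L2_inner_cnj)
  ultimately show ?thesis by (simp add: complex_add_cnj)
qed

text \<open>The real part is already known to vanish; the same fact for \<i> h in place of h gives
  the imaginary part.\<close>

lemma inner_H_orthogonal:
  assumes u: "(u, k) \<in> H" and h: "(h, m) \<in> H" and orth: "\<And>\<nu>. inn (E \<nu> u) h = 0"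
  shows "inn k h = 0"
proof (rule complex_eqI)
  have "Re (inn k (\<lambda>x. \<i> * h x)) = 0"
    by (rule inner_H_add_orthogonal[OF u H_scale[OF h]]) (simp add: L2_inner_linear orth)
  thus "Im (inn k h) = Im 0" by (simp add: L2_inner_linear)
qed (use inner_H_add_orthogonal[OF assms] in simp)

section \<open>Vectors in the range of a spectral projection \<open>band a b\<close>\<close>

definition in_band :: "real \<Rightarrow> real \<Rightarrow> ('a \<Rightarrow> complex) \<Rightarrow> bool" where
  "in_band a b u \<longleftrightarrow> u \<in> L2 M \<and> (\<forall>g \<in> L2 M. inn (band a b u) g = inn u g)"

lemma in_band_band: "a \<le> b \<Longrightarrow> f \<in> L2 M \<Longrightarrow> in_band a b (band a b f)"
  by (simp add: in_band_def band_band)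

lemma in_band_L2: "in_band a b u \<Longrightarrow> u \<in> L2 M"
  by (simp add: in_band_def)

lemma in_band_scale: "in_band a b u \<Longrightarrow> in_band a b (\<lambda>x. c * u x)"
  by (auto simp: in_band_def band_inner E_scale L2_inner_linear L2_scale right_diff_distrib[symmetric])

lemma in_band_add: "in_band a b u \<Longrightarrow> in_band a b v \<Longrightarrow> in_band a b (\<lambda>x. u x + v x)"
  by (auto simp: in_band_def band_inner E_add L2_inner_linear L2_add add_diff_add)

text \<open>Inserting the projection in front of E(\<nu>) cuts \<nu> off at b and at a; this is what
  confines the spectral measure of \<open>u\<close> to the band.\<close>

lemma in_band_E:
  assumes "in_band a b u" "g \<in> L2 M"
  shows "inn (E \<nu> u) g = inn (E (min \<nu> b) u) g - inn (E (min \<nu> a) u) g"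
proof -
  have u: "u \<in> L2 M" using assms by (simp add: in_band_def)
  have "inn (E \<nu> u) g = inn (band a b u) (E \<nu> g)" using assms u by (simp add: in_band_def E_sym)
  also have "\<dots> = inn (E \<nu> (band a b u)) g" using u assms by (simp add: E_sym)
  finally show ?thesis using u assms by (simp add: E_band)
qed

text \<open>Provides the hypothesis of \<open>inner_H_orthogonal\<close> for the part of
  \<open>h\<close> outside the band: the projection commutes with every E(\<nu>), so E(\<nu>) u
  never leaves the band.\<close>

lemma in_band_orthogonal:
  assumes ab: "a \<le> b" and u: "in_band a b u" and h: "h \<in> L2 M"
  shows "inn (E \<nu> u) (\<lambda>x. h x - band a b h x) = 0"
proof -
  have uL: "u \<in> L2 M" using u by (rule in_band_L2)
  have "inn (E \<nu> u) (band a b h) = inn (band a b (E \<nu> u)) h" using uL h by (simp add: band_sym)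
  also have "\<dots> = inn (E \<nu> u) h"
    using uL h in_band_E[OF u h, of \<nu>] by (simp add: band_inner E_E min.commute)
  finally show ?thesis using uL h by (simp add: L2_inner_linear)
qed

lemma in_band_orthogonal':
  assumes ab: "a \<le> b" and u: "in_band a b u" and h: "h \<in> L2 M"
  shows "inn u (\<lambda>x. h x - band a b h x) = 0"
  using u h band_sym[of u h a b] by (simp add: in_band_def L2_inner_linear)

lemma in_band_AE:
  assumes ab: "a \<le> b" and u: "in_band a b u"
  shows "AE t in spm u. t \<in> {a<..b}"
proof -
  have uL: "u \<in> L2 M" using u by (rule in_band_L2)
  interpret finite_borel_measure "spm u" using uL by (rule spm_finite)
  have F_min: "F u \<nu> = F u (min \<nu> b) - F u (min \<nu> a)" for \<nu>
    using in_band_E[OF u uL, of \<nu>] by (simp add: F_def)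
  \<comment> \<open>At \<nu> = b the identity \<open>F_min\<close> reads F u b = F u b - F u
    a.\<close>
  have Fa: "F u a = 0" using F_min[of b] ab by simp
  have "(F u \<longlongrightarrow> F u b) at_top"
  proof (rule tendsto_eventually, rule eventually_at_top_linorderI)
    fix \<nu> assume "b \<le> \<nu>"
    thus "F u \<nu> = F u b" using F_min[of \<nu>] Fa ab by simp
  qed
  hence Fb: "F u b = (nrm u)\<^sup>2" using F_at_top[OF uL] by (rule tendsto_unique[rotated]) simp
  have "emeasure (spm u) {a<..b} = emeasure (spm u) (space (spm u))"
    using uL ab by (simp add: spm_Ioc spm_UNIV Fa Fb)
  hence "emeasure (spm u) (space (spm u) - {a<..b}) = 0"
    by (subst emeasure_compl) auto
  thus ?thesis by (intro AE_I[where N = "space (spm u) - {a<..b}"]) auto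
qed

lemma in_band_Domain:
  assumes "a \<le> b" "in_band a b u" shows "u \<in> Domain H"
proof -
  have uL: "u \<in> L2 M" using assms in_band_L2 by blast
  interpret finite_borel_measure "spm u" using uL by (rule spm_finite)
  have "integrable (spm u) (\<lambda>t. t\<^sup>2)"
  proof (rule integrable_const_bound)
    show "AE t in spm u. norm (t\<^sup>2) \<le> (\<bar>a\<bar> + \<bar>b\<bar>)\<^sup>2"
      using in_band_AE[OF assms]
    proof eventually_elim
      fix t assume "t \<in> {a<..b}"
      hence "\<bar>t\<bar> \<le> \<bar>\<bar>a\<bar> + \<bar>b\<bar>\<bar>" by auto
      thus "norm (t\<^sup>2) \<le> (\<bar>a\<bar> + \<bar>b\<bar>)\<^sup>2" unfolding abs_le_square_iff by simp
    qed
  qed simp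
  thus ?thesis using Domain_iff[OF uL] by simp
qed

text \<open>The diagonal value (H u - a u, u) is the integral of t - a, and t lies in (a, b] almost
  everywhere for the spectral measure of u.\<close>

lemma in_band_form:
  assumes ab: "a \<le> b" and u: "in_band a b u" and uk: "(u, k) \<in> H"
  shows "0 \<le> Re (inn (\<lambda>x. k x - of_real a * u x) u)"
    and "Re (inn (\<lambda>x. k x - of_real a * u x) u) \<le> (b - a) * (nrm u)\<^sup>2"
proof -
  have L: "u \<in> L2 M" "k \<in> L2 M" using H_L2[OF uk] by auto
  interpret finite_borel_measure "spm u" using L by (intro spm_finite)
  note [simp] = H_integrable[OF uk]
  have meas: "measure (spm u) UNIV = (nrm u)\<^sup>2" using spm_UNIV[OF L(1)] by (simp add: measure_def)
  have "Re (inn (\<lambda>x. k x - of_real a * u x) u) = (\<integral>t. t \<partial>spm u) - a * (nrm u)\<^sup>2"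
    using L by (simp add: L2_inner_linear inner_H[OF uk] L2_inner_self L2_scale)
  also have "\<dots> = (\<integral>t. t - a \<partial>spm u)" using meas by simp
  finally have *: "Re (inn (\<lambda>x. k x - of_real a * u x) u) = (\<integral>t. t - a \<partial>spm u)" .
  show "0 \<le> Re (inn (\<lambda>x. k x - of_real a * u x) u)"
    unfolding * using in_band_AE[OF ab u] by (intro integral_nonneg_AE) auto
  have "(\<integral>t. t - a \<partial>spm u) \<le> (\<integral>t. b - a \<partial>spm u)"
    using in_band_AE[OF ab u] by (intro integral_mono_AE) (auto elim: eventually_mono)
  thus "Re (inn (\<lambda>x. k x - of_real a * u x) u) \<le> (b - a) * (nrm u)\<^sup>2"
    unfolding * using meas by (simp add: mult.commute)
qed

text \<open>Let B(u, v) = ((H - a) u, v), a symmetric form. Then 4 Re B(u, v) = B(u + v, u + v) -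
  B(u - v, u - v); the first term is at most (b - a) \<parallel>u + v\<parallel>^2, the second is
  nonnegative before subtraction, and the parallelogram law bounds \<parallel>u + v\<parallel>^2 by
  2 \<parallel>u\<parallel>^2 + 2 \<parallel>v\<parallel>^2.\<close>

lemma in_band_polar_aux:
  assumes ab: "a \<le> b" and u: "in_band a b u" "(u, k) \<in> H" and v: "in_band a b v" "(v, m) \<in> H"
  shows "Re (inn (\<lambda>x. k x - of_real a * u x) v) \<le> ((b - a) * (nrm u)\<^sup>2 + (b - a) * (nrm v)\<^sup>2) / 2"
proof -
  note L = H_L2[OF u(2)] H_L2[OF v(2)]
  let ?k = "\<lambda>x. k x - of_real a * u x" and ?m = "\<lambda>x. m x - of_real a * v x"
  define v' m' where "v' = (\<lambda>x. - 1 * v x)" and "m' = (\<lambda>x. - 1 * m x)"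
  have v': "in_band a b v'" "(v', m') \<in> H" "v' \<in> L2 M" 
    unfolding v'_def m'_def
    using in_band_scale[OF v(1), of "-1"] H_scale[OF v(2), of "-1"] L2_scale[OF L(3), of "-1"] by simp_all
  have mu: "inn ?m u = cnj (inn ?k v)"
  proof -
    have "inn ?m u = inn m u - a * inn v u" using L by (simp add: L2_inner_linear L2_scale)
    also have "\<dots> = inn v k - a * inn v u" using H_sym[OF v(2) u(2)] by simp
    also have "\<dots> = inn v ?k" using L by (simp add: L2_inner_linear L2_scale)
    finally show ?thesis by (simp add: L2_inner_cnj)
  qed
  have 1: "Re (inn (\<lambda>x. (k x + m x) - of_real a * (u x + v x)) (\<lambda>x. u x + v x))
      \<le> (b - a) * (nrm (\<lambda>x. u x + v x))\<^sup>2"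
    by (rule in_band_form(2)[OF ab in_band_add[OF u(1) v(1)] H_add[OF u(2) v(2)]])
  have 2: "0 \<le> Re (inn (\<lambda>x. (k x + m' x) - of_real a * (u x + v' x)) (\<lambda>x. u x + v' x))"
    by (rule in_band_form(1)[OF ab in_band_add[OF u(1) v'(1)] H_add[OF u(2) v'(2)]])
  have e1: "(\<lambda>x. (k x + m x) - of_real a * (u x + v x)) = (\<lambda>x. ?k x + ?m x)"
    by (auto simp: algebra_simps)
  have e2: "(\<lambda>x. (k x + m' x) - of_real a * (u x + v' x)) = (\<lambda>x. ?k x - ?m x)" 
    "(\<lambda>x. u x + v' x) = (\<lambda>x. u x - v x)"
    by (auto simp: algebra_simps m'_def v'_def)
  have n: "(nrm (\<lambda>x. u x + v x))\<^sup>2 + (nrm (\<lambda>x. u x - v x))\<^sup>2 = 2 * (nrm u)\<^sup>2 + 2 * (nrm v)\<^sup>2"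
  proof -
    have "nrm v' = nrm v" unfolding v'_def by (simp only: L2_norm_scale) simp
    moreover have "inn u v' = - inn u v" unfolding v'_def by (simp only: L2_inner_linear) simp
    ultimately show ?thesis
      unfolding e2(2)[symmetric] using L v' by (simp add: L2_norm_add_square)
  qed
  have "?k \<in> L2 M" "?m \<in> L2 M" using L by auto
  hence "Re (inn (\<lambda>x. ?k x + ?m x) (\<lambda>x. u x + v x)) - Re (inn (\<lambda>x. ?k x - ?m x) (\<lambda>x. u x - v x))
     = 4 * Re (inn ?k v)"
    using L mu 
    by (simp add: L2_inner_add_left[of ?k _ ?m] L2_inner_diff_left[of ?k _ ?m] L2_inner_add_right[of u _ v]
        L2_inner_diff_right[of u _ v] L2_add[of u _ v] L2_diff[of u _ v])
  hence "4 * Re (inn ?k v) \<le> (b - a) * (nrm (\<lambda>x. u x + v x))\<^sup>2" using 1 2 unfolding e1 e2 by linarith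
  also have "\<dots> \<le> (b - a) * (2 * (nrm u)\<^sup>2 + 2 * (nrm v)\<^sup>2)"
    unfolding n[symmetric] using ab by (intro mult_left_mono) auto
  finally show ?thesis by (simp add: field_simps)
qed

lemma in_band_polar:
  assumes ab: "a \<le> b" and u: "in_band a b u" "(u, k) \<in> H" and v: "in_band a b v" "(v, m) \<in> H"
  shows "cmod (inn (\<lambda>x. k x - of_real a * u x) v) \<le> (b - a) * nrm u * nrm v"
proof -
  let ?k = "\<lambda>x. k x - of_real a * u x"
  define w where "w = inn ?k v"
  obtain z where z: "cmod z = 1" "z * w = of_real (cmod w)"
  proof (cases "w = 0")
    case False
    show ?thesis
      by (rule that[of "of_real (cmod w) / w"]) (use False in \<open>auto simp: norm_divide\<close>)
  qed (rule that[of 1], auto)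
  have "cmod w \<le> sqrt ((b - a) * (nrm u)\<^sup>2) * sqrt ((b - a) * (nrm v)\<^sup>2)"
  proof (rule le_sqrt_mult_sqrt)
    fix s :: real assume s: "0 < s"
    define r where "r = sqrt s"
    have r: "0 < r" "s = r\<^sup>2" using s by (auto simp: r_def)
    \<comment> \<open>\<open>z\<close> turns the value of the form into its modulus. Replacing u by
      r u and v by v / r leaves that value unchanged and produces the weight s = r^2 over which
      \<open>le_sqrt_mult_sqrt\<close> optimises.\<close>
    define c where "c = z * of_real r"
    have "Re (inn (\<lambda>x. c * k x - of_real a * (c * u x)) (\<lambda>x. of_real (1 / r) * v x)) \<le> 
       ((b - a) * (nrm (\<lambda>x. c * u x))\<^sup>2 + (b - a) * (nrm (\<lambda>x. of_real (1 / r) * v x))\<^sup>2) / 2"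
      by (rule in_band_polar_aux[OF ab in_band_scale[OF u(1)] H_scale[OF u(2)]
            in_band_scale[OF v(1)] H_scale[OF v(2)]])
    also have "(\<lambda>x. c * k x - of_real a * (c * u x)) = (\<lambda>x. c * ?k x)" by (auto simp: algebra_simps)
    also have "inn \<dots> (\<lambda>x. of_real (1 / r) * v x) = z * w"
      unfolding L2_inner_linear c_def w_def using r by simp
    also have "(nrm (\<lambda>x. c * u x))\<^sup>2 = s * (nrm u)\<^sup>2"
      using r z by (simp add: L2_norm_scale c_def norm_mult power_mult_distrib)
    also have "(nrm (\<lambda>x. of_real (1 / r) * v x))\<^sup>2 = (nrm v)\<^sup>2 / s"
      using r by (simp only: L2_norm_scale) (simp add: norm_divide power_divide power_mult_distrib)
    finally show "cmod w \<le> (s * ((b - a) * (nrm u)\<^sup>2) + (b - a) * (nrm v)\<^sup>2 / s) / 2"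
      unfolding z by (simp add: mult_ac)
  qed (use ab in auto)
  also have "\<dots> = (b - a) * nrm u * nrm v" using ab by (simp add: real_sqrt_mult)
  finally show ?thesis unfolding w_def .
qed

lemma norm_band_le:
  assumes "a \<le> b" "h \<in> L2 M" shows "nrm (band a b h) \<le> nrm h"
proof (rule L2_norm_le_of_inner)
  have "inn (band a b h) (band a b h) = inn (band a b (band a b h)) h" using assms by (simp add: band_sym)
  also have "\<dots> = inn (band a b h) h" using assms by (simp add: band_band)
  finally show "cmod (inn (band a b h) (band a b h)) \<le> nrm h * nrm (band a b h)"
    using L2_Cauchy_Schwarz[of "band a b h" M h] assms by (simp add: mult.commute)
qed (use assms in auto)

text \<open>A vector h of the domain is split into its part in the band and the rest. The part in
  the band lies in the domain, hence so does the rest; \<open>inner_H_orthogonal\<close> then shows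
  that the rest contributes nothing, and \<open>in_band_polar\<close> estimates the other part.
  Density of the domain allows testing against H u - a u itself.\<close>

theorem in_band_approximate_eigenvector:
  assumes ab: "a \<le> b" and u: "in_band a b u"
  obtains k where "(u, k) \<in> H" "nrm (\<lambda>x. k x - of_real a * u x) \<le> (b - a) * nrm u"
proof -
  obtain k where uk: "(u, k) \<in> H" using in_band_Domain[OF ab u] by blast
  note L = H_L2[OF uk]
  let ?v = "\<lambda>x. k x - of_real a * u x"
  have vL: "?v \<in> L2 M" using L by auto
  have bound: "cmod (inn ?v h) \<le> (b - a) * nrm u * nrm h" if h: "h \<in> Domain H" for h
  proof -
    obtain m where hm: "(h, m) \<in> H" using h by blast
    have hL: "h \<in> L2 M" using H_L2[OF hm] by simp
    have bh: "in_band a b (band a b h)" by (rule in_band_band[OF ab hL])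
    obtain n where bn: "(band a b h, n) \<in> H" using in_band_Domain[OF ab bh] by blast
    have 1: "inn k (\<lambda>x. h x - band a b h x) = 0"
      by (rule inner_H_orthogonal[OF uk H_diff[OF hm bn]]) (rule in_band_orthogonal[OF ab u hL])
    have 2: "inn ?v (\<lambda>x. h x - band a b h x) = 0" 
      using L hL 1 in_band_orthogonal'[OF ab u hL] 
      by (subst L2_inner_diff_left) (auto simp: L2_inner_scale_left)
    have "inn ?v h = inn ?v (band a b h)"
      using 2 L2_inner_diff_right[OF hL band_L2[OF hL] vL] by simp
    also have "cmod \<dots> \<le> (b - a) * nrm u * nrm (band a b h)"
      by (rule in_band_polar[OF ab u uk bh bn])
    also have "\<dots> \<le> (b - a) * nrm u * nrm h"
      using ab norm_band_le[OF ab hL] by (intro mult_left_mono) auto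
    finally show ?thesis .
  qed
  have "Domain H \<subseteq> L2 M" using H_L2 by blast
  hence "cmod (inn ?v ?v) \<le> (b - a) * nrm u * nrm ?v"
    using ab by (intro L2_bound_by_dense[OF vL _ _ H_dense bound vL]) auto
  hence "nrm ?v \<le> (b - a) * nrm u" using ab by (intro L2_norm_le_of_inner[OF vL]) auto
  with uk show ?thesis by (rule that)
qed

end

text \<open>\<open>U_H\<close> is the only link between \<open>U\<close> and \<open>H\<close>. It is
  an integrated form of d/dt U(t) f = \<i> U(t) H f: once the phase exp(\<i> c t) is removed, the
  vector moves at a speed of at most \<parallel>(H - c) f\<parallel>.\<close>

locale spectral_group = spectral +
  fixes U :: "real \<Rightarrow> ('a \<Rightarrow> complex) \<Rightarrow> ('a \<Rightarrow> complex)"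
  assumes U_L2 [simp]: "f \<in> L2 M \<Longrightarrow> U t f \<in> L2 M"
    and U_add: "U t (\<lambda>x. f x + g x) = (\<lambda>x. U t f x + U t g x)"
    and U_scale: "U t (\<lambda>x. z * f x) = (\<lambda>x. z * U t f x)"
    and U_norm: "f \<in> L2 M \<Longrightarrow> nrm (U t f) \<le> nrm f"
    and U_H: "(f, k) \<in> H \<Longrightarrow> h \<in> L2 M \<Longrightarrow>
      cmod (exp (- \<i> * of_real (c * t)) * inn (U t f) h - inn f h) \<le> \<bar>t\<bar> * nrm (\<lambda>x. k x - of_real c * f x) * nrm h"
begin

lemma U_diff: "f \<in> L2 M \<Longrightarrow> g \<in> L2 M \<Longrightarrow> h \<in> L2 M \<Longrightarrow>
    inn (U t (\<lambda>x. f x - g x)) h = inn (U t f) h - inn (U t g) h"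
  using U_add[of t f "\<lambda>x. (-1) * g x"] by (simp add: U_scale[of t "-1", simplified] L2_inner_linear)

section \<open>The spectral measure of a fixed vector and its Fourier transform\<close>

context
  fixes f :: "'a \<Rightarrow> complex" and t :: real
  assumes f: "f \<in> L2 M"
begin

text \<open>The discrepancy, over (a, b], between the flow and the Fourier transform of the spectral
  measure. It is additive over adjacent intervals, hence zero once the bounds over the cells of a
  partition have a sum that tends to 0 with the mesh.\<close>

definition J :: "real \<Rightarrow> real \<Rightarrow> complex" where
  "J a b = inn (U t (band a b f)) f -
     (\<integral>\<nu>. indicator {a<..b} \<nu> *\<^sub>R iexp (t * \<nu>) \<partial>spm f)"

lemma integrable_iexp_Ioc: "integrable (spm f) (\<lambda>\<nu>. indicator {a<..b} \<nu> *\<^sub>R iexp (t * \<nu>))"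
proof -
  interpret finite_borel_measure "spm f" using f by (rule spm_finite)
  show ?thesis by (rule integrable_const_bound[where B = 1]) (auto simp: indicator_def)
qed

lemma J_split:
  assumes "a \<le> b" "b \<le> c" shows "J a c = J a b + J b c"
proof -
  have "(\<lambda>\<nu>. indicator {a<..c} \<nu> *\<^sub>R iexp (t * \<nu>)) = 
    (\<lambda>\<nu>. indicator {a<..b} \<nu> *\<^sub>R iexp (t * \<nu>) + indicator {b<..c} \<nu> *\<^sub>R iexp (t * \<nu>))"
    using assms by (auto simp: indicator_def)
  hence "(\<integral>\<nu>. indicator {a<..c} \<nu> *\<^sub>R iexp (t * \<nu>) \<partial>spm f) =
    (\<integral>\<nu>. indicator {a<..b} \<nu> *\<^sub>R iexp (t * \<nu>) \<partial>spm f) +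
    (\<integral>\<nu>. indicator {b<..c} \<nu> *\<^sub>R iexp (t * \<nu>) \<partial>spm f)"
    by (simp only: Bochner_Integration.integral_add[OF integrable_iexp_Ioc integrable_iexp_Ioc])
  thus ?thesis unfolding J_def band_def using f by (simp add: U_diff)
qed

lemma J_refl: "J a a = 0"
  unfolding J_def band_def using f U_diff[of f f f t] by simp

text \<open>Both terms of \<open>J a b\<close> are compared with exp(\<i> a t) (u, f), where u is
  the part of f in the band: the first by \<open>U_H\<close> with c = a, the second because exp(\<i>
  t \<nu>) differs from exp(\<i> t a) by at most |t| (b - a) on the band.\<close>

lemma J_bound:
  assumes ab: "a \<le> b"
  shows "cmod (J a b) \<le> \<bar>t\<bar> * (b - a) * (nrm (band a b f) * nrm f + (F f b - F f a))"
proof -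
  interpret finite_borel_measure "spm f" using f by (rule spm_finite)
  define u where "u = band a b f"
  define e where "e = iexp (t * a)"
  have e1: "cmod e = 1" "exp (- \<i> * complex_of_real (a * t)) * e = 1"
    by (simp_all add: e_def exp_add[symmetric] mult.commute)
  have uL: "u \<in> L2 M" using f by (simp add: u_def)
  obtain k where k: "(u, k) \<in> H" "nrm (\<lambda>x. k x - of_real a * u x) \<le> (b - a) * nrm u"
    using in_band_approximate_eigenvector[OF ab in_band_band[OF ab f]] u_def by metis
  have "inn (U t u) f - e * inn u f = e * (exp (- \<i> * of_real (a * t)) * inn (U t u) f - inn u f)"
  proof -
    have "e * (exp (- \<i> * of_real (a * t)) * inn (U t u) f) = inn (U t u) f"
      using e1(2) by (metis mult.assoc mult.commute mult_1)
    thus ?thesis unfolding right_diff_distrib by simp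
  qed
  hence "cmod (inn (U t u) f - e * inn u f) \<le> \<bar>t\<bar> * nrm (\<lambda>x. k x - of_real a * u x) * nrm f"
    using U_H[OF k(1) f, of a t] e1(1) by (simp add: norm_mult)
  also have "\<dots> \<le> \<bar>t\<bar> * ((b - a) * nrm u) * nrm f"
    using k(2) by (intro mult_right_mono mult_left_mono) auto
  finally have 1: "cmod (inn (U t u) f - e * inn u f) \<le> \<bar>t\<bar> * (b - a) * (nrm u * nrm f)"
    by (simp add: mult_ac)
  have uf: "inn u f = of_real (F f b - F f a)"
    using f by (simp add: u_def band_inner inner_E_F)
  have int_e: "integrable (spm f) (\<lambda>\<nu>. indicator {a<..b} \<nu> *\<^sub>R e)"
    by (intro integrable_scaleR_left integrable_real_indicator) (auto simp: less_top[symmetric])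
  have m: "measure (spm f) {a<..b} = F f b - F f a"
    using spm_Ioc[OF f ab] F_mono[OF f ab] by (simp add: measure_def)
  have "(\<integral>\<nu>. indicator {a<..b} \<nu> *\<^sub>R iexp (t * \<nu>) \<partial>spm f) - e * inn u f =
     (\<integral>\<nu>. indicator {a<..b} \<nu> *\<^sub>R iexp (t * \<nu>) - indicator {a<..b} \<nu> *\<^sub>R e \<partial>spm f)"
  proof -
    have "integrable (spm f) (\<lambda>\<nu>. indicator {a<..b} \<nu> *\<^sub>R e)" by (rule int_e)
    hence "(\<integral>\<nu>. indicator {a<..b} \<nu> *\<^sub>R iexp (t * \<nu>) - indicator {a<..b} \<nu> *\<^sub>R e \<partial>spm f) =
      (\<integral>\<nu>. indicator {a<..b} \<nu> *\<^sub>R iexp (t * \<nu>) \<partial>spm f) - (\<integral>\<nu>. indicator {a<..b} \<nu> *\<^sub>R e \<partial>spm f)"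
      by (rule Bochner_Integration.integral_diff[OF integrable_iexp_Ioc])
    also have "(\<integral>\<nu>. indicator {a<..b} \<nu> *\<^sub>R e \<partial>spm f) = measure (spm f) {a<..b} *\<^sub>R e"
      using m by (subst integral_scaleR_left) (auto simp: less_top[symmetric])
    also have "\<dots> = e * inn u f" unfolding m uf scaleR_conv_of_real by (rule mult.commute)
    finally show ?thesis by (rule sym)
  qed
  also have "cmod \<dots> \<le> (\<integral>\<nu>. \<bar>t\<bar> * (b - a) * indicator {a<..b} \<nu> \<partial>spm f)"
  proof (rule order_trans[OF integral_norm_bound], rule integral_mono)
    fix \<nu>
    show "cmod (indicator {a<..b} \<nu> *\<^sub>R iexp (t * \<nu>) - indicator {a<..b} \<nu> *\<^sub>R e) 
       \<le> \<bar>t\<bar> * (b - a) * indicator {a<..b} \<nu>"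
    proof (cases "\<nu> \<in> {a<..b}")
      case True
      have "cmod (iexp (t * \<nu>) - e) \<le> \<bar>t * \<nu> - t * a\<bar>"
        unfolding e_def by (rule iexp_diff_le)
      also have "\<dots> = \<bar>t\<bar> * (\<nu> - a)" using True by (simp add: abs_mult right_diff_distrib[symmetric])
      also have "\<dots> \<le> \<bar>t\<bar> * (b - a)" using True by (intro mult_left_mono) auto
      finally show ?thesis using True by simp
    qed simp
  next
    show "integrable (spm f) (\<lambda>x. cmod (indicator {a<..b} x *\<^sub>R iexp (t * x) - indicator {a<..b} x *\<^sub>R e))"
      by (intro integrable_norm Bochner_Integration.integrable_diff integrable_iexp_Ioc int_e)
  qed (auto simp: less_top[symmetric])
  also have "\<dots> = \<bar>t\<bar> * (b - a) * (F f b - F f a)" using m by simp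
  finally have 2: "cmod ((\<integral>\<nu>. indicator {a<..b} \<nu> *\<^sub>R iexp (t * \<nu>) \<partial>spm f) - e * inn u f) \<le> \<dots>" .
  have "cmod (J a b) \<le> cmod (inn (U t u) f - e * inn u f) + 
     cmod ((\<integral>\<nu>. indicator {a<..b} \<nu> *\<^sub>R iexp (t * \<nu>) \<partial>spm f) - e * inn u f)"
    unfolding J_def u_def[symmetric] by (rule order_trans[OF _ norm_triangle_ineq4]) simp
  thus ?thesis using 1 2 by (simp add: u_def distrib_left)
qed

text \<open>
  Cut \<open>(-N, N]\<close> into \<open>m\<^sup>2\<close> pieces of length \<open>s\<^sup>2 = 2 N / m\<^sup>2\<close>. The errors \<open>s\<^sup>2 \<parallel>u\<^sub>j\<parallel> \<parallel>f\<parallel>\<close> of the pieces \<open>u\<^sub>j\<close> add up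
  to \<open>O(s)\<close>, because \<open>s \<parallel>u\<^sub>j\<parallel> \<parallel>f\<parallel> \<le> (s\<^sup>2 \<parallel>f\<parallel>\<^sup>2 + \<parallel>u\<^sub>j\<parallel>\<^sup>2) / 2\<close> and \<open>\<Sum>\<^sub>j \<parallel>u\<^sub>j\<parallel>\<^sup>2 \<le> \<parallel>f\<parallel>\<^sup>2\<close>.
\<close>

lemma J_zero:
  assumes N: "0 \<le> N" shows "J (- N) N = 0"
proof -
  define r where "r = sqrt (2 * N)"
  have r: "0 \<le> r" "r\<^sup>2 = 2 * N" using N by (auto simp: r_def)
  define K where "K = \<bar>t\<bar> * (nrm f)\<^sup>2 * (r ^ 3 + r + r\<^sup>2)"
  have K: "cmod (J (- N) N) \<le> K / real m" if m: "0 < m" for m :: nat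
  proof -
    define s where "s = r / m"
    define p where "p j = - N + real j * s\<^sup>2" for j :: nat
    have s: "0 \<le> s" using r by (simp add: s_def)
    have p0: "p 0 = - N" and pS: "p (Suc j) = p j + s\<^sup>2" for j by (auto simp: p_def algebra_simps)
    have pm: "p (m\<^sup>2) = N" using r m by (simp add: p_def s_def power_divide)
    have p_mono: "p j \<le> p (Suc j)" for j by (simp add: pS)
    have p0j: "- N \<le> p j" for j by (simp add: p_def)
    have sum: "J (- N) (p n) = (\<Sum>j<n. J (p j) (p (Suc j)))" for n
    proof (induction n)
      case (Suc n)
      thus ?case using J_split[OF p0j p_mono, of n] by simp
    qed (simp add: p0 J_refl)
    have nf: "F f (p (Suc j)) - F f (p j) = (nrm (band (p j) (p (Suc j)) f))\<^sup>2" for j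
      using norm_band[OF p_mono f] by simp
    have step: "cmod (J (p j) (p (Suc j))) \<le>
        \<bar>t\<bar> * (s ^ 3 * (nrm f)\<^sup>2 / 2 + (s / 2 + s\<^sup>2) * (F f (p (Suc j)) - F f (p j)))" for j
    proof -
      let ?n = "nrm (band (p j) (p (Suc j)) f)"
      have "s * (?n * nrm f) \<le> (s\<^sup>2 * (nrm f)\<^sup>2 + ?n\<^sup>2) / 2"
        using zero_le_power2[of "s * nrm f - ?n"] by (simp add: power2_diff power_mult_distrib algebra_simps)
      hence "s * (s * (?n * nrm f)) \<le> s * ((s\<^sup>2 * (nrm f)\<^sup>2 + ?n\<^sup>2) / 2)" using s by (rule mult_left_mono)
      hence *: "s\<^sup>2 * (?n * nrm f + ?n\<^sup>2) \<le> s ^ 3 * (nrm f)\<^sup>2 / 2 + (s / 2 + s\<^sup>2) * ?n\<^sup>2"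
        by (simp add: power2_eq_square power3_eq_cube algebra_simps)
      have "cmod (J (p j) (p (Suc j))) \<le> \<bar>t\<bar> * s\<^sup>2 * (?n * nrm f + ?n\<^sup>2)"
        using J_bound[OF p_mono, of j] by (simp add: pS nf[unfolded pS])
      also have "\<dots> \<le> \<bar>t\<bar> * (s ^ 3 * (nrm f)\<^sup>2 / 2 + (s / 2 + s\<^sup>2) * ?n\<^sup>2)"
        unfolding mult.assoc using * by (rule mult_left_mono) simp
      finally show ?thesis unfolding nf .
    qed
    have tele: "(\<Sum>j<n. F f (p (Suc j)) - F f (p j)) = F f (p n) - F f (p 0)" for n
      by (induction n) auto
    have "F f N - F f (- N) = (nrm (band (- N) N f))\<^sup>2" using norm_band[of "-N" N f] N f by simp
    also have "\<dots> \<le> (nrm f)\<^sup>2" using norm_band_le[of "-N" N f] N f by (intro power_mono) auto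
    finally have FN: "F f N - F f (- N) \<le> (nrm f)\<^sup>2" .
    have "cmod (J (- N) N) \<le> (\<Sum>j<m\<^sup>2. cmod (J (p j) (p (Suc j))))"
      using sum[of "m\<^sup>2"] norm_sum[of "\<lambda>j. J (p j) (p (Suc j))" "{..<m\<^sup>2}"] by (simp add: pm)
    also have "\<dots> \<le> (\<Sum>j<m\<^sup>2. \<bar>t\<bar> * (s ^ 3 * (nrm f)\<^sup>2 / 2 + (s / 2 + s\<^sup>2) * (F f (p (Suc j)) - F f (p j))))"
      by (rule sum_mono) (rule step)
    also have "\<dots> = \<bar>t\<bar> * (real (m\<^sup>2) * (s ^ 3 * (nrm f)\<^sup>2 / 2) + (s / 2 + s\<^sup>2) * (F f N - F f (- N)))"
      unfolding sum_distrib_left[symmetric] sum.distrib tele pm p0 by simp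
    also have "\<dots> \<le> \<bar>t\<bar> * (real (m\<^sup>2) * (s ^ 3 * (nrm f)\<^sup>2 / 2) + (s / 2 + s\<^sup>2) * (nrm f)\<^sup>2)"
      using s FN by (intro mult_left_mono add_left_mono) auto
    also have "\<dots> = \<bar>t\<bar> * (nrm f)\<^sup>2 * (real (m\<^sup>2) * s ^ 3 / 2 + s / 2 + s\<^sup>2)"
      by (simp add: algebra_simps)
    also have "\<dots> \<le> \<bar>t\<bar> * (nrm f)\<^sup>2 * ((r ^ 3 + r + r\<^sup>2) / m)"
    proof (rule mult_left_mono)
      have "real (m\<^sup>2) * s ^ 3 = r ^ 3 / m" using m
        by (simp add: s_def power_divide power2_eq_square power3_eq_cube)
      moreover have "s\<^sup>2 \<le> r\<^sup>2 / m" using m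
        by (simp add: s_def power_divide divide_left_mono self_le_power)
      moreover have "r / m \<ge> 0" "r ^ 3 / m \<ge> 0" using r by auto
      ultimately show "real (m\<^sup>2) * s ^ 3 / 2 + s / 2 + s\<^sup>2 \<le> (r ^ 3 + r + r\<^sup>2) / m"
        by (simp add: s_def add_divide_distrib)
    qed simp
    finally show ?thesis by (simp add: K_def)
  qed
  have "(\<lambda>m. K / real m) \<longlonglongrightarrow> 0" by (rule lim_const_over_n)
  moreover have "\<forall>\<^sub>F m in sequentially. cmod (J (- N) N) \<le> K / real m"
    using eventually_gt_at_top[of 0] by eventually_elim (rule K)
  ultimately have "cmod (J (- N) N) \<le> 0" by (intro tendsto_lowerbound[of _ 0 sequentially]) auto
  thus ?thesis by simp
qed

theorem char_spectral_measure:
  "(\<integral>\<nu>. iexp (t * \<nu>) \<partial>spm f) = inn (U t f) f"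
proof (rule LIMSEQ_unique)
  interpret finite_borel_measure "spm f" using f by (rule spm_finite)
  let ?I = "\<lambda>n::nat. \<integral>\<nu>. indicator {- real n<..real n} \<nu> *\<^sub>R iexp (t * \<nu>) \<partial>spm f"
  show "?I \<longlonglongrightarrow> (\<integral>\<nu>. iexp (t * \<nu>) \<partial>spm f)"
  proof (rule integral_dominated_convergence[where w = "\<lambda>_. 1"])
    show "AE \<nu> in spm f. (\<lambda>n. indicator {- real n<..real n} \<nu> *\<^sub>R iexp (t * \<nu>))
        \<longlonglongrightarrow> iexp (t * \<nu>)"
    proof (rule AE_I2, rule tendsto_eventually)
      fix \<nu>
      have "\<forall>\<^sub>F n in sequentially. \<bar>\<nu>\<bar> < real n"
        using filterlim_real_sequentially by (simp add: filterlim_at_top_dense)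
      thus "\<forall>\<^sub>F n in sequentially. indicator {- real n<..real n} \<nu> *\<^sub>R iexp (t * \<nu>) = iexp (t * \<nu>)"
        by eventually_elim (auto simp: indicator_def)
    qed
  qed (auto simp: indicator_def)
  have I: "?I n = inn (U t (band (- real n) n f)) f" for n
    using J_zero[of "real n"] by (simp add: J_def)
  show "?I \<longlonglongrightarrow> inn (U t f) f"
  proof (rule LIM_zero_cancel, rule Lim_null_comparison)
    let ?b = "\<lambda>n. nrm (\<lambda>x. E (real n) f x - f x) + nrm (E (- real n) f)"
    have "((\<lambda>\<kappa>. nrm (\<lambda>x. E \<kappa> f x - f x)) \<longlongrightarrow> 0) at_top" "((\<lambda>\<kappa>. nrm (E \<kappa> f)) \<longlongrightarrow> 0) at_bot"
      using roi f by (auto simp: resolution_of_identity_def)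
    from this(1)[THEN filterlim_compose, OF filterlim_real_sequentially]
      this(2)[THEN filterlim_compose, of "\<lambda>n. - real n"]
    have "?b \<longlonglongrightarrow> 0 + 0"
      by (intro tendsto_add) (auto simp: filterlim_uminus_at_bot filterlim_real_sequentially)
    from tendsto_mult_left_zero[OF this[simplified], of "nrm f"]
    show "(\<lambda>n. ?b n * nrm f) \<longlonglongrightarrow> 0" by simp
    show "\<forall>\<^sub>F n in sequentially. norm (?I n - inn (U t f) f) \<le> ?b n * nrm f"
    proof (rule always_eventually, rule allI)
      fix n :: nat
      let ?B = "band (- real n) n f"
      have "?I n - inn (U t f) f = inn (U t (\<lambda>x. ?B x - f x)) f"
        unfolding I using f by (simp add: U_diff)
      also have "cmod \<dots> \<le> nrm (U t (\<lambda>x. ?B x - f x)) * nrm f"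
        using f by (intro L2_Cauchy_Schwarz U_L2 L2_diff band_L2)
      also have "\<dots> \<le> nrm (\<lambda>x. ?B x - f x) * nrm f"
        using f by (intro mult_right_mono U_norm) auto
      also have "nrm (\<lambda>x. ?B x - f x) \<le> ?b n"
      proof -
        have "nrm (\<lambda>x. ?B x - f x) = nrm (\<lambda>x. (E (real n) f x - f x) + (-1) * E (- real n) f x)"
          by (rule arg_cong[where f = nrm]) (auto simp: band_def)
        also have "\<dots> \<le> nrm (\<lambda>x. E (real n) f x - f x) + nrm (\<lambda>x. (-1) * E (- real n) f x)"
          using f by (intro L2_norm_triangle L2_diff L2_scale) auto
        finally show ?thesis by (simp only: L2_norm_scale) simp
      qed
      finally show "norm (?I n - inn (U t f) f) \<le> ?b n * nrm f" by (simp add: mult_right_mono)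
    qed
  qed
qed

end

end

section \<open>Densities from integrable characteristic functions\<close>

lemma has_vector_derivative_iff_quotient:
  "(g has_vector_derivative D) (at s) \<longleftrightarrow> ((\<lambda>u. (g u - g s) /\<^sub>R (u - s)) \<longlongrightarrow> D) (at s)"
proof -
  have "((\<lambda>u. norm ((g u - g s) - (u - s) *\<^sub>R D) / norm (u - s)) \<longlongrightarrow> 0) (at s)
    \<longleftrightarrow> ((\<lambda>u. norm ((g u - g s) /\<^sub>R (u - s) - D)) \<longlongrightarrow> 0) (at s)"
  proof (rule tendsto_cong, unfold eventually_at_filter, rule always_eventually, intro allI impI)
    fix u assume "u \<noteq> s"
    hence "(g u - g s) /\<^sub>R (u - s) - D = ((g u - g s) - (u - s) *\<^sub>R D) /\<^sub>R (u - s)"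
      by (simp add: scaleR_diff_right)
    thus "norm ((g u - g s) - (u - s) *\<^sub>R D) / norm (u - s) = norm ((g u - g s) /\<^sub>R (u - s) - D)"
      by (simp add: divide_inverse mult.commute)
  qed
  thus ?thesis
    by (simp add: has_vector_derivative_def has_derivative_iff_norm bounded_linear_scaleR_left
        tendsto_norm_zero_iff LIM_zero_iff)
qed

text \<open>Limits along sequences reduce this to dominated convergence of difference quotients
  based at \<open>s0\<close>. Only countably many values of s enter at a time, which is why the
  exceptional null set in \<open>bound\<close> may depend on s.\<close>

lemma has_vector_derivative_integral:
  fixes f :: "real \<Rightarrow> 'a \<Rightarrow> 'b::{banach, second_countable_topology}"
  assumes \<delta>: "0 < \<delta>"
    and int: "\<And>s. \<bar>s - s0\<bar> < \<delta> \<Longrightarrow> integrable M (f s)"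
    and der: "AE x in M. ((\<lambda>s. f s x) has_vector_derivative f' x) (at s0)"
    and bound: "\<And>s. \<bar>s - s0\<bar> < \<delta> \<Longrightarrow> AE x in M. norm (f s x - f s0 x) \<le> w x * \<bar>s - s0\<bar>"
    and w: "integrable M w" and f': "f' \<in> borel_measurable M"
  shows "((\<lambda>s. integral\<^sup>L M (f s)) has_vector_derivative integral\<^sup>L M f') (at s0)"
  unfolding has_vector_derivative_iff_quotient tendsto_at_iff_sequentially
proof (intro allI impI)
  fix X :: "nat \<Rightarrow> real" assume X: "\<forall>i. X i \<in> UNIV - {s0}" "X \<longlonglongrightarrow> s0"
  have "\<forall>\<^sub>F n in sequentially. dist (X n) s0 < \<delta>" using X(2) \<delta> by (rule tendstoD)
  then obtain N where N: "\<And>n. n \<ge> N \<Longrightarrow> \<bar>X n - s0\<bar> < \<delta>"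
    unfolding eventually_sequentially dist_real_def by blast
  define Y where "Y n = X (n + N)" for n
  have Y: "\<bar>Y n - s0\<bar> < \<delta>" "Y n \<noteq> s0" for n using N X(1) by (auto simp: Y_def)
  have Yl: "filterlim Y (at s0) sequentially"
    using LIMSEQ_ignore_initial_segment[OF X(2), of N] Y(2) by (auto simp: filterlim_at Y_def[abs_def])
  have eq: "(integral\<^sup>L M (f (Y n)) - integral\<^sup>L M (f s0)) /\<^sub>R (Y n - s0) =
    (\<integral>x. (f (Y n) x - f s0 x) /\<^sub>R (Y n - s0) \<partial>M)" for n
    using int[OF Y(1)] int[of s0] \<delta> by simp
  have "(\<lambda>n. \<integral>x. (f (Y n) x - f s0 x) /\<^sub>R (Y n - s0) \<partial>M) \<longlonglongrightarrow> integral\<^sup>L M f'"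
  proof (rule integral_dominated_convergence[OF f' _ w])
    show "AE x in M. (\<lambda>n. (f (Y n) x - f s0 x) /\<^sub>R (Y n - s0)) \<longlonglongrightarrow> f' x"
      using der
    proof eventually_elim
      case (elim x)
      thus ?case unfolding has_vector_derivative_iff_quotient by (rule filterlim_compose[OF _ Yl])
    qed
    fix n
    show "(\<lambda>x. (f (Y n) x - f s0 x) /\<^sub>R (Y n - s0)) \<in> borel_measurable M"
      using int[OF Y(1)] int[of s0] \<delta> by auto
    show "AE x in M. norm ((f (Y n) x - f s0 x) /\<^sub>R (Y n - s0)) \<le> w x"
      using bound[OF Y(1)[of n]]
    proof eventually_elim
      case (elim x)
      thus ?case using Y(2)[of n] by (simp add: divide_inverse[symmetric] mult.commute[of "inverse _"] divide_le_eq)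
    qed
  qed
  hence "(\<lambda>n. (integral\<^sup>L M (f (Y n)) - integral\<^sup>L M (f s0)) /\<^sub>R (Y n - s0)) \<longlonglongrightarrow> integral\<^sup>L M f'"
    unfolding eq .
  thus "((\<lambda>u. (integral\<^sup>L M (f u) - integral\<^sup>L M (f s0)) /\<^sub>R (u - s0)) \<circ> X) \<longlonglongrightarrow> integral\<^sup>L M f'"
    unfolding Y_def comp_def by (rule LIMSEQ_offset)
qed

text \<open>An antiderivative in \<open>\<nu>\<close> of \<open>exp (-\<i>t\<nu>)\<close>, chosen so that it stays bounded by \<open>\<bar>\<nu>\<bar>\<close> for all \<open>t\<close>.\<close>

definition levy_kernel :: "real \<Rightarrow> real \<Rightarrow> complex" where
  "levy_kernel \<nu> t = (1 - iexp (- (t * \<nu>))) / (\<i> * of_real t)"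

lemma levy_kernel_measurable [measurable]: "levy_kernel \<nu> \<in> borel_measurable borel"
  unfolding levy_kernel_def by measurable

lemma levy_kernel_diff: "levy_kernel b t - levy_kernel a t = (iexp (- (t * a)) - iexp (- (t * b))) / (\<i> * of_real t)"
  by (simp add: levy_kernel_def diff_divide_distrib)

lemma levy_kernel_diff_le: "cmod (levy_kernel b t - levy_kernel a t) \<le> \<bar>b - a\<bar>"
proof (cases "t = 0")
  case False
  have "cmod (iexp (- (t * a)) - iexp (- (t * b))) \<le> \<bar>t\<bar> * \<bar>b - a\<bar>"
    using iexp_diff_le[of "- (t * a)" "- (t * b)"] by (simp add: abs_mult[symmetric] algebra_simps)
  thus ?thesis using False
    by (simp add: levy_kernel_diff norm_divide norm_mult divide_le_eq mult.commute)
qed (simp add: levy_kernel_def)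

lemma levy_kernel_0 [simp]: "levy_kernel 0 t = 0"
  by (simp add: levy_kernel_def)

lemma levy_kernel_derivative:
  assumes "t \<noteq> 0"
  shows "((\<lambda>\<nu>. levy_kernel \<nu> t) has_vector_derivative iexp (- (t * \<nu>))) (at \<nu>)"
proof -
  have "((\<lambda>z. (1 - exp (- (\<i> * of_real t * z))) / (\<i> * of_real t)) has_field_derivative
      exp (- (\<i> * of_real t * of_real \<nu>))) (at (of_real \<nu>))"
    using assms by (auto intro!: derivative_eq_intros)
  from has_vector_derivative_real_field[OF this] show ?thesis
    by (simp add: levy_kernel_def[abs_def] mult.assoc)
qed

section \<open>Distributions with an integrable characteristic function\<close>

context real_distribution
begin

text \<open>The antiderivative, normalised to vanish at 0, of the inverse Fourier transform of
  \<open>char M\<close>. With the integration in \<nu> done first, its increments are the integrals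
  of Levy's inversion formula.\<close>

definition inverse_fourier :: "real \<Rightarrow> complex" where
  "inverse_fourier \<nu> = (\<integral>t. levy_kernel \<nu> t * char M t \<partial>lborel) / (2 * pi)"

context
  assumes char: "integrable lborel (char M)"
begin

lemma levy_kernel_char_integrable: 
  "integrable lborel (\<lambda>t. (levy_kernel b t - levy_kernel a t) * char M t)"
proof (rule Bochner_Integration.integrable_bound)
  show "integrable lborel (\<lambda>t. \<bar>b - a\<bar> * cmod (char M t))" using char by simp
  show "AE t in lborel. norm ((levy_kernel b t - levy_kernel a t) * char M t) \<le> norm (\<bar>b - a\<bar> * cmod (char M t))"
    by (auto simp: norm_mult intro!: mult_right_mono levy_kernel_diff_le)
qed (use char in measurable)

lemma inverse_fourier_diff: 
  "inverse_fourier b - inverse_fourier a = (\<integral>t. (levy_kernel b t - levy_kernel a t) * char M t \<partial>lborel) / (2 * pi)"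
proof -
  note i = levy_kernel_char_integrable[of b 0] levy_kernel_char_integrable[of a 0]
  have "(\<integral>t. (levy_kernel b t - levy_kernel a t) * char M t \<partial>lborel) = 
     (\<integral>t. levy_kernel b t * char M t \<partial>lborel) - (\<integral>t. levy_kernel a t * char M t \<partial>lborel)"
    using i by (simp add: left_diff_distrib)
  thus ?thesis by (simp add: inverse_fourier_def diff_divide_distrib)
qed

lemma inverse_fourier_derivative:
  "(inverse_fourier has_vector_derivative (\<integral>t. iexp (- (t * \<nu>)) * char M t \<partial>lborel) / (2 * pi)) (at \<nu>)"
proof -
  have "((\<lambda>\<nu>. \<integral>t. levy_kernel \<nu> t * char M t \<partial>lborel) has_vector_derivative
      (\<integral>t. iexp (- (t * \<nu>)) * char M t \<partial>lborel)) (at \<nu>)"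
  proof (rule has_vector_derivative_integral[where \<delta> = 1 and w = "\<lambda>t. cmod (char M t)"])
    show "integrable lborel (\<lambda>t. levy_kernel s t * char M t)" for s
      using levy_kernel_char_integrable[of s 0] by simp
    show "AE t in lborel. ((\<lambda>s. levy_kernel s t * char M t) has_vector_derivative iexp (- (t * \<nu>)) * char M t) (at \<nu>)"
      \<comment> \<open>At t = 0 division by zero makes the kernel vanish for every \<nu>, whereas
        the claimed derivative would be 1.\<close>
      using AE_lborel_singleton[of 0]
      by eventually_elim (intro has_vector_derivative_mult_left levy_kernel_derivative)
    show "AE t in lborel. norm (levy_kernel s t * char M t - levy_kernel \<nu> t * char M t) \<le> cmod (char M t) * \<bar>s - \<nu>\<bar>" for s
      by (auto simp: norm_mult left_diff_distrib[symmetric] mult.commute[of _ "\<bar>_\<bar>"] intro!: mult_right_mono levy_kernel_diff_le)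
    show "(\<lambda>t. iexp (- (t * \<nu>)) * char M t) \<in> borel_measurable lborel" using char by measurable
  qed (use char in auto)
  thus ?thesis unfolding inverse_fourier_def[abs_def] by (rule has_vector_derivative_divide)
qed

text \<open>Levy's formula is a limit of truncated integrals; since \<open>char M\<close> is
  integrable and the kernel bounded, dominated convergence replaces the limit by one integral. The
  condition on the end points comes from Levy's formula.\<close>

lemma measure_eq_inverse_fourier:
  assumes ab: "a \<le> b" and atoms: "measure M {a} = 0" "measure M {b} = 0"
  shows "of_real (measure M {a<..b}) = inverse_fourier b - inverse_fourier a"
proof (rule LIMSEQ_unique)
  let ?h = "\<lambda>t. (levy_kernel b t - levy_kernel a t) * char M t"
  have "(\<lambda>T. 1 / (2 * pi) * (CLBINT t=-T..T. ?h t)) \<longlonglongrightarrow> of_real (measure M {a<..b})"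
    using Levy_Inversion[OF ab atoms] unfolding levy_kernel_diff by simp
  moreover have "(CLBINT t=ereal (real_of_int (- int T))..ereal (real T). ?h t) = 
     (\<integral>t. indicator {- real T<..<real T} t *\<^sub>R ?h t \<partial>lborel)" for T
    by (simp add: interval_lebesgue_integral_def set_lebesgue_integral_def)
  ultimately show "(\<lambda>T. 1 / (2 * pi) * (\<integral>t. indicator {- real T<..<real T} t *\<^sub>R ?h t \<partial>lborel)) \<longlonglongrightarrow> of_real (measure M {a<..b})"
    by simp
  have "(\<lambda>T. \<integral>t. indicator {- real T<..<real T} t *\<^sub>R ?h t \<partial>lborel) \<longlonglongrightarrow> (\<integral>t. ?h t \<partial>lborel)"
  proof (rule integral_dominated_convergence[where w = "\<lambda>t. norm (?h t)"])
    show "integrable lborel (\<lambda>t. norm (?h t))" using levy_kernel_char_integrable by (rule integrable_norm)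
    show "AE t in lborel. (\<lambda>T. indicator {- real T<..<real T} t *\<^sub>R ?h t) \<longlonglongrightarrow> ?h t"
    proof (rule AE_I2, rule tendsto_eventually)
      fix t :: real
      have "\<forall>\<^sub>F n in sequentially. \<bar>t\<bar> < real n"
        using filterlim_real_sequentially by (simp add: filterlim_at_top_dense)
      thus "\<forall>\<^sub>F T in sequentially. indicator {- real T<..<real T} t *\<^sub>R ?h t = ?h t"
        by eventually_elim (auto simp: indicator_def)
    qed
    show "?h \<in> borel_measurable lborel" using levy_kernel_char_integrable by auto
    thus "(\<lambda>t. indicator {- real T<..<real T} t *\<^sub>R ?h t) \<in> borel_measurable lborel" for T by measurable
  qed (auto simp: indicator_def)
  from tendsto_mult_left[OF this, of "1 / (2 * pi)"]
  show "(\<lambda>T. 1 / (2 * pi) * (\<integral>t. indicator {- real T<..<real T} t *\<^sub>R ?h t \<partial>lborel)) \<longlonglongrightarrow> inverse_fourier b - inverse_fourier a"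
    by (simp add: inverse_fourier_diff)
qed

text \<open>\<open>D\<close> is constant on the points that are not atoms. There are only countably
  many atoms, so such points accumulate from the right at every x, and right-continuity of
  \<open>D\<close> extends the constancy to all x.\<close>

lemma cdf_eq_inverse_fourier:
  "of_real (cdf M b) - inverse_fourier b = of_real (cdf M a) - inverse_fourier a"
proof -
  define D where "D x = of_real (cdf M x) - inverse_fourier x" for x
  have noatom_aux: "D a = D b" if "measure M {a} = 0" "measure M {b} = 0" "a \<le> b" for a b
  proof -
    have "cdf M b - cdf M a = measure M {a<..b}" using that(3) cdf_diff_eq[of a b] by (cases "a = b") auto
    hence "complex_of_real (cdf M b) - of_real (cdf M a) = inverse_fourier b - inverse_fourier a"
      using measure_eq_inverse_fourier[OF that(3,1,2)] by (simp only: of_real_diff[symmetric])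
    moreover have "y - v = x - u" if "x - y = u - v" for x y u v :: complex
      using that by algebra
    ultimately show ?thesis unfolding D_def by blast
  qed
  have noatom: "D a = D b" if "measure M {a} = 0" "measure M {b} = 0" for a b
  proof (cases "a \<le> b")
    case True
    show ?thesis by (rule noatom_aux[OF that True])
  next
    case False
    thus ?thesis by (intro noatom_aux[OF that(2,1), symmetric]) simp
  qed
  have ex_noatom: "\<exists>c. a < c \<and> c < b \<and> measure M {c} = 0" if "a < b" for a b
  proof (rule ccontr)
    assume *: "\<not> ?thesis"
    have "{a<..<b} \<subseteq> {x. 0 < measure M {x}}"
      using * by (auto simp: less_le measure_nonneg)
    hence "countable {a<..<b}" using countable_atoms countable_subset by blast
    thus False using uncountable_open_interval[of a b] that by simp
  qed
  have "continuous (at_right x) inverse_fourier" for x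
    by (rule continuous_at_imp_continuous_at_within[OF
          has_vector_derivative_continuous[OF inverse_fourier_derivative]])
  hence cont: "(D \<longlongrightarrow> D x) (at_right x)" for x
    using cdf_is_right_cont[of x] unfolding D_def continuous_within
    by (intro tendsto_diff tendsto_of_real) blast+
  obtain c where c: "measure M {c} = 0" using ex_noatom[of 0 1] zero_less_one by blast
  have "D x = D c" for x
  proof (rule ccontr)
    assume "D x \<noteq> D c"
    hence "\<forall>\<^sub>F y in at_right x. D y \<noteq> D c" using cont[of x] tendsto_imp_eventually_ne by blast
    then obtain b where b: "x < b" "\<And>y. x < y \<Longrightarrow> y < b \<Longrightarrow> D y \<noteq> D c"
      unfolding eventually_at_right_field by blast
    obtain y where "x < y" "y < b" "measure M {y} = 0" using ex_noatom[OF b(1)] by blast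
    thus False using b(2) noatom[OF _ c] by blast
  qed
  thus ?thesis unfolding D_def by metis
qed

theorem cdf_has_density:
  "((\<lambda>\<nu>. complex_of_real (cdf M \<nu>)) has_vector_derivative (\<integral>t. iexp (- (t * \<nu>)) * char M t \<partial>lborel) / (2 * pi)) (at \<nu>)"
proof -
  have "(\<lambda>\<nu>. complex_of_real (cdf M \<nu>)) = (\<lambda>\<nu>. inverse_fourier \<nu> + (of_real (cdf M 0) - inverse_fourier 0))"
    using cdf_eq_inverse_fourier[of _ 0] by (auto simp: algebra_simps)
  thus ?thesis using has_vector_derivative_add[OF inverse_fourier_derivative has_vector_derivative_const] by simp
qed

end

end

section \<open>Densities of the forms (E(\<nu>) f, g)\<close>

context spectral_group
begin

text \<open>The inversion theorem concerns probability measures, so f is divided by its norm. If the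
  norm is zero, both sides vanish.\<close>

lemma F_has_density:
  assumes f: "f \<in> L2 M" and int: "integrable lborel (\<lambda>t. inn (U t f) f)"
  shows "((\<lambda>\<nu>. inn (E \<nu> f) f) has_vector_derivative
    (\<integral>t. iexp (- (t * \<nu>)) * inn (U t f) f \<partial>lborel) / (2 * pi)) (at \<nu>)"
proof (cases "nrm f = 0")
  case True
  have "inn (E \<nu> f) f = 0" for \<nu>
    using L2_Cauchy_Schwarz[of "E \<nu> f" M f] f True by simp
  moreover have "inn (U t f) f = 0" for t
    using L2_Cauchy_Schwarz[of "U t f" M f] f True by simp
  ultimately show ?thesis by simp
next
  case False
  define r where "r = nrm f"
  have r: "0 < r" using False L2_norm_nonneg[of M f] unfolding r_def by linarith
  define h where "h = (\<lambda>x. of_real (1 / r) * f x)"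
  have h: "h \<in> L2 M" unfolding h_def using f by (rule L2_scale)
  have Eh: "inn (E \<nu> h) h = inn (E \<nu> f) f / r\<^sup>2" for \<nu>
    unfolding h_def
    by (simp only: L2_inner_scale_right E_scale[OF f f]) (simp add: power2_eq_square)
  have Uh: "inn (U t h) h = inn (U t f) f / r\<^sup>2" for t
    unfolding h_def U_scale L2_inner_linear by (simp add: power2_eq_square)
  have nh: "nrm h = 1" unfolding h_def L2_norm_scale using r by (simp add: r_def norm_divide)
  interpret h: finite_borel_measure "spm h" using h by (rule spm_finite)
  have "prob_space (spm h)" by (rule prob_spaceI) (simp add: spm_UNIV[OF h] nh)
  then interpret h: real_distribution "spm h"
    by (intro real_distribution.intro real_distribution_axioms.intro) simp_all
  have char: "char (spm h) = (\<lambda>t. inn (U t f) f / r\<^sup>2)"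
    unfolding char_def using char_spectral_measure[OF h] by (auto simp: Uh)
  have "((\<lambda>\<nu>. of_real (r\<^sup>2) * complex_of_real (cdf (spm h) \<nu>)) has_vector_derivative
     of_real (r\<^sup>2) * ((\<integral>t. iexp (- (t * \<nu>)) * char (spm h) t \<partial>lborel) / (2 * pi))) (at \<nu>)"
    using int by (intro has_vector_derivative_mult_right h.cdf_has_density) (simp add: char)
  moreover have "of_real (r\<^sup>2) * complex_of_real (cdf (spm h) \<nu>) = inn (E \<nu> f) f" for \<nu>
    using r by (simp add: cdf_spm[OF h] inner_E_F[OF h, symmetric] Eh)
  ultimately show ?thesis using r by (simp add: char)
qed

lemma polarization:
  fixes B :: "('a \<Rightarrow> complex) \<Rightarrow> ('a \<Rightarrow> complex) \<Rightarrow> complex"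
  assumes "\<And>f f' g. f \<in> L2 M \<Longrightarrow> f' \<in> L2 M \<Longrightarrow> g \<in> L2 M \<Longrightarrow> B (\<lambda>x. f x + f' x) g = B f g + B f' g"
    and "\<And>f g g'. f \<in> L2 M \<Longrightarrow> g' \<in> L2 M \<Longrightarrow> g \<in> L2 M \<Longrightarrow> B f (\<lambda>x. g x + g' x) = B f g + B f g'"
    and "\<And>c f g. f \<in> L2 M \<Longrightarrow> g \<in> L2 M \<Longrightarrow> B (\<lambda>x. c * f x) g = c * B f g"
    and "\<And>c f g. f \<in> L2 M \<Longrightarrow> g \<in> L2 M \<Longrightarrow> B f (\<lambda>x. c * g x) = cnj c * B f g"
    and "f \<in> L2 M" "g \<in> L2 M"
  shows "B f g = (\<Sum>c\<in>{1, -1, \<i>, -\<i>}. c / 4 * B (\<lambda>x. f x + c * g x) (\<lambda>x. f x + c * g x))"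
proof -
  have "B (\<lambda>x. f x + c * g x) (\<lambda>x. f x + c * g x) = 
     B f f + cnj c * B f g + c * B g f + c * cnj c * B g g" for c
    using assms(5,6) by (simp add: assms(1-4) L2_add L2_scale algebra_simps)
  note BB = this[of 1] this[of "-1"] this[of \<i>] this[of "-\<i>"]
  show ?thesis
    using BB by (simp add: complex_eq_iff) (simp add: field_simps)
qed

text \<open>The subspace \<open>V\<close> contains the four combinations f + c g for which
  integrability is required. Polarizing (E(\<nu>) f, g) and (U(t) f, g) with the same scalars lets
  the four diagonal densities reassemble under the integral.\<close>

theorem spectral_family_has_density:
  assumes V: "V \<subseteq> L2 M" "\<And>f g c. f \<in> V \<Longrightarrow> g \<in> V \<Longrightarrow> (\<lambda>x. f x + c * g x) \<in> V"
    and int: "\<And>f g. f \<in> V \<Longrightarrow> g \<in> V \<Longrightarrow> integrable lborel (\<lambda>t. inn (U t f) g)"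
    and f: "f \<in> V" and g: "g \<in> V"
  shows "((\<lambda>\<nu>. inn (E \<nu> f) g) has_vector_derivative
    (\<integral>t. iexp (- (t * \<nu>)) * inn (U t f) g \<partial>lborel) / (2 * pi)) (at \<nu>)"
proof -
  have fg: "f \<in> L2 M" "g \<in> L2 M" using f g V by auto
  let ?h = "\<lambda>c x. f x + c * g x"
  have pE: "inn (E \<nu> f) g = (\<Sum>c\<in>{1, -1, \<i>, -\<i>}. c / 4 * inn (E \<nu> (?h c)) (?h c))" for \<nu>
    by (rule polarization) (auto simp: E_add E_scale L2_inner_linear fg L2_add)
  have pU: "inn (U t f) g = (\<Sum>c\<in>{1, -1, \<i>, -\<i>}. c / 4 * inn (U t (?h c)) (?h c))" for t
  proof (rule polarization)
    fix c f g assume "f \<in> L2 M" "g \<in> L2 M"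
    show "inn (U t (\<lambda>x. c * f x)) g = c * inn (U t f) g" by (subst U_scale) (rule L2_inner_scale_left)
  qed (simp_all only: U_add L2_inner_linear fg U_L2)
  have h: "?h c \<in> V" "?h c \<in> L2 M" for c using V f g by auto
  have i: "integrable lborel (\<lambda>t. iexp (- (t * \<nu>)) * inn (U t (?h c)) (?h c))" for c
  proof (rule Bochner_Integration.integrable_bound[OF int[OF h(1)[of c] h(1)[of c]]])
    have [measurable]: "(\<lambda>t. inn (U t (?h c)) (?h c)) \<in> borel_measurable lborel"
      using int[OF h(1) h(1)] by (rule borel_measurable_integrable)
    show "(\<lambda>t. iexp (- (t * \<nu>)) * inn (U t (?h c)) (?h c)) \<in> borel_measurable lborel" by measurable
  qed (simp add: norm_mult)
  have "((\<lambda>\<nu>. \<Sum>c\<in>{1, -1, \<i>, -\<i>}. c / 4 * inn (E \<nu> (?h c)) (?h c)) has_vector_derivative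
     (\<Sum>c\<in>{1, -1, \<i>, -\<i>}. c / 4 * ((\<integral>t. iexp (- (t * \<nu>)) * inn (U t (?h c)) (?h c) \<partial>lborel) / (2 * pi)))) (at \<nu>)"
    by (intro has_vector_derivative_sum has_vector_derivative_mult_right F_has_density h int)
  also have "(\<Sum>c\<in>{1, -1, \<i>, -\<i>}. c / 4 * ((\<integral>t. iexp (- (t * \<nu>)) * inn (U t (?h c)) (?h c) \<partial>lborel) / (2 * pi)))
    = (\<integral>t. (\<Sum>c\<in>{1, -1, \<i>, -\<i>}. c / 4 * (iexp (- (t * \<nu>)) * inn (U t (?h c)) (?h c))) \<partial>lborel) / (2 * pi)"
    by (subst Bochner_Integration.integral_sum) (use i in \<open>auto simp: sum_divide_distrib\<close>)
  also have "(\<lambda>t. \<Sum>c\<in>{1, -1, \<i>, -\<i>}. c / 4 * (iexp (- (t * \<nu>)) * inn (U t (?h c)) (?h c))) = (\<lambda>t. iexp (- (t * \<nu>)) * inn (U t f) g)"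
    unfolding pU sum_distrib_left by (intro ext sum.cong) auto
  finally show ?thesis unfolding pE .
qed

end

section \<open>Test functions\<close>

text \<open>The functions p(1/x) exp(-1/x), extended by 0, form a class closed under
  differentiation. Smoothness of the standard cut-off exp(-1/x) thus follows by induction with
  \<open>p\<close> arbitrary.\<close>

definition flat_exp :: "real poly \<Rightarrow> real \<Rightarrow> real" where
  "flat_exp p x = (if 0 < x then poly p (1 / x) * exp (- (1 / x)) else 0)"

lemma poly_times_exp_minus_tendsto_0: "((\<lambda>u::real. poly p u * exp (- u)) \<longlongrightarrow> 0) at_top"
proof -
  have "((\<lambda>u::real. \<Sum>i\<le>degree p. coeff p i * (u ^ i / exp u)) \<longlongrightarrow> (\<Sum>i\<le>degree p. coeff p i * 0)) at_top"
    by (intro tendsto_sum tendsto_mult tendsto_const tendsto_power_div_exp_0)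
  thus ?thesis by (simp add: poly_altdef exp_minus divide_inverse sum_distrib_right mult.assoc)
qed

lemma flat_exp_tendsto_0: "(flat_exp p \<longlongrightarrow> 0) (at 0)"
proof (rule filterlim_split_at)
  show "(flat_exp p \<longlongrightarrow> 0) (at_left 0)"
    by (rule tendsto_eventually) (auto simp: eventually_at_filter flat_exp_def)
  have "((\<lambda>x. poly p (1 / x) * exp (- (1 / x))) \<longlongrightarrow> 0) (at_right 0)"
    by (rule filterlim_compose[OF poly_times_exp_minus_tendsto_0])
      (use filterlim_inverse_at_top_right in \<open>simp add: inverse_eq_divide\<close>)
  thus "(flat_exp p \<longlongrightarrow> 0) (at_right 0)"
    by (rule Lim_transform_eventually) (auto simp: eventually_at_filter flat_exp_def)
qed

text \<open>For x > 0 the chain rule gives x^-2 (p - p')(1/x) exp(-1/x), whence the factor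
  \<open>monom 1 2\<close>. At 0 the exponential beats every power of 1/x.\<close>

lemma flat_exp_derivative: "(flat_exp p has_real_derivative flat_exp (monom 1 2 * (p - pderiv p)) x) (at x)"
proof -
  let ?q = "monom 1 2 * (p - pderiv p)"
  consider "0 < x" | "x = 0" | "x < 0" by linarith
  thus ?thesis
  proof cases
    case 1
    have "((\<lambda>x. poly p (1 / x) * exp (- (1 / x))) has_real_derivative flat_exp ?q x) (at x)"
      using 1 by (auto intro!: derivative_eq_intros poly_DERIV[THEN DERIV_chain2]
          simp: flat_exp_def poly_monom field_simps power2_eq_square)
    moreover have "\<forall>\<^sub>F y in nhds x. poly p (1 / y) * exp (- (1 / y)) = flat_exp p y"
      using eventually_nhds_in_open[of "{0<..}" x] 1 by (auto simp: flat_exp_def elim!: eventually_mono)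
    ultimately show ?thesis by (rule DERIV_cong_ev[OF refl _ refl, THEN iffD1, rotated])
  next
    case 2
    \<comment> \<open>Dividing by h multiplies the polynomial in 1/h by its variable, so the
      difference quotient is again a function of the class.\<close>
    have "(\<lambda>h. (flat_exp p (0 + h) - flat_exp p 0) / h) = flat_exp ([:0, 1:] * p)"
      by (auto simp: flat_exp_def)
    moreover have "flat_exp (monom 1 2 * (p - pderiv p)) 0 = 0" by (simp add: flat_exp_def)
    ultimately show ?thesis unfolding DERIV_def 2 using flat_exp_tendsto_0[of "[:0, 1:] * p"] by simp
  next
    case 3
    have "((\<lambda>x. 0) has_real_derivative flat_exp ?q x) (at x)" using 3 by (simp add: flat_exp_def)
    moreover have "\<forall>\<^sub>F y in nhds x. 0 = flat_exp p y"
      using eventually_nhds_in_open[of "{..<0}" x] 3 by (auto simp: flat_exp_def elim!: eventually_mono)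
    ultimately show ?thesis by (rule DERIV_cong_ev[OF refl _ refl, THEN iffD1, rotated])
  qed
qed

lemma flat_exp_continuous: "continuous_on A f \<Longrightarrow> continuous_on A (\<lambda>x. flat_exp p (f x))"
  by (rule continuous_on_compose2[of UNIV "flat_exp p"])
     (auto intro!: continuous_at_imp_continuous_on DERIV_isCont[OF flat_exp_derivative])

lemma flat_exp_affine_derivative:
  "((\<lambda>t. flat_exp p (c * t + e)) has_real_derivative c * flat_exp (monom 1 2 * (p - pderiv p)) (c * t + e)) (at t)"
proof -
  have "((\<lambda>t. flat_exp p (c * t + e)) has_real_derivative flat_exp (monom 1 2 * (p - pderiv p)) (c * t + e) * c) (at t)"
    by (rule DERIV_chain2[OF flat_exp_derivative]) (auto intro!: derivative_eq_intros)
  thus ?thesis by (simp add: mult.commute)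
qed

section \<open>Closure properties of \<open>Ck\<close>\<close>

definition partials :: "nat \<Rightarrow> (point \<Rightarrow> complex) \<Rightarrow> (point \<Rightarrow> complex) \<Rightarrow> (nat \<Rightarrow> point \<Rightarrow> complex) \<Rightarrow> bool" where
  "partials d f g G \<longleftrightarrow> (\<forall>(x1, x') \<in> Rd d.
     ((\<lambda>t. f (t, x')) has_vector_derivative g (x1, x')) (at x1) \<and>
     (\<forall>i\<in>{2..d}. ((\<lambda>t. f (x1, x'(i := t))) has_vector_derivative G i (x1, x')) (at (x' i))))"

text \<open>The separate existentials for the directions i are merged by choice into one family
  \<open>G\<close>, so that sums and products can be differentiated in all directions at
  once.\<close>

lemma Ck_Suc_iff:
  "Ck d (Suc k) f \<longleftrightarrow> continuous_on (Rd d) f \<and> (\<exists>g G. partials d f g G \<and> Ck d k g \<and> (\<forall>i\<in>{2..d}. Ck d k (G i)))"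
  (is "_ \<longleftrightarrow> ?R")
proof
  assume f: "Ck d (Suc k) f"
  then obtain g where g: "\<forall>(x\<^sub>1, x') \<in> Rd d. ((\<lambda>t. f (t, x')) has_vector_derivative g (x\<^sub>1, x')) (at x\<^sub>1)" "Ck d k g"
    by auto
  have "\<forall>i\<in>{2..d}. \<exists>h. (\<forall>(x\<^sub>1, x') \<in> Rd d.
      ((\<lambda>t. f (x\<^sub>1, x'(i := t))) has_vector_derivative h (x\<^sub>1, x')) (at (x' i))) \<and> Ck d k h"
    using f unfolding Ck.simps by blast
  from bchoice[OF this] obtain G where "\<forall>i\<in>{2..d}. (\<forall>(x\<^sub>1, x') \<in> Rd d.
      ((\<lambda>t. f (x\<^sub>1, x'(i := t))) has_vector_derivative G i (x\<^sub>1, x')) (at (x' i))) \<and> Ck d k (G i)" ..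
  with f g show ?R unfolding partials_def by (intro conjI exI[of _ g] exI[of _ G]) auto
next
  assume ?R
  thus "Ck d (Suc k) f" unfolding partials_def Ck.simps by blast
qed

lemma Ck_mono: "Ck d (Suc k) f \<Longrightarrow> Ck d k f"
proof (induction k arbitrary: f)
  case (Suc k)
  thus ?case unfolding Ck_Suc_iff[of d "Suc k"] Ck_Suc_iff[of d k f] by blast
qed simp

lemma Ck_add: "Ck d k f \<Longrightarrow> Ck d k g \<Longrightarrow> Ck d k (\<lambda>x. f x + g x)"
proof (induction k arbitrary: f g)
  case (Suc k)
  then obtain f1 F g1 G where *: "partials d f f1 F" "partials d g g1 G"
    "Ck d k f1" "\<forall>i\<in>{2..d}. Ck d k (F i)" "Ck d k g1" "\<forall>i\<in>{2..d}. Ck d k (G i)"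
    "continuous_on (Rd d) f" "continuous_on (Rd d) g"
    unfolding Ck_Suc_iff by blast
  have "partials d (\<lambda>x. f x + g x) (\<lambda>x. f1 x + g1 x) (\<lambda>i x. F i x + G i x)"
    using *(1,2) unfolding partials_def by (auto intro!: has_vector_derivative_add)
  thus ?case unfolding Ck_Suc_iff using * Suc.IH by (blast intro: continuous_on_add)
qed (auto intro: continuous_on_add)

lemma Ck_mult: "Ck d k f \<Longrightarrow> Ck d k g \<Longrightarrow> Ck d k (\<lambda>x. f x * g x)"
proof (induction k arbitrary: f g)
  case (Suc k)
  then obtain f1 F g1 G where *: "partials d f f1 F" "partials d g g1 G"
    "Ck d k f1" "\<forall>i\<in>{2..d}. Ck d k (F i)" "Ck d k g1" "\<forall>i\<in>{2..d}. Ck d k (G i)"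
    "continuous_on (Rd d) f" "continuous_on (Rd d) g"
    unfolding Ck_Suc_iff by blast
  note fg = Suc.prems[THEN Ck_mono]
  have "partials d (\<lambda>x. f x * g x) (\<lambda>x. f x * g1 x + f1 x * g x) (\<lambda>i x. f x * G i x + F i x * g x)"
    unfolding partials_def
  proof (intro ballI, clarify, intro conjI ballI)
    fix x1 x' assume x: "(x1, x') \<in> Rd d"
    show "((\<lambda>t. f (t, x') * g (t, x')) has_vector_derivative f (x1, x') * g1 (x1, x') + f1 (x1, x') * g (x1, x')) (at x1)"
      using *(1,2) x unfolding partials_def by (intro has_vector_derivative_mult) auto
    fix i assume i: "i \<in> {2..d}"
    have "((\<lambda>t. f (x1, x'(i := t)) * g (x1, x'(i := t))) has_vector_derivative
        f (x1, x'(i := x' i)) * G i (x1, x') + F i (x1, x') * g (x1, x'(i := x' i))) (at (x' i))"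
      using *(1,2) x i unfolding partials_def by (intro has_vector_derivative_mult) auto
    thus "((\<lambda>t. f (x1, x'(i := t)) * g (x1, x'(i := t))) has_vector_derivative
        f (x1, x') * G i (x1, x') + F i (x1, x') * g (x1, x')) (at (x' i))" by simp
  qed
  moreover have "Ck d k (\<lambda>x. f x * g1 x + f1 x * g x)" "\<forall>i\<in>{2..d}. Ck d k (\<lambda>x. f x * G i x + F i x * g x)"
    using * fg by (auto intro!: Ck_add Suc.IH)
  ultimately show ?case unfolding Ck_Suc_iff using *(7,8) by (blast intro: continuous_on_mult)
qed (auto intro: continuous_on_mult)

lemma Ck_const: "Ck d k (\<lambda>x. c)"
proof (induction k arbitrary: c)
  case (Suc k)
  have "partials d (\<lambda>x. c) (\<lambda>x. 0) (\<lambda>i x. 0)" by (auto simp: partials_def)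
  thus ?case unfolding Ck_Suc_iff using Suc.IH by (intro conjI exI) auto
qed simp

lemma Ck_prod: "(\<And>j. j \<in> J \<Longrightarrow> Ck d k (f j)) \<Longrightarrow> Ck d k (\<lambda>x. \<Prod>j\<in>J. f j x)"
  by (induction J rule: infinite_finite_induct) (auto intro: Ck_const Ck_mult)

lemma of_real_flat_exp_affine_derivative:
  "((\<lambda>t. complex_of_real (flat_exp p (c * t + e))) has_vector_derivative
     of_real c * of_real (flat_exp (monom 1 2 * (p - pderiv p)) (c * t + e))) (at t)"
  unfolding of_real_mult[symmetric]
  by (intro has_vector_derivative_of_real flat_exp_affine_derivative)

lemma continuous_on_coordinate: "continuous_on A (\<lambda>x :: point. snd x i)"
  by (rule continuous_on_compose2[OF continuous_on_product_coordinates continuous_on_snd[OF continuous_on_id]]) simp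

lemma Ck_flat_fst: "Ck d k (\<lambda>x. complex_of_real (flat_exp p (c * fst x + e)))"
proof (induction k arbitrary: p)
  case 0
  thus ?case by (auto intro!: continuous_intros flat_exp_continuous)
next
  case (Suc k)
  show ?case
  proof (unfold Ck_Suc_iff, intro conjI exI ballI)
    show "partials d (\<lambda>x. complex_of_real (flat_exp p (c * fst x + e)))
      (\<lambda>x. of_real c * of_real (flat_exp (monom 1 2 * (p - pderiv p)) (c * fst x + e))) (\<lambda>i x. 0)"
      by (auto simp: partials_def intro!: of_real_flat_exp_affine_derivative)
    show "continuous_on (Rd d) (\<lambda>x. complex_of_real (flat_exp p (c * fst x + e)))"
      by (auto intro!: continuous_intros flat_exp_continuous)
  qed (auto intro!: Ck_mult Ck_const Suc.IH)
qed

lemma Ck_flat_snd: "Ck d k (\<lambda>x. complex_of_real (flat_exp p (c * snd x j + e)))"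
proof (induction k arbitrary: p)
  case 0
  thus ?case by (auto intro!: continuous_intros flat_exp_continuous continuous_on_coordinate)
next
  case (Suc k)
  let ?g = "\<lambda>x :: point. of_real c * complex_of_real (flat_exp (monom 1 2 * (p - pderiv p)) (c * snd x j + e))"
  show ?case
  proof (unfold Ck_Suc_iff, intro conjI exI ballI)
    show "partials d (\<lambda>x. complex_of_real (flat_exp p (c * snd x j + e))) (\<lambda>x. 0) (\<lambda>i x. if i = j then ?g x else 0)"
      by (auto simp: partials_def intro!: of_real_flat_exp_affine_derivative)
    show "continuous_on (Rd d) (\<lambda>x. complex_of_real (flat_exp p (c * snd x j + e)))"
      by (auto intro!: continuous_intros flat_exp_continuous continuous_on_coordinate)
    show "Ck d k (\<lambda>x. if i = j then ?g x else 0)" for i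
      by (cases "i = j") (auto intro!: Ck_mult Ck_const Suc.IH)
  qed (rule Ck_const)
qed

text \<open>For c > 0 a smooth function with values in [0, 1], positive exactly on (a, b). The
  parameter \<open>c\<close> is a sharpness: since exp(-1/(c y)) tends to 1 for y > 0 as c grows,
  the bump tends to the indicator of the open interval.\<close>

definition bump :: "real \<Rightarrow> real \<Rightarrow> real \<Rightarrow> real \<Rightarrow> real" where
  "bump c a b x = flat_exp 1 (c * x + - c * a) * flat_exp 1 (- c * x + c * b)"

text \<open>The product rule, in which \<open>flat_exp (monom 1 2)\<close> is the derivative of
  \<open>flat_exp 1\<close>.\<close>

definition bump' :: "real \<Rightarrow> real \<Rightarrow> real \<Rightarrow> real \<Rightarrow> real" where
  "bump' c a b x = c * flat_exp (monom 1 2) (c * x + - c * a) * flat_exp 1 (- c * x + c * b)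
     - c * flat_exp 1 (c * x + - c * a) * flat_exp (monom 1 2) (- c * x + c * b)"

lemma bump_derivative: "(bump c a b has_real_derivative bump' c a b x) (at x)"
proof -
  from DERIV_mult[OF flat_exp_affine_derivative[of 1 c "- c * a" x] flat_exp_affine_derivative[of 1 "- c" "c * b" x]]
  show ?thesis by (simp add: bump_def[abs_def] bump'_def algebra_simps)
qed

lemma bump_continuous: "continuous_on A (bump c a b)" "continuous_on A (bump' c a b)"
  unfolding bump_def[abs_def] bump'_def[abs_def]
  by (auto intro!: continuous_intros flat_exp_continuous)

lemma bump_measurable [measurable]: "bump c a b \<in> borel_measurable borel" "bump' c a b \<in> borel_measurable borel"
  by (auto intro!: borel_measurable_continuous_onI bump_continuous)

lemma flat_exp_1: "0 \<le> flat_exp 1 x" "flat_exp 1 x \<le> 1"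
  by (auto simp: flat_exp_def)

lemma bump_bounds: "0 \<le> bump c a b x" "bump c a b x \<le> 1"
  unfolding bump_def by (auto intro!: mult_nonneg_nonneg mult_le_one flat_exp_1)

lemma bump_outside: 
  assumes "0 < c" "x \<notin> {a<..<b}" shows "bump c a b x = 0" "bump' c a b x = 0"
proof -
  have "c * x + - c * a \<le> 0 \<or> - c * x + c * b \<le> 0"
    using assms mult_left_mono[of x a c] mult_left_mono[of b x c] by auto
  thus "bump c a b x = 0" "bump' c a b x = 0" by (auto simp: bump_def bump'_def flat_exp_def)
qed

lemma bump'_bounded: 
  assumes "0 < c" obtains B where "0 \<le> B" "\<And>x. \<bar>bump' c a b x\<bar> \<le> B"
proof -
  have "compact (bump' c a b ` {a..b})" by (intro compact_continuous_image bump_continuous compact_Icc)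
  hence "bounded (bump' c a b ` {a..b})" by (rule compact_imp_bounded)
  then obtain B where B: "\<And>x. x \<in> {a..b} \<Longrightarrow> \<bar>bump' c a b x\<bar> \<le> B"
    unfolding bounded_iff real_norm_def by blast
  show ?thesis
  proof (rule that[of "max 0 B"])
    fix x show "\<bar>bump' c a b x\<bar> \<le> max 0 B"
      using B[of x] bump_outside(2)[OF assms, of x a b] by (cases "x \<in> {a<..<b}") (auto simp: le_max_iff_disj)
  qed simp
qed

lemma bump_translate: "bump c a b (x - y) = bump c (a + y) (b + y) x" "bump' c a b (x - y) = bump' c (a + y) (b + y) x"
  by (simp_all add: bump_def bump'_def algebra_simps)

lemma bump_tendsto_indicator: "(\<lambda>n. bump (real (Suc n)) a b x) \<longlonglongrightarrow> indicator {a<..<b} x"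
proof (cases "x \<in> {a<..<b}")
  case True
  have *: "(\<lambda>n. flat_exp 1 (real (Suc n) * y)) \<longlonglongrightarrow> 1" if "0 < y" for y
  proof -
    have "(\<lambda>n. exp (- (1 / (real (Suc n)) * (1 / y)))) \<longlonglongrightarrow> exp (- (0 * (1 / y)))"
      by (intro tendsto_intros) (use LIMSEQ_inverse_real_of_nat in \<open>simp add: inverse_eq_divide\<close>)
    thus ?thesis using that by (simp add: flat_exp_def)
  qed
  have "(\<lambda>n. flat_exp 1 (real (Suc n) * (x - a)) * flat_exp 1 (real (Suc n) * (b - x))) \<longlonglongrightarrow> 1 * 1"
    using True by (intro tendsto_mult *) auto
  moreover have "bump c a b x = flat_exp 1 (c * (x - a)) * flat_exp 1 (c * (b - x))" for c
    by (simp add: bump_def algebra_simps)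
  ultimately show ?thesis using True by simp
next
  case False
  hence "bump (real (Suc n)) a b x = 0" for n by (intro bump_outside) auto
  thus ?thesis using False by (simp only: indicator_simps) simp
qed

definition bump_prod :: "nat \<Rightarrow> real \<Rightarrow> (nat \<Rightarrow> real) \<Rightarrow> (nat \<Rightarrow> real) \<Rightarrow> (nat \<Rightarrow> real) \<Rightarrow> real" where
  "bump_prod d c a b x' = (\<Prod>i\<in>{2..d}. bump c (a i) (b i) (x' i))"

lemma bump_prod_bounds: "0 \<le> bump_prod d c a b x'" "bump_prod d c a b x' \<le> 1"
  unfolding bump_prod_def by (auto intro!: prod_nonneg prod_le_1 bump_bounds)

lemma bump_test_function:
  assumes c: "0 < c" and e: "0 < e"
  shows "(\<lambda>(x1, x'). complex_of_real (bump c u v x1 * bump_prod d e a b x')) \<in> test_functions d"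
    (is "?\<phi> \<in> _")
proof -
  have eq: "?\<phi> = (\<lambda>x. (complex_of_real (flat_exp 1 (c * fst x + - c * u)) * of_real (flat_exp 1 (- c * fst x + c * v))) *
     (\<Prod>i\<in>{2..d}. complex_of_real (flat_exp 1 (e * snd x i + - e * a i)) * of_real (flat_exp 1 (- e * snd x i + e * b i))))"
    by (auto simp: bump_def bump_prod_def fun_eq_iff)
  have "Ck d k ?\<phi>" for k
    unfolding eq by (intro Ck_mult Ck_prod Ck_flat_fst Ck_flat_snd)
  moreover have "\<exists>K. compact K \<and> K \<subseteq> Rd d \<and> (\<forall>x \<in> Rd d - K. ?\<phi> x = 0)"
  proof (intro exI conjI ballI)
    \<comment> \<open>Points of \<open>cross_space d\<close> take the value \<open>undefined\<close>
      off {2..d}. Confining these coordinates to a singleton makes the set compact in the product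
      over all naturals and keeps it inside \<open>Rd d\<close>.\<close>
    let ?C = "\<lambda>i. if i \<in> {2..d} then {a i..b i} else {undefined}"
    let ?K = "{u..v} \<times> (\<Pi>\<^sub>E i\<in>UNIV. ?C i)"
    have "compactin (product_topology (\<lambda>i. euclidean) UNIV) (\<Pi>\<^sub>E i\<in>UNIV. ?C i)"
      unfolding compactin_PiE by auto
    hence "compact (\<Pi>\<^sub>E i\<in>UNIV. ?C i)"
      by (simp add: euclidean_product_topology)
    thus "compact ?K" by (intro compact_Times) auto
    show "?K \<subseteq> Rd d" by (auto simp: Rd_def cross_space_def PiE_def Pi_def extensional_def split: if_splits)
    fix x assume x: "x \<in> Rd d - ?K"
    obtain x1 x' where x': "x = (x1, x')" by force
    have "x1 \<notin> {u..v} \<or> (\<exists>i\<in>{2..d}. x' i \<notin> {a i..b i})"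
    proof (rule ccontr)
      assume "\<not> ?thesis"
      moreover have "x' i = undefined" if "i \<notin> {2..d}" for i
        using x that unfolding x' by (auto simp: Rd_def cross_space_def PiE_def extensional_def)
      ultimately show False using x unfolding x'
        by (simp add: PiE_iff) (metis atLeastAtMost_iff singletonI)
    qed
    thus "?\<phi> x = 0"
    proof
      assume "x1 \<notin> {u..v}"
      hence "bump c u v x1 = 0" by (intro bump_outside c) auto
      thus ?thesis by (simp add: x')
    next
      assume "\<exists>i\<in>{2..d}. x' i \<notin> {a i..b i}"
      then obtain i where "i \<in> {2..d}" "x' i \<notin> {a i..b i}" by blast
      hence "bump_prod d e a b x' = 0" unfolding bump_prod_def
        using bump_outside(1)[OF e, of "x' i" "a i" "b i"] by (intro prod_zero bexI[of _ i]) auto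
      thus ?thesis by (simp add: x')
    qed
  qed
  ultimately show ?thesis by (simp add: test_functions_def)
qed

section \<open>Dense subspaces\<close>

text \<open>The sets over which \<open>u\<close> has integral zero form a Dynkin system:
  \<open>whole\<close> provides complements, countable additivity the disjoint unions. Containing an
  intersection-stable generator, it is the whole sigma-algebra.\<close>

lemma (in sigma_finite_measure) AE_zero_of_generator:
  fixes u :: "'a \<Rightarrow> 'b::{banach, second_countable_topology}"
  assumes u: "integrable M u"
    and G: "Int_stable G" "G \<subseteq> Pow (space M)" "sets M = sigma_sets (space M) G"
    and zero: "\<And>A. A \<in> G \<Longrightarrow> (\<integral>x. indicator A x *\<^sub>R u x \<partial>M) = 0" and whole: "(\<integral>x. u x \<partial>M) = 0"
  shows "AE x in M. u x = 0"
proof (rule density_zero[OF u])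
  fix A assume A: "A \<in> sets M"
  have "A \<in> sigma_sets (space M) G" using A G(3) by simp
  with G(1,2) show "set_lebesgue_integral M A u = 0"
  proof (induction rule: sigma_sets_induct_disjoint)
    case (basic A)
    thus ?case using zero by (simp add: set_lebesgue_integral_def)
  next
    case empty
    thus ?case by (simp add: set_lebesgue_integral_def)
  next
    case (compl A)
    have [measurable]: "A \<in> sets M" using compl.hyps G(3) by simp
    have "(\<integral>x. indicator (space M - A) x *\<^sub>R u x \<partial>M) = (\<integral>x. u x - indicator A x *\<^sub>R u x \<partial>M)"
      by (intro Bochner_Integration.integral_cong) (auto simp: indicator_def)
    also have "\<dots> = 0"
      using compl.IH u whole integrable_mult_indicator[OF \<open>A \<in> sets M\<close> u] by (simp add: set_lebesgue_integral_def)
    finally show ?case by (simp add: set_lebesgue_integral_def)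
  next
    case (union A)
    have A: "A i \<in> sets M" for i using union.hyps(2) G(3) by auto
    have "set_integrable M (\<Union>i. A i) u"
      unfolding set_integrable_def using A u by (intro integrable_mult_indicator) auto
    hence "set_lebesgue_integral M (\<Union>i. A i) u = (\<Sum>i. set_lebesgue_integral M (A i) u)"
      using A union.hyps(1) by (intro lebesgue_integral_countable_add) (auto simp: disjoint_family_on_def)
    thus ?case using union.IH by simp
  qed
qed

definition L2_subspace :: "'a measure \<Rightarrow> ('a \<Rightarrow> complex) set \<Rightarrow> bool" where
  "L2_subspace M S \<longleftrightarrow> S \<subseteq> L2 M \<and> (\<forall>f\<in>S. \<forall>g\<in>S. \<forall>c. (\<lambda>x. f x + c * g x) \<in> S)"

definition L2_closure :: "'a measure \<Rightarrow> ('a \<Rightarrow> complex) set \<Rightarrow> ('a \<Rightarrow> complex) set" where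
  "L2_closure M S = {f \<in> L2 M. \<forall>e>0. \<exists>h\<in>S. L2_norm M (\<lambda>x. f x - h x) < e}"

lemma L2_closureD: "f \<in> L2_closure M S \<Longrightarrow> 0 < e \<Longrightarrow> \<exists>h\<in>S. L2_norm M (\<lambda>x. f x - h x) < e"
  by (simp add: L2_closure_def)

lemma L2_closure_limit:
  assumes F: "\<And>n. F n \<in> L2_closure M S" and f: "f \<in> L2 M" and S: "S \<subseteq> L2 M"
    and lim: "(\<lambda>n::nat. L2_norm M (\<lambda>x. f x - F n x)) \<longlonglongrightarrow> 0"
  shows "f \<in> L2_closure M S"
  unfolding L2_closure_def
proof (intro CollectI conjI f allI impI)
  fix e :: real assume e: "0 < e"
  have "\<forall>\<^sub>F n in sequentially. L2_norm M (\<lambda>x. f x - F n x) < e / 2"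
    using order_tendstoD(2)[OF lim, of "e / 2"] e by simp
  then obtain n where n: "L2_norm M (\<lambda>x. f x - F n x) < e / 2"
    by (meson eventually_happens sequentially_bot)
  obtain h where h: "h \<in> S" "L2_norm M (\<lambda>x. F n x - h x) < e / 2"
    using L2_closureD[OF F half_gt_zero[OF e]] by blast
  have "L2_norm M (\<lambda>x. f x - h x) < e"
    using L2_norm_triangle3[OF f, of "F n" h] F[of n] h S n by (auto simp: L2_closure_def)
  thus "\<exists>h\<in>S. L2_norm M (\<lambda>x. f x - h x) < e" using h by blast
qed

lemma L2_closure_linear:
  assumes S: "L2_subspace M S"
    and f: "f \<in> L2_closure M S" and g: "g \<in> L2_closure M S"
  shows "(\<lambda>x. f x + c * g x) \<in> L2_closure M S"
  unfolding L2_closure_def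
proof (intro CollectI conjI allI impI)
  have L: "f \<in> L2 M" "g \<in> L2 M" using f g by (auto simp: L2_closure_def)
  show "(\<lambda>x. f x + c * g x) \<in> L2 M" using L by (intro L2_add L2_scale)
  fix e :: real assume e: "0 < e"
  have c: "0 < cmod c + 1" by (simp add: add_nonneg_pos)
  obtain h where h: "h \<in> S" "L2_norm M (\<lambda>x. f x - h x) < e / 2"
    using L2_closureD[OF f half_gt_zero[OF e]] by blast
  have "0 < e / 2 / (cmod c + 1)" using e c by simp
  then obtain k where k: "k \<in> S" "L2_norm M (\<lambda>x. g x - k x) < e / 2 / (cmod c + 1)"
    using L2_closureD[OF g] by blast
  have hk: "h \<in> L2 M" "k \<in> L2 M" "(\<lambda>x. h x + c * k x) \<in> S" using h k S by (auto simp: L2_subspace_def)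
  have "L2_norm M (\<lambda>x. (f x + c * g x) - (h x + c * k x)) = L2_norm M (\<lambda>x. (f x - h x) + c * (g x - k x))"
    by (simp add: algebra_simps)
  also have "\<dots> \<le> L2_norm M (\<lambda>x. f x - h x) + L2_norm M (\<lambda>x. c * (g x - k x))"
    using L hk by (intro L2_norm_triangle L2_scale L2_diff)
  also have "L2_norm M (\<lambda>x. c * (g x - k x)) \<le> (cmod c + 1) * L2_norm M (\<lambda>x. g x - k x)"
    by (simp add: L2_norm_scale mult_right_mono)
  also have "\<dots> < e / 2" using k(2) c by (simp add: field_simps)
  finally have "L2_norm M (\<lambda>x. (f x + c * g x) - (h x + c * k x)) < e" using h(2) by simp
  thus "\<exists>h\<in>S. L2_norm M (\<lambda>x. f x + c * g x - h x) < e" by (intro bexI[OF _ hk(3)])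
qed

lemma L2_dominated_convergence:
  assumes F: "\<And>n. F n \<in> borel_measurable M" and g: "g \<in> L2 M"
    and bound: "\<And>n x. x \<in> space M \<Longrightarrow> cmod (F n x) \<le> C * cmod (g x)"
    and lim: "\<And>x. x \<in> space M \<Longrightarrow> (\<lambda>n. F n x) \<longlonglongrightarrow> f x"
  shows "f \<in> L2 M" "(\<lambda>n. L2_norm M (\<lambda>x. f x - F n x)) \<longlonglongrightarrow> 0"
proof -
  have f_meas[measurable]: "f \<in> borel_measurable M" by (rule borel_measurable_LIMSEQ_metric[OF F lim])
  have fb: "cmod (f x) \<le> C * cmod (g x)" if "x \<in> space M" for x
    using bound[OF that] tendsto_norm[OF lim[OF that]] by (intro LIMSEQ_le_const2) auto
  show f: "f \<in> L2 M" by (rule L2_dominated[OF g f_meas fb])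
  have "(\<lambda>n. \<integral>x. (cmod (f x - F n x))\<^sup>2 \<partial>M) \<longlonglongrightarrow> (\<integral>x. 0 \<partial>M)"
  proof (rule integral_dominated_convergence[where w = "\<lambda>x. (2 * C)\<^sup>2 * (cmod (g x))\<^sup>2"])
    show "integrable M (\<lambda>x. (2 * C)\<^sup>2 * (cmod (g x))\<^sup>2)" using L2_integrable[OF g] by simp
    show "AE x in M. (\<lambda>n. (cmod (f x - F n x))\<^sup>2) \<longlonglongrightarrow> 0"
    proof (rule AE_I2)
      fix x assume "x \<in> space M"
      have "(\<lambda>n. (cmod (f x - F n x))\<^sup>2) \<longlonglongrightarrow> (cmod (f x - f x))\<^sup>2"
        by (intro tendsto_intros lim \<open>x \<in> space M\<close>)
      thus "(\<lambda>n. (cmod (f x - F n x))\<^sup>2) \<longlonglongrightarrow> 0" by simp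
    qed
    fix n
    show "AE x in M. norm ((cmod (f x - F n x))\<^sup>2) \<le> (2 * C)\<^sup>2 * (cmod (g x))\<^sup>2"
    proof (rule AE_I2)
      fix x assume x: "x \<in> space M"
      have "cmod (f x - F n x) \<le> 2 * C * cmod (g x)"
        using norm_triangle_ineq4[of "f x" "F n x"] fb[OF x] bound[OF x, of n] by linarith
      hence "(cmod (f x - F n x))\<^sup>2 \<le> (2 * C * cmod (g x))\<^sup>2" by (intro power_mono) auto
      thus "norm ((cmod (f x - F n x))\<^sup>2) \<le> (2 * C)\<^sup>2 * (cmod (g x))\<^sup>2" by (simp add: power_mult_distrib)
    qed
    show "(\<lambda>x. (cmod (f x - F n x))\<^sup>2) \<in> borel_measurable M" using F[of n] by measurable
  qed simp
  from tendsto_real_sqrt[OF this] show "(\<lambda>n. L2_norm M (\<lambda>x. f x - F n x)) \<longlonglongrightarrow> 0"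
    by (simp add: L2_norm_def)
qed

lemma L2_bounded_finite:
  assumes "f \<in> borel_measurable M" "A \<in> sets M" "emeasure M A < \<infinity>" "\<And>x. x \<in> space M \<Longrightarrow> cmod (f x) \<le> C * indicator A x"
  shows "f \<in> L2 M"
proof -
  have "indicator A \<in> L2 M"
  proof (rule L2I)
    have "(\<lambda>x. (cmod (indicator A x))\<^sup>2) = (indicator A :: _ \<Rightarrow> real)" by (auto simp: indicator_def)
    thus "integrable M (\<lambda>x. (cmod (indicator A x))\<^sup>2)" using assms by simp
  qed (use assms in auto)
  thus ?thesis
  proof (rule L2_dominated[where C = C])
    fix x assume "x \<in> space M"
    thus "cmod (f x) \<le> C * cmod (indicator A x)"
      using assms(4)[of x] by (cases "x \<in> A") auto
  qed fact
qed

text \<open>A Dynkin argument relative to each \<open>K m\<close>: the complement of a set of finite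
  measure may have infinite measure, so the induction runs over \<open>A \<inter> K m\<close>. From
  indicators one passes to functions supported in some \<open>K m\<close>, and from these to all of
  \<open>L2 M\<close> by exhaustion.\<close>

theorem L2_closure_of_generator:
  fixes K :: "nat \<Rightarrow> 'a set"
  assumes S: "L2_subspace M S"
    and G: "Int_stable G" "G \<subseteq> Pow (space M)" "sets M = sigma_sets (space M) G"
    and K: "\<And>m. K m \<in> G" "\<And>m. emeasure M (K m) < \<infinity>" "incseq K" "(\<Union>m. K m) = space M"
    and gen: "\<And>A. A \<in> G \<Longrightarrow> emeasure M A < \<infinity> \<Longrightarrow> indicator A \<in> L2_closure M S"
    and f: "f \<in> L2 M"
  shows "f \<in> L2_closure M S"
proof -
  have Kset [measurable]: "K m \<in> sets M" for m using K(1) G(3) by auto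
  have SL: "S \<subseteq> L2 M" using S by (simp add: L2_subspace_def)
  note lin = L2_closure_linear[OF S]
  have ind: "indicator (A \<inter> K m) \<in> L2_closure M S" if "A \<in> sets M" for A m
  proof -
    have "A \<in> sigma_sets (space M) G" using that G(3) by simp
    with G(1,2) show ?thesis
    proof (induction rule: sigma_sets_induct_disjoint)
      case (basic A)
      have "emeasure M (A \<inter> K m) \<le> emeasure M (K m)" by (intro emeasure_mono) auto
      thus ?case using basic K(1,2)[of m] G(1) by (intro gen) (auto simp: Int_stable_def le_less_trans)
    next
      case empty
      have "(\<lambda>x. indicator (K m) x + (-1) * indicator (K m) x) \<in> L2_closure M S"
        by (intro lin gen K)
      thus ?case by (simp add: indicator_def[abs_def])
    next
      case (compl A)
      have "(\<lambda>x. indicator (K m) x + (-1) * indicator (A \<inter> K m) x) \<in> L2_closure M S"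
        by (intro lin gen K compl.IH)
      moreover have "(\<lambda>x. indicator (K m) x + (-1) * indicator (A \<inter> K m) x) = (indicator ((space M - A) \<inter> K m) :: _ \<Rightarrow> complex)"
        using K(1)[of m] G(2) by (auto simp: fun_eq_iff indicator_def)
      ultimately show ?case by simp
    next
      case (union A)
      have A [measurable]: "A i \<in> sets M" for i using union.hyps(2) G(3) by auto
      define F where "F n x = (indicator ((\<Union>i<n. A i) \<inter> K m) x :: complex)" for n x
      have F: "F n \<in> L2_closure M S" for n
      proof (induction n)
        case 0
        have "(\<lambda>x. indicator (K m) x + (-1) * indicator (K m) x) \<in> L2_closure M S"
          by (intro lin gen K)
        thus ?case by (simp add: F_def[abs_def] indicator_def)
      next
        case (Suc n)
        have "(\<lambda>x. F n x + 1 * indicator (A n \<inter> K m) x) = F (Suc n)"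
          using disjoint_family_onD[OF union.hyps(1), of _ n]
          by (auto simp: F_def fun_eq_iff indicator_def less_Suc_eq) fastforce+
        thus ?case using lin[OF Suc union.IH[of n], of 1] by simp
      qed
      have KL: "indicator (K m) \<in> L2 M" using gen[OF K(1,2)] by (simp add: L2_closure_def)
      have Fm: "F n \<in> borel_measurable M" for n unfolding F_def[abs_def] by measurable
      have Fb: "cmod (F n x) \<le> 1 * cmod (indicator (K m) x)" for n x by (auto simp: F_def indicator_def)
      have Fl: "(\<lambda>n. F n x) \<longlonglongrightarrow> indicator ((\<Union>i. A i) \<inter> K m) x" for x
      proof (cases "x \<in> (\<Union>i. A i) \<inter> K m")
        case True
        then obtain i where "x \<in> A i" "x \<in> K m" by auto
        hence "F n x = indicator ((\<Union>i. A i) \<inter> K m) x" if "n > i" for n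
          using that by (auto simp: F_def indicator_def)
        thus ?thesis by (intro tendsto_eventually eventually_at_top_linorderI[of "Suc i"]) auto
      qed (auto simp: F_def indicator_def)
      show ?case
        by (rule L2_closure_limit[OF F _ SL]) (rule L2_dominated_convergence[OF Fm KL Fb Fl])+
    qed
  qed
  \<comment> \<open>\<open>f\<close> is supported in \<open>K m\<close> but may be unbounded there.
    The simple functions \<open>s i\<close> inherit the support from the bound by 2 |f|, so their
    level sets may be intersected with \<open>K m\<close>.\<close>
  have bounded_on_K: "f \<in> L2_closure M S" if f: "f \<in> L2 M" and supp: "\<And>x. x \<notin> K m \<Longrightarrow> f x = 0" for f m
  proof -
    obtain s where s: "\<And>i. simple_function M (s i)" "\<And>x. x \<in> space M \<Longrightarrow> (\<lambda>i. s i x) \<longlonglongrightarrow> f x"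
      "\<And>i x. x \<in> space M \<Longrightarrow> norm (s i x) \<le> 2 * norm (f x)"
      using borel_measurable_implies_sequence_metric[OF L2_measurable[OF f], of 0] by simp blast
    have "s i \<in> L2_closure M S" for i
    proof -
      define g where "g y = (indicator ((s i -` {y} \<inter> space M) \<inter> K m) :: _ \<Rightarrow> complex)" for y
      have g: "g y \<in> L2_closure M S" for y
        unfolding g_def using simple_functionD(2)[OF s(1)] by (intro ind) auto
      have fin: "finite (s i ` space M)" using s(1) by (rule simple_functionD)
      have "(\<lambda>x. \<Sum>y\<in>Y. y * g y x) \<in> L2_closure M S" if "finite Y" for Y
        using that
      proof (induction Y)
        case empty
        have "(\<lambda>x. g 0 x + (-1) * g 0 x) \<in> L2_closure M S" by (intro lin g)
        thus ?case by simp
      next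
        case (insert y Y)
        from lin[OF insert.IH g, of y y] insert.hyps show ?case by (simp add: add.commute)
      qed
      from this[OF fin] have *: "(\<lambda>x. \<Sum>y\<in>s i ` space M. y * g y x) \<in> L2_closure M S" .
      have eq: "(\<Sum>y\<in>s i ` space M. y * g y x) = s i x" if x: "x \<in> space M" for x
      proof -
        have "(\<Sum>y\<in>s i ` space M. y * g y x) = (\<Sum>y\<in>s i ` space M. if y = s i x then y * indicator (K m) x else 0)"
          using x by (intro sum.cong) (auto simp: g_def indicator_def)
        also have "\<dots> = s i x * indicator (K m) x" using fin x by (simp add: sum.delta)
        also have "\<dots> = s i x" using supp[of x] s(3)[OF x, of i] by (auto simp: indicator_def)
        finally show ?thesis .
      qed
      show ?thesis
      \<comment> \<open>A constant sequence: the sum agrees with \<open>s i\<close> only on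
        \<open>space M\<close>, and a limit at distance zero passes from one representative to the
        other.\<close>
      proof (rule L2_closure_limit[OF _ _ SL])
        show "(\<lambda>x. \<Sum>y\<in>s i ` space M. y * g y x) \<in> L2_closure M S" for n :: nat by (rule *)
        show sL: "s i \<in> L2 M"
          by (rule L2_dominated[OF f borel_measurable_simple_function[OF s(1)] s(3)])
        have "L2_norm M (\<lambda>x. s i x - (\<Sum>y\<in>s i ` space M. y * g y x)) = L2_norm M (\<lambda>x. 0)"
          using * eq sL by (intro L2_norm_cong_AE) (auto simp: L2_closure_def)
        thus "(\<lambda>n. L2_norm M (\<lambda>x. s i x - (\<Sum>y\<in>s i ` space M. y * g y x))) \<longlonglongrightarrow> 0" by simp
      qed
    qed
    thus ?thesis
      by (rule L2_closure_limit[OF _ f SL])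
         (rule L2_dominated_convergence[OF borel_measurable_simple_function[OF s(1)] f s(3) s(2)])
  qed
  let ?F = "\<lambda>m x. indicator (K m) x * f x"
  have Fm: "?F m \<in> borel_measurable M" for m using L2_measurable[OF f] by measurable
  have Fb: "cmod (?F m x) \<le> 1 * cmod (f x)" for m x by (simp add: norm_mult indicator_def)
  have Fl: "(\<lambda>m. ?F m x) \<longlonglongrightarrow> f x" if x: "x \<in> space M" for x
  proof -
    obtain i where i: "x \<in> K i" using x K(4) by auto
    hence "?F n x = f x" if "n \<ge> i" for n using incseqD[OF K(3) that] by (auto simp: indicator_def)
    thus ?thesis by (intro tendsto_eventually eventually_at_top_linorderI[of i])
  qed
  show ?thesis
  proof (rule L2_closure_limit[OF _ f SL])
    show "?F m \<in> L2_closure M S" for m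
      by (rule bounded_on_K[of _ m], rule L2_dominated[OF f Fm Fb]) (simp add: indicator_def)
  qed (rule L2_dominated_convergence[OF Fm f Fb Fl])
qed

section \<open>Boxes and slabs as generators of the measurable sets\<close>

lemma space_cross_measure: "space (cross_measure d) = cross_space d"
  by (simp add: cross_measure_def cross_space_def space_PiM)

lemma space_Rd_measure: "space (Rd_measure d) = Rd d"
  by (simp add: Rd_measure_def Rd_def space_pair_measure space_cross_measure)

lemma sigma_finite_cross_measure: "sigma_finite_measure (cross_measure d)"
proof -
  interpret product_sigma_finite "\<lambda>_::nat. lborel :: real measure" ..
  show ?thesis unfolding cross_measure_def by (rule sigma_finite) simp
qed

interpretation cross: sigma_finite_measure "cross_measure d" for d
  by (rule sigma_finite_cross_measure)

interpretation Rd: pair_sigma_finite lborel "cross_measure d" for d ..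

definition open_box :: "nat \<Rightarrow> (nat \<Rightarrow> real) \<Rightarrow> (nat \<Rightarrow> real) \<Rightarrow> (nat \<Rightarrow> real) set" where
  "open_box d a b = (\<Pi>\<^sub>E i\<in>{2..d}. {a i<..<b i})"

definition open_boxes :: "nat \<Rightarrow> (nat \<Rightarrow> real) set set" where
  "open_boxes d = {open_box d a b | a b. True}"

lemma borel_sigma_intervals: "(borel :: real measure) = sigma UNIV (range (\<lambda>(a, b). {a<..<b}))"
  using borel_eq_box[where 'a = real] by (simp add: box_real)

lemma UN_intervals: "(\<Union>n::nat. {- real n<..<real n}) = UNIV"
proof (intro UNIV_eq_I[symmetric])
  fix x :: real
  obtain n where "\<bar>x\<bar> < real n" using reals_Archimedean2 by blast
  thus "x \<in> (\<Union>n::nat. {- real n<..<real n})" by (auto intro!: exI[of _ n])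
qed

text \<open>Open boxes are chosen as generators because their indicators are limits of
  \<open>bump_prod\<close>. The index set {2..d} is finite and serves as the single block of the
  partition in \<open>sets_PiM_sigma\<close>.\<close>

lemma sets_cross_measure: "sets (cross_measure d) = sigma_sets (cross_space d) (open_boxes d)"
proof -
  let ?E = "range (\<lambda>(a, b). {a<..<b::real})"
  have "sets (cross_measure d) = sets (\<Pi>\<^sub>M i\<in>{2..d}. sigma UNIV ?E)"
    unfolding cross_measure_def borel_sigma_intervals[symmetric] by (rule sets_PiM_cong) auto
  also have "\<dots> = sets (sigma (\<Pi>\<^sub>E i\<in>{2..d}. UNIV)
     {{f\<in>(\<Pi>\<^sub>E i\<in>{2..d}. UNIV). \<forall>i\<in>j. f i \<in> A i} | A j. j \<in> {{2..d}} \<and> A \<in> Pi j (\<lambda>_. ?E)})"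
  proof (rule sets_PiM_sigma)
    show "\<exists>S\<subseteq>?E. countable S \<and> UNIV = \<Union>S"
      by (intro exI[of _ "range (\<lambda>n::nat. {- real n<..<real n})"]) (auto simp: UN_intervals)
  qed auto
  also have "{{f\<in>(\<Pi>\<^sub>E i\<in>{2..d}. UNIV). \<forall>i\<in>j. f i \<in> A i} | A j. j \<in> {{2..d}} \<and> A \<in> Pi j (\<lambda>_. ?E)} = open_boxes d"
  proof (intro subset_antisym subsetI)
    fix B assume "B \<in> {{f\<in>(\<Pi>\<^sub>E i\<in>{2..d}. UNIV). \<forall>i\<in>j. f i \<in> A i} | A j. j \<in> {{2..d}} \<and> A \<in> Pi j (\<lambda>_. ?E)}"
    then obtain A where A: "B = {f\<in>(\<Pi>\<^sub>E i\<in>{2..d}. UNIV). \<forall>i\<in>{2..d}. f i \<in> A i}" "A \<in> Pi {2..d} (\<lambda>_. ?E)"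
      by auto
    have "\<exists>p. i \<in> {2..d} \<longrightarrow> A i = {fst p<..<snd p}" for i
    proof (cases "i \<in> {2..d}")
      case True
      hence "A i \<in> ?E" using A(2) by (rule Pi_mem[rotated])
      thus ?thesis by (auto intro!: exI)
    qed blast
    then obtain p where p: "\<And>i. i \<in> {2..d} \<Longrightarrow> A i = {fst (p i)<..<snd (p i)}" by metis
    have "B = open_box d (fst \<circ> p) (snd \<circ> p)"
    proof -
      have "B = Pi\<^sub>E {2..d} A" unfolding A(1) by (auto simp: PiE_def Pi_def)
      also have "\<dots> = open_box d (fst \<circ> p) (snd \<circ> p)"
        unfolding open_box_def using p by (intro PiE_cong) simp
      finally show ?thesis .
    qed
    thus "B \<in> open_boxes d" by (auto simp: open_boxes_def)
  next
    fix B assume "B \<in> open_boxes d"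
    then obtain a b where B: "B = open_box d a b" by (auto simp: open_boxes_def)
    show "B \<in> {{f\<in>(\<Pi>\<^sub>E i\<in>{2..d}. UNIV). \<forall>i\<in>j. f i \<in> A i} | A j. j \<in> {{2..d}} \<and> A \<in> Pi j (\<lambda>_. ?E)}"
      unfolding B open_box_def
      by (intro CollectI exI[of _ "\<lambda>i. {a i<..<b i}"] exI[of _ "{2..d}"]) (auto simp: PiE_def Pi_def)
  qed
  also have "sets (sigma (\<Pi>\<^sub>E i\<in>{2..d}. UNIV) (open_boxes d)) = sigma_sets (cross_space d) (open_boxes d)"
    unfolding cross_space_def[symmetric]
    by (rule sets_measure_of) (auto simp: open_boxes_def open_box_def cross_space_def)
  finally show ?thesis .
qed

lemma open_boxes_Pow: "open_boxes d \<subseteq> Pow (space (cross_measure d))"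
  by (auto simp: open_boxes_def open_box_def space_cross_measure cross_space_def)

lemma open_box_sets [measurable]: "open_box d a b \<in> sets (cross_measure d)"
  unfolding sets_cross_measure by (rule sigma_sets.Basic) (auto simp: open_boxes_def)

lemma open_box_Int: "open_box d a b \<inter> open_box d a' b' = open_box d (\<lambda>i. max (a i) (a' i)) (\<lambda>i. min (b i) (b' i))"
  by (auto simp: open_box_def PiE_Int)

lemma Int_stable_open_boxes: "Int_stable (open_boxes d)"
  unfolding Int_stable_def open_boxes_def using open_box_Int by blast

lemma emeasure_lborel_Ioo_eq: "emeasure lborel {a<..<b::real} = ennreal (max 0 (b - a))"
  by (cases "a \<le> b") (auto simp: max_def)

lemma emeasure_open_box: "emeasure (cross_measure d) (open_box d a b) < \<infinity>"
proof -
  interpret product_sigma_finite "\<lambda>_::nat. lborel :: real measure" ..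
  have "emeasure (cross_measure d) (open_box d a b) = (\<Prod>i\<in>{2..d}. emeasure lborel {a i<..<b i})"
    unfolding cross_measure_def open_box_def by (rule emeasure_PiM) auto
  also have "\<dots> = ennreal (\<Prod>i\<in>{2..d}. max 0 (b i - a i))"
    by (simp only: emeasure_lborel_Ioo_eq) (rule prod_ennreal, simp)
  also have "\<dots> < \<infinity>" by simp
  finally show ?thesis .
qed

definition cube :: "nat \<Rightarrow> nat \<Rightarrow> (nat \<Rightarrow> real) set" where
  "cube d m = open_box d (\<lambda>_. - real m) (\<lambda>_. real m)"

lemma cube_sets [measurable]: "cube d m \<in> sets (cross_measure d)"
  by (simp add: cube_def)

lemma emeasure_cube: "emeasure (cross_measure d) (cube d m) < \<infinity>"
  unfolding cube_def by (rule emeasure_open_box)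

lemma incseq_cube: "incseq (cube d)"
  unfolding incseq_def cube_def open_box_def by (intro allI impI PiE_mono) auto

lemma UN_cube: "(\<Union>m. cube d m) = cross_space d"
proof (intro subset_antisym subsetI)
  fix x assume x: "x \<in> cross_space d"
  obtain m where m: "(\<Sum>i\<in>{2..d}. \<bar>x i\<bar>) < real m" using reals_Archimedean2 by blast
  have "\<bar>x i\<bar> < real m" if "i \<in> {2..d}" for i
    using member_le_sum[OF that, of "\<lambda>i. \<bar>x i\<bar>"] m by simp
  hence "x \<in> cube d m"
    using x by (force simp: cube_def open_box_def cross_space_def PiE_iff abs_less_iff)
  thus "x \<in> (\<Union>m. cube d m)" by blast
qed (auto simp: cube_def open_box_def cross_space_def)

definition open_slabs :: "nat \<Rightarrow> point set set" where
  "open_slabs d = {{a<..<b} \<times> A | a b A. A \<in> sets (cross_measure d)}"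

lemma sets_Rd_measure: "sets (Rd_measure d) = sigma_sets (Rd d) (open_slabs d)"
proof -
  let ?E = "range (\<lambda>(a, b). {a<..<b::real})"
  have "sets (Rd_measure d) = sets (sigma (space lborel \<times> space (cross_measure d)) {a \<times> b | a b. a \<in> ?E \<and> b \<in> sets (cross_measure d)})"
    unfolding Rd_measure_def
  proof (rule sets_pair_eq)
    show "sets lborel = sigma_sets (space lborel) ?E"
      using arg_cong[OF borel_sigma_intervals, of sets] by simp
    show "countable (range (\<lambda>n::nat. {- real n<..<real n}))" by simp
    show "\<Union>(range (\<lambda>n::nat. {- real n<..<real n})) = space lborel"
      by (simp add: UN_intervals)
    show "countable {space (cross_measure d)}" by simp
    show "sets (cross_measure d) = sigma_sets (space (cross_measure d)) (sets (cross_measure d))"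
      by (rule sets.sigma_sets_eq[symmetric])
  qed (auto dest: sets.sets_into_space)
  also have "{a \<times> b | a b. a \<in> ?E \<and> b \<in> sets (cross_measure d)} = open_slabs d"
    by (auto simp: open_slabs_def)
  also have "space lborel \<times> space (cross_measure d) = Rd d" by (simp add: Rd_def space_cross_measure)
  also have "sets (sigma (Rd d) (open_slabs d)) = sigma_sets (Rd d) (open_slabs d)"
    by (rule sets_measure_of) (auto simp: open_slabs_def Rd_def space_cross_measure[symmetric] dest: sets.sets_into_space)
  finally show ?thesis .
qed

lemma Int_stable_open_slabs: "Int_stable (open_slabs d)"
  unfolding Int_stable_def
proof (intro ballI)
  fix B C assume "B \<in> open_slabs d" "C \<in> open_slabs d"
  then obtain a b A a' b' A' where "B = {a<..<b} \<times> A" "C = {a'<..<b'} \<times> A'"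
    "A \<in> sets (cross_measure d)" "A' \<in> sets (cross_measure d)" by (auto simp: open_slabs_def)
  moreover have "({a<..<b} \<times> A) \<inter> ({a'<..<b'} \<times> A') = {max a a'<..<min b b'} \<times> (A \<inter> A')" by auto
  ultimately show "B \<inter> C \<in> open_slabs d" unfolding open_slabs_def by blast
qed

lemma emeasure_slab: "A \<in> sets (cross_measure d) \<Longrightarrow>
    emeasure (Rd_measure d) ({a<..<b} \<times> A) = emeasure lborel {a<..<b} * emeasure (cross_measure d) A"
  unfolding Rd_measure_def by (rule cross.emeasure_pair_measure_Times) auto

text \<open>Smooth along the flow and merely measurable across it. A translation by s \<psi>(x')
  acts on each fibre separately, so it preserves this kind of regularity however rough \<psi>
  is.\<close>

definition bump_slab :: "real \<Rightarrow> real \<Rightarrow> real \<Rightarrow> (nat \<Rightarrow> real) set \<Rightarrow> point \<Rightarrow> complex" where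
  "bump_slab c a b A x = of_real (bump c a b (fst x) * indicator A (snd x))"

lemma bump_slab_measurable [measurable]:
  assumes [measurable]: "A \<in> sets (cross_measure d)"
  shows "bump_slab c a b A \<in> borel_measurable (Rd_measure d)"
  unfolding bump_slab_def[abs_def] Rd_measure_def by measurable

lemma bump_slab_le: "0 < c \<Longrightarrow> cmod (bump_slab c a b A x) \<le> 1 * cmod (indicator ({a<..<b} \<times> A) x)"
  using bump_bounds[of c a b "fst x"] bump_outside(1)[of c "fst x" a b]
  by (cases x) (auto simp: bump_slab_def indicator_def)

lemma slab_L2:
  assumes "A \<in> sets (cross_measure d)" "emeasure (cross_measure d) A < \<infinity>"
  shows "indicator ({a<..<b} \<times> A) \<in> L2 (Rd_measure d)"
proof (rule L2_bounded_finite[where C = 1])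
  show S: "{a<..<b} \<times> A \<in> sets (Rd_measure d)" using assms by (auto simp: Rd_measure_def)
  thus "(indicator ({a<..<b} \<times> A) :: _ \<Rightarrow> complex) \<in> borel_measurable (Rd_measure d)" by measurable
  show "emeasure (Rd_measure d) ({a<..<b} \<times> A) < \<infinity>"
    using assms by (simp add: emeasure_slab emeasure_lborel_Ioo_eq ennreal_mult_less_top)
qed (auto simp: indicator_def)

lemma bump_slab_L2:
  assumes "0 < c" "A \<in> sets (cross_measure d)" "emeasure (cross_measure d) A < \<infinity>"
  shows "bump_slab c a b A \<in> L2 (Rd_measure d)"
  by (rule L2_dominated[OF slab_L2[OF assms(2,3)] bump_slab_measurable[OF assms(2)] bump_slab_le[OF assms(1)]])

theorem L2_closure_bump_slabs:
  assumes S: "L2_subspace (Rd_measure d) S"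
    and bump: "\<And>c a b A. 0 < c \<Longrightarrow> A \<in> sets (cross_measure d) \<Longrightarrow> emeasure (cross_measure d) A < \<infinity> \<Longrightarrow> bump_slab c a b A \<in> S"
    and f: "f \<in> L2 (Rd_measure d)"
  shows "f \<in> L2_closure (Rd_measure d) S"
proof (rule L2_closure_of_generator[OF S Int_stable_open_slabs _ _ _ _ _ _ _ f])
  let ?K = "\<lambda>m. {- real m<..<real m} \<times> cube d m"
  show "open_slabs d \<subseteq> Pow (space (Rd_measure d))"
    by (auto simp: open_slabs_def space_Rd_measure Rd_def space_cross_measure[symmetric] dest: sets.sets_into_space)
  show "sets (Rd_measure d) = sigma_sets (space (Rd_measure d)) (open_slabs d)"
    by (simp add: sets_Rd_measure space_Rd_measure)
  show "?K m \<in> open_slabs d" for m unfolding open_slabs_def using cube_sets by blast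
  show "emeasure (Rd_measure d) (?K m) < \<infinity>" for m
    using emeasure_cube[of d m] by (simp add: emeasure_slab emeasure_lborel_Ioo_eq ennreal_mult_less_top)
  show "incseq ?K" using incseq_cube[of d] unfolding incseq_def by force
  show "(\<Union>m. ?K m) = space (Rd_measure d)"
  proof (intro subset_antisym subsetI)
    fix x assume "x \<in> space (Rd_measure d)"
    hence x: "snd x \<in> cross_space d" by (auto simp: space_Rd_measure Rd_def)
    then obtain m where m: "snd x \<in> cube d m" using UN_cube by blast
    obtain n where n: "\<bar>fst x\<bar> < real n" using reals_Archimedean2 by blast
    have "snd x \<in> cube d (max m n)" using m incseqD[OF incseq_cube, of m "max m n"] by auto
    moreover have "fst x \<in> {- real (max m n)<..<real (max m n)}" using n by (auto simp: abs_less_iff)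
    ultimately show "x \<in> (\<Union>m. ?K m)" 
      by (intro UN_I[of "max m n"] UNIV_I) (simp only: mem_Times_iff)
  qed (auto simp: space_Rd_measure Rd_def UN_cube[symmetric])
  fix B assume "B \<in> open_slabs d" and fin: "emeasure (Rd_measure d) B < \<infinity>"
  then obtain a b A where B: "B = {a<..<b} \<times> A" and A: "A \<in> sets (cross_measure d)" by (auto simp: open_slabs_def)
  \<comment> \<open>Over an empty interval, finiteness of the slab says nothing about
    \<open>A\<close>; the slab is then rewritten with an empty cross section.\<close>
  define A' where "A' = (if a < b then A else {})"
  have B': "B = {a<..<b} \<times> A'" by (auto simp: B A'_def)
  have A': "A' \<in> sets (cross_measure d)" using A by (simp add: A'_def)
  have fA': "emeasure (cross_measure d) A' < \<infinity>"
    using fin unfolding B emeasure_slab[OF A] by (auto simp: A'_def ennreal_mult_less_top)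
  show "indicator B \<in> L2_closure (Rd_measure d) S"
  proof (rule L2_closure_limit)
    show "S \<subseteq> L2 (Rd_measure d)" using S by (simp add: L2_subspace_def)
    let ?F = "\<lambda>n. bump_slab (real (Suc n)) a b A'"
    have FS: "?F n \<in> S" for n by (rule bump[OF _ A' fA']) simp
    thus "?F n \<in> L2_closure (Rd_measure d) S" for n
      using S by (auto simp: L2_closure_def L2_subspace_def intro!: bexI[of _ "?F n"])
    have m: "?F n \<in> borel_measurable (Rd_measure d)" for n using A' by measurable
    have b: "cmod (?F n x) \<le> 1 * cmod (indicator B x)" for n x
      unfolding B' by (rule bump_slab_le) simp
    have l: "(\<lambda>n. ?F n x) \<longlonglongrightarrow> indicator B x" for x
    proof -
      have "(\<lambda>n. complex_of_real (bump (real (Suc n)) a b (fst x) * indicator A' (snd x))) \<longlonglongrightarrow>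
          of_real (indicator {a<..<b} (fst x) * indicator A' (snd x))"
        by (intro tendsto_intros bump_tendsto_indicator)
      moreover have "of_real (indicator {a<..<b} (fst x) * indicator A' (snd x)) = (indicator B x :: complex)"
        by (cases x) (auto simp: B' indicator_def)
      ultimately show ?thesis by (simp only: bump_slab_def)
    qed
    show BL: "indicator B \<in> L2 (Rd_measure d)" unfolding B' by (rule slab_L2[OF A' fA'])
    show "(\<lambda>n. L2_norm (Rd_measure d) (\<lambda>x. indicator B x - ?F n x)) \<longlonglongrightarrow> 0"
      by (rule L2_dominated_convergence(2)[OF m BL b l])
  qed
qed

section \<open>The flow of a shear\<close>

lemma L2_bounded_finite_AE:
  assumes [measurable]: "f \<in> borel_measurable M" "A \<in> sets M" and fin: "emeasure M A < \<infinity>"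
    and bound: "AE x in M. cmod (f x) \<le> C * indicator A x"
  shows "f \<in> L2 M"
proof (rule L2I, fact, rule Bochner_Integration.integrable_bound)
  show "integrable M (\<lambda>x. C\<^sup>2 * indicator A x :: real)" using fin by simp
  show "AE x in M. norm ((cmod (f x))\<^sup>2) \<le> norm (C\<^sup>2 * indicator A x :: real)"
    using bound
  proof eventually_elim
    case (elim x)
    from power_mono[OF elim, of 2] show ?case by (cases "x \<in> A") auto
  qed
qed measurable

text \<open>A square-integrable function is integrable on bounded intervals, and for y in a bounded
  range all translates of \<gamma> live on a single one, which gives a dominating function. It lets
  the weak equation pass from rational to real translations.\<close>

lemma convolution_continuous:
  fixes \<gamma> :: "real \<Rightarrow> real"
  assumes v: "v \<in> L2 lborel" and cont: "continuous_on UNIV \<gamma>" and C: "\<And>x. \<bar>\<gamma> x\<bar> \<le> C"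
    and supp: "\<And>x. x \<notin> {a..b} \<Longrightarrow> \<gamma> x = 0"
  shows "continuous_on UNIV (\<lambda>y. \<integral>x. of_real (\<gamma> (x - y)) * v x \<partial>lborel)"
    and "integrable lborel (\<lambda>x. of_real (\<gamma> (x - y)) * v x)"
proof -
  have [measurable]: "v \<in> borel_measurable borel" using L2_measurable[OF v] by simp
  have [measurable]: "\<gamma> \<in> borel_measurable borel" using cont by (rule borel_measurable_continuous_onI)
  have C0: "0 \<le> C" using C[of 0] by linarith
  have w: "integrable lborel (\<lambda>x. C * cmod (v x * cnj (indicator {a - R..b + R} x)))" for R
  proof -
    have "indicator {a - R..b + R} \<in> L2 lborel"
      by (rule L2_bounded_finite[where C = 1 and A = "{a - R..b + R}"]) (auto simp: indicator_def emeasure_lborel_Icc_eq)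
    from L2_mult_integrable[OF v this] show ?thesis by simp
  qed
  have bound: "cmod (of_real (\<gamma> (x - y)) * v x) \<le> C * cmod (v x * cnj (indicator {a - R..b + R} x))" if "\<bar>y\<bar> \<le> R" for x y R
  proof (cases "x - y \<in> {a..b}")
    case True
    hence "x \<in> {a - R..b + R}" using that by auto
    thus ?thesis using C[of "x - y"] by (simp add: norm_mult mult_right_mono)
  qed (use supp C0 in \<open>simp add: norm_mult\<close>)
  show "integrable lborel (\<lambda>x. of_real (\<gamma> (x - y)) * v x)"
    by (rule Bochner_Integration.integrable_bound[OF w[of "\<bar>y\<bar>"]])
       (use bound[of y "\<bar>y\<bar>"] C0 in \<open>auto intro!: AE_I2\<close>)
  show "continuous_on UNIV (\<lambda>y. \<integral>x. of_real (\<gamma> (x - y)) * v x \<partial>lborel)"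
    unfolding continuous_on_sequentially comp_def
  proof (intro allI ballI impI, elim conjE)
    fix Y :: "nat \<Rightarrow> real" and y assume Y: "Y \<longlonglongrightarrow> y"
    have "Bseq Y" using Y by (intro convergent_imp_Bseq convergentI)
    then obtain R where R: "\<And>n. \<bar>Y n\<bar> \<le> R" unfolding Bseq_def by auto
    show "(\<lambda>n. \<integral>x. of_real (\<gamma> (x - Y n)) * v x \<partial>lborel) \<longlonglongrightarrow> (\<integral>x. of_real (\<gamma> (x - y)) * v x \<partial>lborel)"
    proof (rule integral_dominated_convergence[OF _ _ w[of R]])
      show "AE x in lborel. (\<lambda>n. complex_of_real (\<gamma> (x - Y n)) * v x) \<longlonglongrightarrow> complex_of_real (\<gamma> (x - y)) * v x"
      proof (rule AE_I2)
        fix x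
        have "isCont \<gamma> (x - y)" using cont by (simp add: continuous_on_eq_continuous_at)
        hence "(\<lambda>n. \<gamma> (x - Y n)) \<longlonglongrightarrow> \<gamma> (x - y)"
          by (rule isCont_tendsto_compose) (intro tendsto_intros Y)
        thus "(\<lambda>n. complex_of_real (\<gamma> (x - Y n)) * v x) \<longlonglongrightarrow> complex_of_real (\<gamma> (x - y)) * v x"
          by (intro tendsto_mult tendsto_of_real tendsto_const)
      qed
      show "AE x in lborel. cmod (of_real (\<gamma> (x - Y n)) * v x) \<le> C * cmod (v x * cnj (indicator {a - R..b + R} x))" for n
        using bound[OF R] by (intro AE_I2) blast
    qed measurable
  qed
qed

lemma bump_prod_outside:
  assumes "0 < e" "x' \<in> cross_space d" "x' \<notin> open_box d p q" shows "bump_prod d e p q x' = 0"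
proof -
  obtain i where "i \<in> {2..d}" "x' i \<notin> {p i<..<q i}"
    using assms(2,3) by (auto simp: open_box_def cross_space_def PiE_def Pi_def)
  thus ?thesis unfolding bump_prod_def by (intro prod_zero bexI[of _ i] bump_outside assms) auto
qed

lemma bump_prod_tendsto:
  assumes "x' \<in> cross_space d"
  shows "(\<lambda>n. bump_prod d (real (Suc n)) p q x') \<longlonglongrightarrow> indicator (open_box d p q) x'"
proof (cases "x' \<in> open_box d p q")
  case True
  have "(\<lambda>n. bump_prod d (real (Suc n)) p q x') \<longlonglongrightarrow> (\<Prod>i\<in>{2..d}. indicator {p i<..<q i} (x' i))"
    unfolding bump_prod_def by (intro tendsto_prod bump_tendsto_indicator)
  also have "(\<Prod>i\<in>{2..d}. indicator {p i<..<q i} (x' i)) = (\<Prod>i\<in>{2..d}. 1 :: real)"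
    using True by (intro prod.cong) (auto simp: open_box_def PiE_def Pi_def)
  finally show ?thesis using True by simp
next
  case False
  thus ?thesis using bump_prod_outside[OF _ assms False] by simp
qed

lemma bump_prod_measurable [measurable]: "bump_prod d e p q \<in> borel_measurable (cross_measure d)"
  unfolding bump_prod_def[abs_def] cross_measure_def by measurable

section \<open>The flow map and the weak equation on fibres\<close>

locale regular_shear =
  fixes d :: nat and \<psi> :: "(nat \<Rightarrow> real) \<Rightarrow> real" and l L :: real and H :: "point graph"
  assumes regular: "regular_shear_flow d l L \<psi> H"
begin

abbreviation X where "X \<equiv> cross_measure d"
abbreviation M where "M \<equiv> Rd_measure d"

lemma shear: "shear_flow d \<psi> H"
  using regular by (simp add: regular_shear_flow_def)

lemma psi_measurable [measurable]: "\<psi> \<in> borel_measurable X"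
  using shear by (simp add: shear_flow_def)

lemma l_pos: "0 < l"
  using regular by (simp add: regular_shear_flow_def)

lemma psi_gt: "x' \<in> cross_space d \<Longrightarrow> l < \<psi> x'"
  using regular by (simp add: regular_shear_flow_def)

lemma psi_bounded: obtains B where "0 \<le> B" "AE x in M. \<bar>\<psi> (snd x)\<bar> \<le> B"
proof -
  obtain B where B: "AE x' in X. \<bar>\<psi> x'\<bar> \<le> B" using shear by (auto simp: shear_flow_def)
  have "AE x in M. \<bar>\<psi> (snd x)\<bar> \<le> B"
    unfolding Rd_measure_def
  proof (rule Rd.AE_pair_measure)
    show "{x \<in> space (lborel \<Otimes>\<^sub>M X). \<bar>\<psi> (snd x)\<bar> \<le> B} \<in> sets (lborel \<Otimes>\<^sub>M X)" by measurable
  qed (use B in simp)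
  hence "AE x in M. \<bar>\<psi> (snd x)\<bar> \<le> max 0 B" by eventually_elim simp
  thus ?thesis by (intro that[of "max 0 B"]) auto
qed

lemma H_self_adjoint: "self_adjoint M H"
  using shear by (simp add: shear_flow_def)

definition T :: "real \<Rightarrow> point \<Rightarrow> point" where
  "T t x = (fst x + t * \<psi> (snd x), snd x)"

lemma T_Pair: "T t (x1, x') = (x1 + t * \<psi> x', x')"
  by (simp add: T_def)

lemma T_measurable [measurable]: "T t \<in> M \<rightarrow>\<^sub>M M"
  unfolding T_def[abs_def] Rd_measure_def by measurable

text \<open>On each line the flow is a translation by the constant t \<psi>(x'), so translation
  invariance of Lebesgue measure suffices after Tonelli.\<close>

lemma nn_integral_T:
  assumes f [measurable]: "f \<in> borel_measurable M"
  shows "(\<integral>\<^sup>+x. f (T t x) \<partial>M) = (\<integral>\<^sup>+x. f x \<partial>M)"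
proof -
  have f': "f \<in> borel_measurable (lborel \<Otimes>\<^sub>M X)" using f by (simp add: Rd_measure_def)
  have fT: "(\<lambda>x. f (T t x)) \<in> borel_measurable (lborel \<Otimes>\<^sub>M X)"
    using measurable_compose[OF T_measurable f] by (simp add: Rd_measure_def)
  have "(\<integral>\<^sup>+x. f (T t x) \<partial>M) = (\<integral>\<^sup>+x'. \<integral>\<^sup>+x1. f (x1 + t * \<psi> x', x') \<partial>lborel \<partial>X)"
    unfolding Rd_measure_def using Rd.nn_integral_snd[OF fT] by (simp add: T_Pair)
  also have "\<dots> = (\<integral>\<^sup>+x'. \<integral>\<^sup>+x1. f (x1, x') \<partial>lborel \<partial>X)"
  proof (rule nn_integral_cong)
    fix x' assume x': "x' \<in> space X"
    have "(\<lambda>x1. f (x1, x')) \<in> borel_measurable borel"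
      using measurable_compose[OF measurable_Pair2'[OF x', of lborel] f'] by simp
    from nn_integral_real_affine[OF this, of 1 "t * \<psi> x'"]
    show "(\<integral>\<^sup>+x1. f (x1 + t * \<psi> x', x') \<partial>lborel) = (\<integral>\<^sup>+x1. f (x1, x') \<partial>lborel)"
      by (simp add: add.commute)
  qed
  also have "\<dots> = (\<integral>\<^sup>+x. f x \<partial>M)" unfolding Rd_measure_def by (rule Rd.nn_integral_snd[OF f'])
  finally show ?thesis .
qed

lemma distr_T: "distr M M (T t) = M"
proof (rule measure_eqI)
  fix A assume "A \<in> sets (distr M M (T t))"
  hence [measurable]: "A \<in> sets M" by simp
  have "emeasure (distr M M (T t)) A = (\<integral>\<^sup>+x. indicator A x \<partial>distr M M (T t))" by simp
  also have "\<dots> = (\<integral>\<^sup>+x. indicator A (T t x) \<partial>M)" by (rule nn_integral_distr) measurable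
  also have "\<dots> = emeasure M A" by (subst nn_integral_T) auto
  finally show "emeasure (distr M M (T t)) A = emeasure M A" .
qed simp

lemma integrable_T: "f \<in> borel_measurable M \<Longrightarrow> integrable M (\<lambda>x. f (T t x)) \<longleftrightarrow> integrable M f"
  for f :: "point \<Rightarrow> 'b::{banach, second_countable_topology}"
  using integrable_distr_eq[OF T_measurable, of f t] by (simp add: distr_T)

lemma integral_T: "f \<in> borel_measurable M \<Longrightarrow> (\<integral>x. f (T t x) \<partial>M) = (\<integral>x. f x \<partial>M)"
  for f :: "point \<Rightarrow> 'b::{banach, second_countable_topology}"
  using integral_distr[OF T_measurable, of f t] by (simp add: distr_T)

definition U :: "real \<Rightarrow> (point \<Rightarrow> complex) \<Rightarrow> (point \<Rightarrow> complex)" where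
  "U t f = (\<lambda>x. f (T t x))"

lemma U_L2: assumes f: "f \<in> L2 M" shows "U t f \<in> L2 M"
proof (rule L2I)
  have [measurable]: "f \<in> borel_measurable M" using f by (rule L2_measurable)
  show "U t f \<in> borel_measurable M" unfolding U_def by measurable
  show "integrable M (\<lambda>x. (cmod (U t f x))\<^sup>2)"
    unfolding U_def using L2_integrable[OF f] by (subst integrable_T[where f = "\<lambda>x. (cmod (f x))\<^sup>2"]) auto
qed

lemma U_norm: assumes f: "f \<in> L2 M" shows "L2_norm M (U t f) = L2_norm M f"
proof -
  have [measurable]: "f \<in> borel_measurable M" using f by (rule L2_measurable)
  show ?thesis unfolding L2_norm_def U_def by (subst integral_T[where f = "\<lambda>x. (cmod (f x))\<^sup>2"]) auto
qed

lemma H_L2: "(f, k) \<in> H \<Longrightarrow> f \<in> L2 M" "(f, k) \<in> H \<Longrightarrow> k \<in> L2 M"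
  using H_self_adjoint by (auto simp: self_adjoint_def)

text \<open>
  Up to conjugation and a unimodular factor, the integrand of the weak equation \<open>-\<i> \<psi> \<partial>\<^sub>1 f = k\<close> tested
  with a bump in \<open>x\<^sub>1\<close>.
\<close>

definition weak :: "real \<Rightarrow> real \<Rightarrow> real \<Rightarrow> (point \<Rightarrow> complex) \<Rightarrow> (point \<Rightarrow> complex) \<Rightarrow> point \<Rightarrow> complex" where
  "weak c a b f k x = of_real (\<psi> (snd x) * bump' c a b (fst x)) * f x + \<i> * of_real (bump c a b (fst x)) * k x"

lemma weak_measurable [measurable]:
  assumes [measurable]: "f \<in> borel_measurable M" "k \<in> borel_measurable M"
  shows "weak c a b f k \<in> borel_measurable M"
proof -
  have [measurable]: "fst \<in> M \<rightarrow>\<^sub>M borel" "snd \<in> M \<rightarrow>\<^sub>M X" by (auto simp: Rd_measure_def)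
  show ?thesis unfolding weak_def[abs_def] by measurable
qed

text \<open>Since H coincides with its adjoint, the pair (f, k) may be tested against a product bump
  and its image, which belong to H as a test function pair. Conjugation moves f and k to the first
  slot, and the bumps are real.\<close>

lemma weak_test:
  assumes fk: "(f, k) \<in> H" and c: "0 < c" and e: "0 < e"
  shows "(\<integral>x. of_real (bump_prod d e p q (snd x)) * weak c a b f k x \<partial>M) = 0"
proof -
  define \<phi> where "\<phi> = (\<lambda>(x1, x'). complex_of_real (bump c a b x1 * bump_prod d e p q x'))"
  define \<Phi> where "\<Phi> = (\<lambda>(x1, x'). - \<i> * complex_of_real (\<psi> x') * vector_derivative (\<lambda>t. \<phi> (t, x')) (at x1))"
  have "\<phi> \<in> test_functions d" unfolding \<phi>_def by (rule bump_test_function[OF c e])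
  hence "(\<phi>, \<Phi>) \<in> shear_on_test_functions d \<psi>"
    unfolding shear_on_test_functions_def \<Phi>_def by blast
  hence \<phi>\<Phi>: "(\<phi>, \<Phi>) \<in> H" using shear by (auto simp: shear_flow_def)
  have \<Phi>: "\<Phi> x = - \<i> * of_real (\<psi> (snd x) * bump' c a b (fst x) * bump_prod d e p q (snd x))" for x
  proof -
    have "((\<lambda>t. \<phi> (t, snd x)) has_vector_derivative of_real (bump' c a b (fst x) * bump_prod d e p q (snd x))) (at (fst x))"
      unfolding \<phi>_def prod.case
      by (intro has_vector_derivative_of_real DERIV_cmult_right bump_derivative)
    thus ?thesis by (cases x) (simp add: \<Phi>_def vector_derivative_at)
  qed
  note L = H_L2[OF fk] H_L2[OF \<phi>\<Phi>]
  have "(f, k) \<in> adjoint_graph M H" using H_self_adjoint fk by (simp add: self_adjoint_def)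
  hence "L2_inner M \<Phi> f = L2_inner M \<phi> k" using \<phi>\<Phi> by (auto simp: adjoint_graph_def)
  hence "L2_inner M f \<Phi> = L2_inner M k \<phi>" by (metis L2_inner_cnj)
  moreover have "of_real (bump_prod d e p q (snd x)) * weak c a b f k x =
      - \<i> * (f x * cnj (\<Phi> x)) + \<i> * (k x * cnj (\<phi> x))" for x
    by (cases x) (simp add: weak_def \<Phi> \<phi>_def algebra_simps)
  moreover have "(\<integral>x. - \<i> * (f x * cnj (\<Phi> x)) + \<i> * (k x * cnj (\<phi> x)) \<partial>M) = - \<i> * L2_inner M f \<Phi> + \<i> * L2_inner M k \<phi>"
    unfolding L2_inner_def using L by (simp add: L2_mult_integrable)
  ultimately show ?thesis by simp
qed

lemma weak_integrable:
  assumes fk: "(f, k) \<in> H" and c: "0 < c" and A [measurable]: "A \<in> sets X" and fin: "emeasure X A < \<infinity>"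
  shows "integrable M (\<lambda>x. indicator A (snd x) *\<^sub>R weak c a b f k x)"
proof -
  have [measurable]: "fst \<in> M \<rightarrow>\<^sub>M borel" "snd \<in> M \<rightarrow>\<^sub>M X" by (auto simp: Rd_measure_def)
  note L = H_L2[OF fk]
  obtain B where B: "0 \<le> B" "AE x in M. \<bar>\<psi> (snd x)\<bar> \<le> B" by (rule psi_bounded)
  obtain B' where B': "0 \<le> B'" "\<And>x. \<bar>bump' c a b x\<bar> \<le> B'" using bump'_bounded[OF c, of a b] by blast
  have S: "{a<..<b} \<times> A \<in> sets M" by (simp add: Rd_measure_def A)
  have fS: "emeasure M ({a<..<b} \<times> A) < \<infinity>"
    using fin by (simp add: emeasure_slab emeasure_lborel_Ioo_eq ennreal_mult_less_top)
  have 1: "(\<lambda>x. of_real (indicator A (snd x) * (\<psi> (snd x) * bump' c a b (fst x)))) \<in> L2 M"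
  proof (rule L2_bounded_finite_AE[OF _ S fS])
    show "AE x in M. cmod (of_real (indicator A (snd x) * (\<psi> (snd x) * bump' c a b (fst x)))) \<le> (B * B') * indicator ({a<..<b} \<times> A) x"
      using B(2)
    proof eventually_elim
      case (elim x)
      have "\<bar>\<psi> (snd x)\<bar> * \<bar>bump' c a b (fst x)\<bar> \<le> B * B'" using elim B' B by (intro mult_mono) auto
      thus ?case using bump_outside(2)[OF c, of "fst x" a b] by (cases x) (auto simp: indicator_def norm_mult)
    qed
  qed measurable
  have 2: "bump_slab c a b A \<in> L2 M" by (rule bump_slab_L2[OF c A fin])
  have "integrable M (\<lambda>x. f x * cnj (of_real (indicator A (snd x) * (\<psi> (snd x) * bump' c a b (fst x)))) +
      \<i> * (k x * cnj (bump_slab c a b A x)))"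
    by (intro Bochner_Integration.integrable_add integrable_mult_right L2_mult_integrable L 1 2)
  thus ?thesis by (rule Bochner_Integration.integrable_cong[OF refl, THEN iffD1, rotated])
      (simp add: weak_def bump_slab_def scaleR_conv_of_real algebra_simps)
qed

text \<open>Only the sharpness of the cross factor tends to infinity; the factor in x1, which
  carries the derivative, is kept.\<close>

lemma weak_box:
  assumes fk: "(f, k) \<in> H" and c: "0 < c"
  shows "(\<integral>x. indicator (open_box d p q) (snd x) *\<^sub>R weak c a b f k x \<partial>M) = 0"
proof (rule LIMSEQ_unique)
  have [measurable]: "fst \<in> M \<rightarrow>\<^sub>M borel" "snd \<in> M \<rightarrow>\<^sub>M X" by (auto simp: Rd_measure_def)
  note [measurable] = H_L2[OF fk, THEN L2_measurable]
  let ?Q = "open_box d p q"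
  let ?F = "\<lambda>n x. of_real (bump_prod d (real (Suc n)) p q (snd x)) * weak c a b f k x"
  have int: "integrable M (\<lambda>x. indicator ?Q (snd x) *\<^sub>R weak c a b f k x)"
    by (rule weak_integrable[OF fk c open_box_sets emeasure_open_box])
  have sp: "snd x \<in> cross_space d" if "x \<in> space M" for x using that by (auto simp: space_Rd_measure Rd_def)
  show "(\<lambda>n. \<integral>x. ?F n x \<partial>M) \<longlonglongrightarrow> (\<integral>x. indicator ?Q (snd x) *\<^sub>R weak c a b f k x \<partial>M)"
  proof (rule integral_dominated_convergence[OF _ _ integrable_norm[OF int]])
    show "AE x in M. (\<lambda>n. ?F n x) \<longlonglongrightarrow> indicator ?Q (snd x) *\<^sub>R weak c a b f k x"
      unfolding scaleR_conv_of_real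
      by (intro AE_I2 tendsto_intros bump_prod_tendsto sp)
    show "AE x in M. norm (?F n x) \<le> norm (indicator ?Q (snd x) *\<^sub>R weak c a b f k x)" for n
    proof (rule AE_I2)
      fix x assume x: "x \<in> space M"
      have "\<bar>bump_prod d (real (Suc n)) p q (snd x)\<bar> \<le> indicator ?Q (snd x)"
        using bump_prod_outside[OF _ sp[OF x], of "real (Suc n)" p q] bump_prod_bounds[of d "real (Suc n)" p q "snd x"]
        by (cases "snd x \<in> ?Q") auto
      thus "norm (?F n x) \<le> norm (indicator ?Q (snd x) *\<^sub>R weak c a b f k x)"
        by (simp add: norm_mult mult_right_mono)
    qed
  qed measurable
  show "(\<lambda>n. \<integral>x. ?F n x \<partial>M) \<longlonglongrightarrow> 0"
    using weak_test[OF fk c, of "real (Suc _)"] by simp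
qed

text \<open>Vanishing over all boxes forces the fibre integral \<open>G\<close> to vanish almost
  everywhere. \<open>G\<close> itself may fail to be integrable, so it is cut off by cubes; a box
  meets a cube in a box.\<close>

lemma weak_AE:
  assumes fk: "(f, k) \<in> H" and c: "0 < c"
  shows "AE x' in X. (\<integral>x1. weak c a b f k (x1, x') \<partial>lborel) = 0"
proof -
  define G where "G x' = (\<integral>x1. weak c a b f k (x1, x') \<partial>lborel)" for x'
  have int: "integrable (lborel \<Otimes>\<^sub>M X) (case_prod (\<lambda>x1 x'. indicator A x' *\<^sub>R weak c a b f k (x1, x')))"
    if "A \<in> sets X" "emeasure X A < \<infinity>" for A
    using weak_integrable[OF fk c that] by (simp add: Rd_measure_def case_prod_beta')
  have G: "integrable X (\<lambda>x'. indicator A x' *\<^sub>R G x')" 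
      "(\<integral>x'. indicator A x' *\<^sub>R G x' \<partial>X) = (\<integral>x. indicator A (snd x) *\<^sub>R weak c a b f k x \<partial>M)"
    if "A \<in> sets X" "emeasure X A < \<infinity>" for A
    using Rd.integrable_snd[OF int[OF that]] Rd.integral_snd[OF int[OF that]]
    by (simp_all add: G_def Rd_measure_def case_prod_beta')
  have "AE x' in X. indicator (cube d m) x' *\<^sub>R G x' = 0" for m
  proof (rule cross.AE_zero_of_generator[OF _ Int_stable_open_boxes open_boxes_Pow])
    show "integrable X (\<lambda>x'. indicator (cube d m) x' *\<^sub>R G x')" by (rule G(1)[OF cube_sets emeasure_cube])
    show "sets X = sigma_sets (space X) (open_boxes d)" by (simp add: sets_cross_measure space_cross_measure)
    show "(\<integral>x'. indicator (cube d m) x' *\<^sub>R G x' \<partial>X) = 0"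
      unfolding G(2)[OF cube_sets emeasure_cube] unfolding cube_def by (rule weak_box[OF fk c])
    fix A assume "A \<in> open_boxes d"
    then obtain p q where A: "A = open_box d p q" by (auto simp: open_boxes_def)
    have "(\<lambda>x'. indicator A x' *\<^sub>R indicator (cube d m) x' *\<^sub>R G x') = (\<lambda>x'. indicator (A \<inter> cube d m) x' *\<^sub>R G x')"
      by (auto simp: indicator_def)
    thus "(\<integral>x'. indicator A x' *\<^sub>R indicator (cube d m) x' *\<^sub>R G x' \<partial>X) = 0"
      unfolding A cube_def open_box_Int using G(2)[OF open_box_sets emeasure_open_box] weak_box[OF fk c] by simp
  qed
  hence "AE x' in X. \<forall>m. indicator (cube d m) x' *\<^sub>R G x' = 0" unfolding AE_all_countable ..
  hence "AE x' in X. G x' = 0" using AE_space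
  proof eventually_elim
    case (elim x')
    then obtain m where "x' \<in> cube d m" using UN_cube[of d] by (auto simp: space_cross_measure)
    thus ?case using elim(1)[rule_format, of m] by simp
  qed
  thus ?thesis by (simp add: G_def)
qed

lemma section_L2:
  assumes f: "f \<in> L2 M" shows "AE x' in X. (\<lambda>x1. f (x1, x')) \<in> L2 lborel"
proof -
  have "integrable (lborel \<Otimes>\<^sub>M X) (case_prod (\<lambda>x1 x'. (cmod (f (x1, x')))\<^sup>2))"
    using L2_integrable[OF f] by (simp add: Rd_measure_def case_prod_beta')
  from Rd.AE_integrable_snd[OF this] show ?thesis using AE_space
  proof eventually_elim
    case (elim x')
    have "f \<in> borel_measurable (lborel \<Otimes>\<^sub>M X)" using L2_measurable[OF f] by (simp add: Rd_measure_def)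
    hence "(\<lambda>x1. f (x1, x')) \<in> borel_measurable lborel"
      by (rule measurable_compose[OF measurable_Pair2'[OF elim(2)]])
    thus ?case using elim(1) by (rule L2I)
  qed
qed

text \<open>
  The null set does not depend on \<open>y\<close>, so that \<open>y = s \<psi>(x')\<close> is allowed: with \<open>\<psi>\<close> merely Lipschitz, a bump
  moved along the flow need not be a test function itself.
\<close>

lemma weak_translates:
  assumes fk: "(f, k) \<in> H" and c: "0 < c"
  shows "AE x' in X. \<forall>y. (\<integral>x1. weak c (a + y) (b + y) f k (x1, x') \<partial>lborel) = 0"
proof -
  \<comment> \<open>Rational y cost only countably many null sets. On almost every fibre f and k are
    square-integrable, so the integral is continuous in y as a sum of two convolutions, and
    vanishing extends to all real y.\<close>
  have "AE x' in X. \<forall>y\<in>\<rat>. (\<integral>x1. weak c (a + y) (b + y) f k (x1, x') \<partial>lborel) = 0"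
    using countable_rat by (subst AE_ball_countable) (auto intro: weak_AE[OF fk c])
  with section_L2[OF H_L2(1)[OF fk]] section_L2[OF H_L2(2)[OF fk]] show ?thesis
  proof eventually_elim
    case (elim x')
    obtain B' where B': "0 \<le> B'" "\<And>x. \<bar>bump' c a b x\<bar> \<le> B'" using bump'_bounded[OF c, of a b] by blast
    have b1: "\<bar>bump c a b x\<bar> \<le> 1" for x using bump_bounds[of c a b x] by simp
    have o: "x \<notin> {a..b} \<Longrightarrow> bump c a b x = 0" "x \<notin> {a..b} \<Longrightarrow> bump' c a b x = 0" for x
      by (auto intro!: bump_outside c)
    have cf: "continuous_on UNIV (\<lambda>y. \<integral>x. of_real (bump' c a b (x - y)) * f (x, x') \<partial>lborel)"
      "integrable lborel (\<lambda>x. of_real (bump' c a b (x - y)) * f (x, x'))" for y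
      by (rule convolution_continuous[OF elim(1) bump_continuous(2) B'(2)], erule o(2))+
    have ck: "continuous_on UNIV (\<lambda>y. \<integral>x. of_real (bump c a b (x - y)) * k (x, x') \<partial>lborel)"
      "integrable lborel (\<lambda>x. of_real (bump c a b (x - y)) * k (x, x'))" for y
      by (rule convolution_continuous[OF elim(2) bump_continuous(1) b1], erule o(1))+
    define g where "g y = of_real (\<psi> x') * (\<integral>x. of_real (bump' c a b (x - y)) * f (x, x') \<partial>lborel) +
       \<i> * (\<integral>x. of_real (bump c a b (x - y)) * k (x, x') \<partial>lborel)" for y
    have g: "(\<integral>x1. weak c (a + y) (b + y) f k (x1, x') \<partial>lborel) = g y" for y
      unfolding g_def integral_mult_right_zero[symmetric]
      by (subst Bochner_Integration.integral_add[symmetric])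
         (auto intro!: Bochner_Integration.integral_cong integrable_mult_right
           cf(2)[of y, unfolded bump_translate] ck(2)[of y, unfolded bump_translate]
           simp: weak_def bump_translate mult.assoc)
    have "continuous_on UNIV g" unfolding g_def by (intro continuous_intros cf(1) ck(1))
    hence "g y = 0" for y
      using continuous_constant_on_closure[of \<rat> g 0 y] elim(3) g by (simp add: Rats_closure_real)
    thus ?case using g by simp
  qed
qed

end

section \<open>Evolution of matrix elements along the flow\<close>

lemma bump_Lipschitz:
  assumes "\<And>x. \<bar>bump' c a b x\<bar> \<le> B" shows "\<bar>bump c a b x - bump c a b y\<bar> \<le> B * \<bar>x - y\<bar>"
  using field_differentiable_bound[of UNIV "bump c a b" "bump' c a b" B x y] assms bump_derivative
  by (simp add: has_field_derivative_at_within)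

context regular_shear
begin

text \<open>Invariance of the measure moves the flow from f to the bump, which can be differentiated
  in s although f cannot. The derivative produces \<psi> times \<open>bump'\<close>, and the weak
  equation, translated by y = s \<psi>(x') on almost every fibre, exchanges this for k.\<close>

lemma bump_slab_evolution:
  assumes fk: "(f, k) \<in> H" and c: "0 < c" and A [measurable]: "A \<in> sets X" and fin: "emeasure X A < \<infinity>"
  shows "((\<lambda>s. L2_inner M (U s f) (bump_slab c a b A)) has_vector_derivative
    \<i> * L2_inner M (U s k) (bump_slab c a b A)) (at s)"
proof -
  have [measurable]: "fst \<in> M \<rightarrow>\<^sub>M borel" "snd \<in> M \<rightarrow>\<^sub>M X" by (auto simp: Rd_measure_def)
  note L = H_L2[OF fk]
  note [measurable] = L[THEN L2_measurable]
  define q where "q s x = complex_of_real (bump c a b (fst x - s * \<psi> (snd x)) * indicator A (snd x))" for s x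
  define q' where "q' s x = complex_of_real (\<psi> (snd x) * bump' c a b (fst x - s * \<psi> (snd x)) * indicator A (snd x))" for s x
  have q_meas [measurable]: "q s \<in> borel_measurable M" "q' s \<in> borel_measurable M" for s
    unfolding q_def[abs_def] q'_def[abs_def] by measurable
  have inner: "L2_inner M (U s v) (bump_slab c a b A) = (\<integral>x. v x * q s x \<partial>M)" if "v \<in> L2 M" for v s
  proof -
    have [measurable]: "v \<in> borel_measurable M" using that by (rule L2_measurable)
    have "L2_inner M (U s v) (bump_slab c a b A) = (\<integral>x. v (T s x) * q s (T s x) \<partial>M)"
      by (simp add: L2_inner_def U_def bump_slab_def q_def T_def)
    also have "\<dots> = (\<integral>x. v x * q s x \<partial>M)" by (rule integral_T) measurable
    finally show ?thesis .
  qed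
  have int: "integrable M (\<lambda>x. v x * q s x)" if v: "v \<in> L2 M" for v s
  proof -
    have [measurable]: "v \<in> borel_measurable M" using v by (rule L2_measurable)
    have "integrable M (\<lambda>x. U s v x * cnj (bump_slab c a b A x))"
      by (intro L2_mult_integrable U_L2 v bump_slab_L2 c A fin)
    also have "(\<lambda>x. U s v x * cnj (bump_slab c a b A x)) = (\<lambda>x. v (T s x) * q s (T s x))"
      by (simp add: U_def bump_slab_def q_def T_def)
    finally show ?thesis by (subst (asm) integrable_T) measurable
  qed
  obtain B where B: "0 \<le> B" "AE x in M. \<bar>\<psi> (snd x)\<bar> \<le> B" by (rule psi_bounded)
  obtain B' where B': "0 \<le> B'" "\<And>x. \<bar>bump' c a b x\<bar> \<le> B'" using bump'_bounded[OF c, of a b] by blast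
  \<comment> \<open>For times within 1 of s the shift is at most R almost everywhere, so one fixed
    interval contains the supports of all the moved bumps and yields a dominating function.\<close>
  define R where "R = (\<bar>s\<bar> + 1) * B"
  have R: "0 \<le> R" using B by (simp add: R_def)
  let ?I = "{a - R - 1<..<b + R + 1} \<times> A"
  have bound: "AE x in M. cmod (f x * q r x - f x * q s x) \<le> B' * B * cmod (f x * cnj (indicator ?I x)) * \<bar>r - s\<bar>"
    if r: "\<bar>r - s\<bar> < 1" for r
    using B(2)
  proof eventually_elim
    case (elim x)
    have shift: "\<bar>t * \<psi> (snd x)\<bar> \<le> R" if "\<bar>t\<bar> \<le> \<bar>s\<bar> + 1" for t
      unfolding abs_mult R_def using that elim by (intro mult_mono) auto
    have shift: "\<bar>r * \<psi> (snd x)\<bar> \<le> R" "\<bar>s * \<psi> (snd x)\<bar> \<le> R" using r by (auto intro!: shift)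
    show ?case
    proof (cases "x \<in> ?I")
      case True
      hence A: "snd x \<in> A" by auto
      have "\<bar>bump c a b (fst x - r * \<psi> (snd x)) - bump c a b (fst x - s * \<psi> (snd x))\<bar> \<le>
        B' * \<bar>(fst x - r * \<psi> (snd x)) - (fst x - s * \<psi> (snd x))\<bar>"
        by (rule bump_Lipschitz[OF B'(2)])
      also have "(fst x - r * \<psi> (snd x)) - (fst x - s * \<psi> (snd x)) = (s - r) * \<psi> (snd x)"
        by (simp add: algebra_simps)
      also have "B' * \<bar>(s - r) * \<psi> (snd x)\<bar> \<le> B' * (\<bar>r - s\<bar> * B)"
        unfolding abs_mult using elim B'(1) by (intro mult_left_mono mult_mono) auto
      finally have "cmod (q r x - q s x) \<le> B' * (\<bar>r - s\<bar> * B)"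
        using A by (simp add: q_def flip: of_real_diff)
      hence "cmod (f x) * cmod (q r x - q s x) \<le> cmod (f x) * (B' * (\<bar>r - s\<bar> * B))" by (rule mult_left_mono) simp
      thus ?thesis using True by (simp add: right_diff_distrib[symmetric] norm_mult mult_ac)
    next
      case False
      have "q t x = 0" if "\<bar>t * \<psi> (snd x)\<bar> \<le> R" for t
      proof (cases "snd x \<in> A")
        case True
        hence "fst x \<notin> {a - R - 1<..<b + R + 1}" using False by (cases x) auto
        hence "fst x - t * \<psi> (snd x) \<notin> {a<..<b}" using that by auto
        thus ?thesis using bump_outside(1)[OF c] by (simp add: q_def)
      qed (simp add: q_def)
      thus ?thesis using shift False by simp
    qed
  qed
  have "((\<lambda>s. \<integral>x. f x * q s x \<partial>M) has_vector_derivative (\<integral>x. f x * (- q' s x) \<partial>M)) (at s)"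
  proof (rule has_vector_derivative_integral[OF zero_less_one int[OF L(1)] _ bound])
    show "AE x in M. ((\<lambda>s. f x * q s x) has_vector_derivative f x * - q' s x) (at s)"
    proof (rule AE_I2)
      fix x
      have "((\<lambda>s. bump c a b (fst x - s * \<psi> (snd x))) has_real_derivative
          bump' c a b (fst x - s * \<psi> (snd x)) * - \<psi> (snd x)) (at s)"
        by (rule DERIV_chain2[OF bump_derivative]) (auto intro!: derivative_eq_intros)
      hence "((\<lambda>s. q s x) has_vector_derivative of_real (bump' c a b (fst x - s * \<psi> (snd x)) * - \<psi> (snd x) * indicator A (snd x))) (at s)"
        unfolding q_def by (intro has_vector_derivative_of_real DERIV_cmult_right)
      hence "((\<lambda>s. q s x) has_vector_derivative - q' s x) (at s)" by (simp add: q'_def mult_ac)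
      thus "((\<lambda>s. f x * q s x) has_vector_derivative f x * - q' s x) (at s)"
        by (rule has_vector_derivative_mult_right)
    qed
    show "integrable M (\<lambda>x. B' * B * cmod (f x * cnj (indicator ?I x)))"
      by (intro integrable_mult_right integrable_norm L2_mult_integrable L slab_L2 A fin)
  qed measurable
  moreover have "(\<integral>x. f x * (- q' s x) \<partial>M) = \<i> * (\<integral>x. k x * q s x \<partial>M)"
  proof -
    let ?w = "\<lambda>x1 x'. indicator A x' *\<^sub>R weak c (a + s * \<psi> x') (b + s * \<psi> x') f k (x1, x')"
    have w: "?w (fst x) (snd x) = f x * q' s x + \<i> * (k x * q s x)" for x
      by (simp add: weak_def q_def q'_def bump_translate scaleR_conv_of_real algebra_simps)
    have i1: "integrable M (\<lambda>x. f x * q' s x)"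
    proof (rule Bochner_Integration.integrable_bound)
      show "integrable M (\<lambda>x. B' * B * cmod (f x * cnj (indicator ?I x)))"
        by (intro integrable_mult_right integrable_norm L2_mult_integrable L slab_L2 A fin)
      show "AE x in M. norm (f x * q' s x) \<le> norm (B' * B * cmod (f x * cnj (indicator ?I x)))"
        using B(2)
      proof eventually_elim
        case (elim x)
        have "\<bar>s * \<psi> (snd x)\<bar> \<le> R" unfolding abs_mult R_def using elim by (intro mult_mono) auto
        hence "fst x - s * \<psi> (snd x) \<notin> {a<..<b}" if "fst x \<notin> {a - R - 1<..<b + R + 1}" using that by auto
        hence o: "q' s x = 0" if "x \<notin> ?I" using bump_outside(2)[OF c] that by (cases x) (auto simp: q'_def)
        have "cmod (q' s x) \<le> B * B'"
          unfolding q'_def norm_of_real abs_mult using elim B B'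
            mult_mono[OF elim B'(2)[of "fst x - s * \<psi> (snd x)"]] by (cases "snd x \<in> A") auto
        hence "cmod (f x) * cmod (q' s x) \<le> cmod (f x) * (B * B')" by (rule mult_left_mono) simp
        thus ?case using o B B' by (cases "x \<in> ?I") (simp_all add: norm_mult mult_ac)
      qed
    qed measurable
    have i: "integrable M (\<lambda>x. f x * q' s x + \<i> * (k x * q s x))"
      by (intro Bochner_Integration.integrable_add integrable_mult_right i1 int L)
    hence iw: "integrable (lborel \<Otimes>\<^sub>M X) (case_prod ?w)"
      unfolding w[symmetric] by (simp add: Rd_measure_def case_prod_beta')
    have "(\<integral>x. f x * q' s x + \<i> * (k x * q s x) \<partial>M) = (\<integral>x'. (\<integral>x1. ?w x1 x' \<partial>lborel) \<partial>X)"
      unfolding Rd.integral_snd[OF iw] unfolding w[symmetric] by (simp add: Rd_measure_def case_prod_beta')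
    also have "\<dots> = (\<integral>x'. 0 \<partial>X)"
    proof (rule integral_cong_AE)
      show "AE x' in X. (\<integral>x1. ?w x1 x' \<partial>lborel) = 0"
        using weak_translates[OF fk c, of a b] by eventually_elim simp
      show "(\<lambda>x'. \<integral>x1. ?w x1 x' \<partial>lborel) \<in> borel_measurable X"
        using Rd.integrable_snd[OF iw] by (rule borel_measurable_integrable)
    qed simp
    finally have "(\<integral>x. f x * q' s x \<partial>M) + \<i> * (\<integral>x. k x * q s x \<partial>M) = 0"
      using i1 int[OF L(2), of s] by simp
    thus ?thesis by (simp add: neg_eq_iff_add_eq_0)
  qed
  ultimately show ?thesis by (simp add: inner L)
qed

text \<open>The vectors against which d/ds U(s) f = \<i> U(s) H f holds weakly. They form a subspace
  that contains the bump slabs and is therefore dense. What is later extended by density is the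
  estimate of \<open>U_H\<close>, not the derivative.\<close>

definition evolution_tests :: "(point \<Rightarrow> complex) set" where
  "evolution_tests = {h \<in> L2 M. \<forall>(f, k) \<in> H. \<forall>s.
     ((\<lambda>s. L2_inner M (U s f) h) has_vector_derivative \<i> * L2_inner M (U s k) h) (at s)}"

lemma L2_subspace_evolution_tests: "L2_subspace M evolution_tests"
  unfolding L2_subspace_def
proof (intro conjI ballI allI)
  show "evolution_tests \<subseteq> L2 M" by (auto simp: evolution_tests_def)
  fix g h c assume g: "g \<in> evolution_tests" and h: "h \<in> evolution_tests"
  have L: "g \<in> L2 M" "h \<in> L2 M" using g h by (auto simp: evolution_tests_def)
  have "((\<lambda>s. L2_inner M (U s f) (\<lambda>x. g x + c * h x)) has_vector_derivative
      \<i> * L2_inner M (U s k) (\<lambda>x. g x + c * h x)) (at s)" if fk: "(f, k) \<in> H" for f k s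
  proof -
    have lin: "L2_inner M (U s v) (\<lambda>x. g x + c * h x) = L2_inner M (U s v) g + cnj c * L2_inner M (U s v) h"
      if "v \<in> L2 M" for v s
      using that L by (simp add: L2_inner_linear U_L2 L2_scale)
    have "((\<lambda>s. L2_inner M (U s f) g + cnj c * L2_inner M (U s f) h) has_vector_derivative
      \<i> * L2_inner M (U s k) g + cnj c * (\<i> * L2_inner M (U s k) h)) (at s)"
      using g h fk by (intro has_vector_derivative_add has_vector_derivative_mult_right) (auto simp: evolution_tests_def)
    thus ?thesis by (simp add: lin H_L2[OF fk] algebra_simps)
  qed
  thus "(\<lambda>x. g x + c * h x) \<in> evolution_tests" using L by (auto simp: evolution_tests_def)
qed

lemma evolution_tests_dense: "f \<in> L2 M \<Longrightarrow> f \<in> L2_closure M evolution_tests"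
  by (rule L2_closure_bump_slabs[OF L2_subspace_evolution_tests])
     (auto simp: evolution_tests_def bump_slab_evolution bump_slab_L2)

text \<open>The mean value inequality for exp(-\<i> c s) (U(s) f, h): differentiating the phase
  replaces H f by (H - c) f, and U(s) is isometric, so the derivative is bounded by \<parallel>(H -
  c) f\<parallel> \<parallel>h\<parallel> uniformly in s.\<close>

lemma U_H:
  assumes fk: "(f, k) \<in> H" and h: "h \<in> L2 M"
  shows "cmod (exp (- \<i> * of_real (c * t)) * L2_inner M (U t f) h - L2_inner M f h)
    \<le> \<bar>t\<bar> * L2_norm M (\<lambda>x. k x - of_real c * f x) * L2_norm M h"
proof -
  note L = H_L2[OF fk]
  let ?v = "\<lambda>x. exp (- \<i> * of_real (c * t)) * U t f x - f x"
  let ?K = "\<lambda>x. k x - of_real c * f x"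
  have vL: "?v \<in> L2 M" by (intro L2_diff L2_scale U_L2 L)
  have v: "L2_inner M ?v h = exp (- \<i> * of_real (c * t)) * L2_inner M (U t f) h - L2_inner M f h" if "h \<in> L2 M" for h
    using L that by (simp add: L2_inner_linear L2_scale U_L2)
  have "cmod (L2_inner M ?v h) \<le> \<bar>t\<bar> * L2_norm M ?K * L2_norm M h"
  proof (rule L2_bound_by_dense[OF vL _ _ _ _ h])
    show "evolution_tests \<subseteq> L2 M" using L2_subspace_evolution_tests by (simp add: L2_subspace_def)
    show "\<exists>h\<in>evolution_tests. L2_norm M (\<lambda>x. f x - h x) < e" if "f \<in> L2 M" "0 < e" for f e
      using L2_closureD[OF evolution_tests_dense] that by blast
    fix h assume h: "h \<in> evolution_tests"
    have hL: "h \<in> L2 M" using h by (simp add: evolution_tests_def)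
    define q where "q s = exp (- \<i> * of_real (c * s)) * L2_inner M (U s f) h" for s :: real
    define q' where "q' s = exp (- \<i> * of_real (c * s)) * (\<i> * L2_inner M (U s ?K) h)" for s :: real
    have der: "(q has_vector_derivative q' s) (at s)" for s
    proof -
      have "((\<lambda>s. L2_inner M (U s f) h) has_vector_derivative \<i> * L2_inner M (U s k) h) (at s)"
        using h fk by (auto simp: evolution_tests_def)
      moreover have "((\<lambda>s. exp (- \<i> * of_real (c * s))) has_vector_derivative
          - \<i> * of_real c * exp (- \<i> * of_real (c * s))) (at s)"
      proof -
        have "((\<lambda>z. exp (- \<i> * of_real c * z)) has_field_derivative - \<i> * of_real c * exp (- \<i> * of_real c * of_real s)) (at (of_real s))"
          by (auto intro!: derivative_eq_intros)
        from has_vector_derivative_real_field[OF this] show ?thesis by (simp add: mult.assoc)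
      qed
      ultimately have "(q has_vector_derivative exp (- \<i> * of_real (c * s)) * (\<i> * L2_inner M (U s k) h) +
          - \<i> * of_real c * exp (- \<i> * of_real (c * s)) * L2_inner M (U s f) h) (at s)"
        unfolding q_def[abs_def] by (intro has_vector_derivative_mult)
      moreover have K: "L2_inner M (U s ?K) h = L2_inner M (U s k) h - of_real c * L2_inner M (U s f) h"
      proof -
        have "U s ?K = (\<lambda>x. U s k x - of_real c * U s f x)" by (simp add: U_def)
        thus ?thesis using L hL by (simp add: L2_inner_linear L2_scale U_L2)
      qed
      moreover have "q' s = exp (- \<i> * of_real (c * s)) * (\<i> * L2_inner M (U s k) h) +
          - \<i> * of_real c * exp (- \<i> * of_real (c * s)) * L2_inner M (U s f) h"
        unfolding q'_def K by (simp add: algebra_simps)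
      ultimately show ?thesis by simp
    qed
    have KL: "?K \<in> L2 M" by (intro L2_diff L2_scale L)
    have bound: "norm (q' s) \<le> L2_norm M ?K * L2_norm M h" for s
      using L2_Cauchy_Schwarz[OF U_L2[OF KL] hL, of s] U_norm[OF KL, of s] by (simp add: q'_def norm_mult)
    have "norm (q t - q 0) \<le> (L2_norm M ?K * L2_norm M h) * norm (t - 0)"
    proof (rule differentiable_bound[OF convex_UNIV])
      show "(q has_derivative (\<lambda>y. y *\<^sub>R q' s)) (at s within UNIV)" for s
        using der[of s] by (simp add: has_vector_derivative_def)
      show "onorm (\<lambda>y. y *\<^sub>R q' s) \<le> L2_norm M ?K * L2_norm M h" for s
        using bound[of s] by (simp add: onorm_scaleR_left[OF bounded_linear_ident] onorm_id)
    qed auto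
    moreover have "q t - q 0 = L2_inner M ?v h" unfolding v[OF hL] by (simp add: q_def U_def T_def)
    ultimately show "cmod (L2_inner M ?v h) \<le> \<bar>t\<bar> * L2_norm M ?K * L2_norm M h" by (simp add: mult_ac)
  qed simp
  thus ?thesis unfolding v[OF h] .
qed

lemma spectral_group:
  assumes "spectral_family M H E" shows "spectral_group M H E U"
proof
  show "self_adjoint M H" by (rule H_self_adjoint)
  show "spectral_family M H E" by fact
  fix f k h c t assume "(f, k) \<in> H" "h \<in> L2 M"
  thus "cmod (exp (- \<i> * of_real (c * t)) * L2_inner M (U t f) h - L2_inner M f h)
      \<le> \<bar>t\<bar> * L2_norm M (\<lambda>x. k x - of_real c * f x) * L2_norm M h"
    by (rule U_H)
qed (simp_all add: U_L2 U_norm, simp_all add: U_def)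

end

section \<open>The weighted estimate\<close>

definition weight_integral :: "real \<Rightarrow> ennreal" where
  "weight_integral \<sigma> = (\<integral>\<^sup>+x. ennreal ((1 + x\<^sup>2) powr (- \<sigma>)) \<partial>lborel)"

text \<open>The integrand is compared with 1 on [-1, 1] and with |x| to the power -2 \<sigma>
  outside, an exponent below -1. \<open>p\<close> is the right tail and its reflection the left
  one.\<close>

lemma weight_integral_finite:
  assumes \<sigma>: "1 / 2 < \<sigma>" shows "weight_integral \<sigma> < \<infinity>"
proof -
  define p where "p x = ennreal (x powr (- 2 * \<sigma>)) * indicator {1..} x" for x :: real
  have p_meas [measurable]: "p \<in> borel_measurable borel" unfolding p_def[abs_def] by measurable
  have "(\<integral>\<^sup>+x. p x \<partial>lborel) = ennreal (0 - 1 powr (1 - 2 * \<sigma>) / (1 - 2 * \<sigma>))"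
    unfolding p_def
  proof (rule nn_integral_FTC_atLeast[where F = "\<lambda>x. x powr (1 - 2 * \<sigma>) / (1 - 2 * \<sigma>)" and f = "\<lambda>x. x powr (- 2 * \<sigma>)"])
    show "((\<lambda>x. x powr (1 - 2 * \<sigma>) / (1 - 2 * \<sigma>)) has_real_derivative x powr (- 2 * \<sigma>)) (at x)" if "1 \<le> x" for x
      using \<sigma> that by (auto intro!: derivative_eq_intros)
    have "((\<lambda>x::real. x powr (1 - 2 * \<sigma>) / (1 - 2 * \<sigma>)) \<longlongrightarrow> 0 / (1 - 2 * \<sigma>)) at_top"
      using \<sigma> by (intro tendsto_divide tendsto_const tendsto_neg_powr) (auto intro: filterlim_ident)
    thus "((\<lambda>x::real. x powr (1 - 2 * \<sigma>) / (1 - 2 * \<sigma>)) \<longlongrightarrow> 0) at_top" by simp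
  qed auto
  hence p: "(\<integral>\<^sup>+x. p x \<partial>lborel) < \<infinity>" by simp
  have p': "(\<integral>\<^sup>+x. p (- x) \<partial>lborel) = (\<integral>\<^sup>+x. p x \<partial>lborel)"
    using nn_integral_real_affine[OF p_meas, of "-1" 0] by simp
  have "weight_integral \<sigma> \<le> (\<integral>\<^sup>+x. indicator {-1..1} x + (p x + p (- x)) \<partial>lborel)"
    unfolding weight_integral_def
  proof (rule nn_integral_mono)
    fix x :: real
    have far: "(1 + x\<^sup>2) powr (- \<sigma>) \<le> y powr (- 2 * \<sigma>)" if "1 \<le> y" "y\<^sup>2 = x\<^sup>2" for y
    proof -
      have "(1 + x\<^sup>2) powr (- \<sigma>) \<le> (y\<^sup>2) powr (- \<sigma>)"
        using \<sigma> that by (intro powr_mono2') auto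
      also have "y\<^sup>2 = y powr 2" using that(1) by simp
      also have "(y powr 2) powr (- \<sigma>) = y powr (- 2 * \<sigma>)" unfolding powr_powr by simp
      finally show ?thesis .
    qed
    consider "x \<in> {-1..1}" | "1 \<le> x" | "1 \<le> - x" by fastforce
    thus "ennreal ((1 + x\<^sup>2) powr (- \<sigma>)) \<le> indicator {-1..1} x + (p x + p (- x))"
    proof cases
      case 1
      have "1 \<le> (1 + x\<^sup>2) powr \<sigma>" using \<sigma> by (intro ge_one_powr_ge_zero) auto
      hence "(1 + x\<^sup>2) powr (- \<sigma>) \<le> 1" by (simp add: powr_minus_divide divide_le_eq_1)
      thus ?thesis using 1 by (simp add: add_increasing2)
    next
      case 2
      hence "ennreal ((1 + x\<^sup>2) powr (- \<sigma>)) \<le> p x" using far[of x] by (simp add: p_def ennreal_leI)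
      thus ?thesis by (simp add: add_increasing add_increasing2)
    next
      case 3
      hence "ennreal ((1 + x\<^sup>2) powr (- \<sigma>)) \<le> p (- x)" using far[of "- x"] by (simp add: p_def ennreal_leI)
      thus ?thesis by (simp add: add_increasing)
    qed
  qed
  also have "\<dots> = emeasure lborel {-1..1::real} + ((\<integral>\<^sup>+x. p x \<partial>lborel) + (\<integral>\<^sup>+x. p (- x) \<partial>lborel))"
    by (simp add: nn_integral_add)
  also have "\<dots> < \<infinity>" using p by (simp add: p')
  finally show ?thesis .
qed

text \<open>Takes the root in \<open>Cauchy_Schwarz_nn_integral\<close>, which is stated for
  squares.\<close>

lemma ennreal_le_of_square:
  assumes "x\<^sup>2 \<le> (ennreal r)\<^sup>2" "0 \<le> r" shows "x \<le> ennreal r"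
proof (cases x)
  case (real y)
  thus ?thesis using assms by (simp add: ennreal_power power_mono_iff)
next
  case top
  thus ?thesis using assms by (simp add: ennreal_power top_unique)
qed

section \<open>Weighted spaces and the decay of correlations\<close>

context regular_shear
begin

text \<open>For d \<ge> 2 the cross space contains two points at distance 1, here the origin and a
  unit vector, and the Lipschitz condition at them forces the sign. For d = 1 it is a single point
  and the condition says nothing about \<open>L\<close>.\<close>

lemma L_nonneg: assumes "2 \<le> d" shows "0 \<le> L"
proof -
  define u v where "u = (\<lambda>i. if i \<in> {2..d} then 0 else undefined :: real)"
    and "v = (\<lambda>i. if i \<in> {2..d} then (if i = 2 then 1 else 0) else undefined :: real)"
  have uv: "u \<in> cross_space d" "v \<in> cross_space d"
    by (auto simp: u_def v_def cross_space_def PiE_def extensional_def)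
  have "(\<Sum>i\<in>{2..d}. (u i - v i)\<^sup>2) = (\<Sum>i\<in>{2..d}. if i = 2 then 1 else 0)"
    by (intro sum.cong) (auto simp: u_def v_def)
  also have "\<dots> = 1" using assms by simp
  finally have "cross_dist d u v = 1" by (simp add: cross_dist_def L2_set_def)
  moreover have "\<bar>\<psi> u - \<psi> v\<bar> \<le> L * cross_dist d u v"
    using regular uv by (simp add: regular_shear_flow_def)
  ultimately show ?thesis by simp
qed

lemma weighted_measurable: "f \<in> weighted_space d \<sigma> \<Longrightarrow> f \<in> borel_measurable M"
  and weighted_integrable: "f \<in> weighted_space d \<sigma> \<Longrightarrow> integrable M (\<lambda>x. (1 + (fst x)\<^sup>2) powr \<sigma> * (cmod (f x))\<^sup>2)"
  by (simp_all add: weighted_space_def)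

lemma weighted_L2:
  assumes "0 \<le> \<sigma>" and f: "f \<in> weighted_space d \<sigma>" shows "f \<in> L2 M"
proof (rule L2I[OF weighted_measurable[OF f]], rule Bochner_Integration.integrable_bound[OF weighted_integrable[OF f]])
  note [measurable] = weighted_measurable[OF f]
  show "(\<lambda>x. (cmod (f x))\<^sup>2) \<in> borel_measurable M" by measurable
  show "AE x in M. norm ((cmod (f x))\<^sup>2) \<le> norm ((1 + (fst x)\<^sup>2) powr \<sigma> * (cmod (f x))\<^sup>2)"
  proof (rule AE_I2)
    fix x :: point
    have "1 \<le> (1 + (fst x)\<^sup>2) powr \<sigma>" using assms by (intro ge_one_powr_ge_zero) auto
    hence "1 * (cmod (f x))\<^sup>2 \<le> (1 + (fst x)\<^sup>2) powr \<sigma> * (cmod (f x))\<^sup>2" by (rule mult_right_mono) simp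
    thus "norm ((cmod (f x))\<^sup>2) \<le> norm ((1 + (fst x)\<^sup>2) powr \<sigma> * (cmod (f x))\<^sup>2)" by simp
  qed
qed

lemma weighted_linear:
  assumes f: "f \<in> weighted_space d \<sigma>" and g: "g \<in> weighted_space d \<sigma>"
  shows "(\<lambda>x. f x + c * g x) \<in> weighted_space d \<sigma>"
proof -
  have [measurable]: "fst \<in> M \<rightarrow>\<^sub>M borel" by (simp add: Rd_measure_def)
  note [measurable] = weighted_measurable[OF f] weighted_measurable[OF g]
  let ?w = "\<lambda>x :: point. (1 + (fst x)\<^sup>2) powr \<sigma>"
  have "integrable M (\<lambda>x. ?w x * (cmod (f x + c * g x))\<^sup>2)"
  proof (rule Bochner_Integration.integrable_bound)
    show "integrable M (\<lambda>x. 2 * (?w x * (cmod (f x))\<^sup>2) + 2 * (cmod c)\<^sup>2 * (?w x * (cmod (g x))\<^sup>2))"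
      by (intro Bochner_Integration.integrable_add integrable_mult_right weighted_integrable f g)
    show "AE x in M. norm (?w x * (cmod (f x + c * g x))\<^sup>2)
        \<le> norm (2 * (?w x * (cmod (f x))\<^sup>2) + 2 * (cmod c)\<^sup>2 * (?w x * (cmod (g x))\<^sup>2))"
    proof (rule AE_I2)
      fix x :: point
      have "(cmod (f x + c * g x))\<^sup>2 \<le> (cmod (f x) + cmod (c * g x))\<^sup>2"
        by (intro power_mono norm_triangle_ineq) auto
      also have "\<dots> \<le> 2 * (cmod (f x))\<^sup>2 + 2 * (cmod (c * g x))\<^sup>2"
        using zero_le_power2[of "cmod (f x) - cmod (c * g x)"] by (simp add: power2_sum power2_diff)
      finally have "?w x * (cmod (f x + c * g x))\<^sup>2 \<le> ?w x * (2 * (cmod (f x))\<^sup>2 + 2 * (cmod (c * g x))\<^sup>2)"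
        by (rule mult_left_mono) simp
      also have "\<dots> = 2 * (?w x * (cmod (f x))\<^sup>2) + 2 * (cmod c)\<^sup>2 * (?w x * (cmod (g x))\<^sup>2)"
        by (simp add: norm_mult power_mult_distrib distrib_left mult_ac)
      finally show "norm (?w x * (cmod (f x + c * g x))\<^sup>2)
        \<le> norm (2 * (?w x * (cmod (f x))\<^sup>2) + 2 * (cmod c)\<^sup>2 * (?w x * (cmod (g x))\<^sup>2))" by simp
    qed
  qed measurable
  thus ?thesis by (simp add: weighted_space_def)
qed

lemma nn_integral_weighted:
  assumes f: "f \<in> weighted_space d \<sigma>"
  shows "(\<integral>\<^sup>+x. ennreal ((1 + (fst x)\<^sup>2) powr \<sigma> * (cmod (f x))\<^sup>2) \<partial>M) = ennreal ((weighted_norm d \<sigma> f)\<^sup>2)"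
  using weighted_integrable[OF f] by (simp add: nn_integral_eq_integral weighted_norm_def)

definition fibre_norm :: "(point \<Rightarrow> complex) \<Rightarrow> (nat \<Rightarrow> real) \<Rightarrow> ennreal" where
  "fibre_norm f x' = (\<integral>\<^sup>+x1. ennreal (cmod (f (x1, x'))) \<partial>lborel)"

lemma fibre_norm_measurable [measurable]:
  assumes "f \<in> borel_measurable M" shows "fibre_norm f \<in> borel_measurable X"
proof -
  have [measurable]: "f \<in> borel_measurable (lborel \<Otimes>\<^sub>M X)" using assms by (simp add: Rd_measure_def)
  show ?thesis unfolding fibre_norm_def[abs_def] by measurable
qed

text \<open>On each fibre |f| is split into (1 + x1^2)^(-\<sigma>/2) and (1 + x1^2)^(\<sigma>/2)
  |f|. Cauchy-Schwarz makes the first factor contribute \<open>weight_integral \<sigma>\<close> and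
  the second the fibre's share of the weighted norm.\<close>

lemma fibre_norm_square_le:
  assumes f: "f \<in> weighted_space d \<sigma>"
  shows "(\<integral>\<^sup>+x'. (fibre_norm f x')\<^sup>2 \<partial>X) \<le> weight_integral \<sigma> * ennreal ((weighted_norm d \<sigma> f)\<^sup>2)"
proof -
  have f_meas [measurable]: "f \<in> borel_measurable (lborel \<Otimes>\<^sub>M X)" 
    using weighted_measurable[OF f] by (simp add: Rd_measure_def)
  let ?W = "\<lambda>x'. \<integral>\<^sup>+x1. ennreal ((1 + x1\<^sup>2) powr \<sigma> * (cmod (f (x1, x')))\<^sup>2) \<partial>lborel"
  have "(\<integral>\<^sup>+x'. (fibre_norm f x')\<^sup>2 \<partial>X) \<le> (\<integral>\<^sup>+x'. weight_integral \<sigma> * ?W x' \<partial>X)"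
  proof (rule nn_integral_mono)
    fix x' assume x': "x' \<in> space X"
    have [measurable]: "(\<lambda>x1. f (x1, x')) \<in> borel_measurable borel"
      using measurable_compose[OF measurable_Pair2'[OF x', of lborel] f_meas] by simp
    let ?u = "\<lambda>x1 :: real. ennreal ((1 + x1\<^sup>2) powr (- \<sigma> / 2))"
    let ?v = "\<lambda>x1. ennreal ((1 + x1\<^sup>2) powr (\<sigma> / 2) * cmod (f (x1, x')))"
    have sq: "((1 + x\<^sup>2) powr (r / 2))\<^sup>2 = (1 + x\<^sup>2) powr r" for x r :: real
      by (simp add: power2_eq_square flip: powr_add)
    have "?u x1 * ?v x1 = ennreal (cmod (f (x1, x')))" for x1
    proof -
      have "0 < 1 + x1\<^sup>2" by (simp add: add_pos_nonneg)
      hence "(1 + x1\<^sup>2) powr (- \<sigma> / 2) * (1 + x1\<^sup>2) powr (\<sigma> / 2) = 1" by (simp flip: powr_add)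
      hence "(1 + x1\<^sup>2) powr (- \<sigma> / 2) * ((1 + x1\<^sup>2) powr (\<sigma> / 2) * cmod (f (x1, x'))) = cmod (f (x1, x'))"
        by (simp add: mult.assoc[symmetric])
      thus ?thesis by (simp add: ennreal_mult'[symmetric])
    qed
    hence "(fibre_norm f x')\<^sup>2 = (\<integral>\<^sup>+x1. ?u x1 * ?v x1 \<partial>lborel)\<^sup>2" by (simp add: fibre_norm_def)
    also have "\<dots> \<le> (\<integral>\<^sup>+x1. (?u x1)\<^sup>2 \<partial>lborel) * (\<integral>\<^sup>+x1. (?v x1)\<^sup>2 \<partial>lborel)"
      by (rule Cauchy_Schwarz_nn_integral) measurable
    also have "(\<integral>\<^sup>+x1. (?u x1)\<^sup>2 \<partial>lborel) = weight_integral \<sigma>"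
      by (simp only: ennreal_power powr_ge_zero sq weight_integral_def)
    also have "(\<integral>\<^sup>+x1. (?v x1)\<^sup>2 \<partial>lborel) = ?W x'"
      by (simp add: ennreal_power power_mult_distrib sq)
    finally show "(fibre_norm f x')\<^sup>2 \<le> weight_integral \<sigma> * ?W x'" .
  qed
  also have "\<dots> = weight_integral \<sigma> * (\<integral>\<^sup>+x'. ?W x' \<partial>X)" by (rule nn_integral_cmult) measurable
  also have "(\<integral>\<^sup>+x'. ?W x' \<partial>X) = (\<integral>\<^sup>+x. ennreal ((1 + (fst x)\<^sup>2) powr \<sigma> * (cmod (f x))\<^sup>2) \<partial>M)"
    unfolding Rd_measure_def
    using Rd.nn_integral_snd[of "\<lambda>x. ennreal ((1 + (fst x)\<^sup>2) powr \<sigma> * (cmod (f x))\<^sup>2)" d] by simp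
  finally show ?thesis unfolding nn_integral_weighted[OF f] .
qed

lemma sigma_finite_Rd: "sigma_finite_measure M"
  unfolding Rd_measure_def ..

lemma joint_measurable:
  assumes "f \<in> borel_measurable M"
  shows "(\<lambda>z. f (T (fst z) (snd z))) \<in> borel_measurable (lborel \<Otimes>\<^sub>M M)"
proof (rule measurable_compose[OF _ assms])
  show "(\<lambda>z. T (fst z) (snd z)) \<in> lborel \<Otimes>\<^sub>M M \<rightarrow>\<^sub>M M" unfolding T_def Rd_measure_def by measurable
qed

lemma joint_measurable':
  assumes "f \<in> borel_measurable M"
  shows "(\<lambda>z. f (T (snd z) (fst z))) \<in> borel_measurable (M \<Otimes>\<^sub>M lborel)"
  using measurable_compose[OF _ joint_measurable[OF assms], of "\<lambda>z. (snd z, fst z)" "M \<Otimes>\<^sub>M lborel"] by simp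

lemma correlation_measurable:
  assumes f: "f \<in> borel_measurable M" and g [measurable]: "g \<in> borel_measurable M"
  shows "(\<lambda>t. L2_inner M (U t f) g) \<in> borel_measurable lborel"
proof -
  interpret sigma_finite_measure M by (rule sigma_finite_Rd)
  note [measurable] = joint_measurable[OF f]
  show ?thesis unfolding L2_inner_def U_def
    by (rule borel_measurable_lebesgue_integral) (simp add: case_prod_beta')
qed

lemma nn_integral_correlation:
  assumes \<sigma>: "1 / 2 < \<sigma>" and f: "f \<in> weighted_space d \<sigma>" and g: "g \<in> weighted_space d \<sigma>"
  shows "(\<integral>\<^sup>+t. ennreal (cmod (L2_inner M (U t f) g)) \<partial>lborel) 
    \<le> ennreal (enn2real (weight_integral \<sigma>) / l * (weighted_norm d \<sigma> f * weighted_norm d \<sigma> g))"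
proof -
  interpret M: sigma_finite_measure M by (rule sigma_finite_Rd)
  interpret LM: pair_sigma_finite lborel M ..
  note [measurable] = weighted_measurable[OF f] weighted_measurable[OF g] joint_measurable[OF weighted_measurable[OF f]]
    joint_measurable'[OF weighted_measurable[OF f]]
  have f_meas: "f \<in> borel_measurable (lborel \<Otimes>\<^sub>M X)" and g_meas [measurable]: "g \<in> borel_measurable (lborel \<Otimes>\<^sub>M X)"
    using weighted_measurable[OF f] weighted_measurable[OF g] by (simp_all add: Rd_measure_def)
  have L: "f \<in> L2 M" "g \<in> L2 M" using \<sigma> f g by (auto intro: weighted_L2[of \<sigma>])
  define c where "c = enn2real (weight_integral \<sigma>)"
  have c: "weight_integral \<sigma> = ennreal c" "0 \<le> c"
    using weight_integral_finite[OF \<sigma>] by (simp_all add: c_def)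
  let ?Nf = "weighted_norm d \<sigma> f" and ?Ng = "weighted_norm d \<sigma> g"
  have N: "0 \<le> ?Nf" "0 \<le> ?Ng" by (simp_all add: weighted_norm_def)
  define I where "I = (\<integral>\<^sup>+t. ennreal (cmod (L2_inner M (U t f) g)) \<partial>lborel)"
  have "I \<le> (\<integral>\<^sup>+t. \<integral>\<^sup>+x. ennreal (cmod (f (T t x))) * ennreal (cmod (g x)) \<partial>M \<partial>lborel)"
    unfolding I_def
  proof (rule nn_integral_mono)
    fix t
    have "ennreal (cmod (L2_inner M (U t f) g)) \<le> (\<integral>\<^sup>+x. ennreal (cmod (U t f x * cnj (g x))) \<partial>M)"
      unfolding L2_inner_def by (intro integral_norm_bound_ennreal L2_mult_integrable U_L2 L)
    thus "ennreal (cmod (L2_inner M (U t f) g)) \<le> (\<integral>\<^sup>+x. ennreal (cmod (f (T t x))) * ennreal (cmod (g x)) \<partial>M)"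
      by (simp add: U_def norm_mult ennreal_mult)
  qed
  also have "\<dots> = (\<integral>\<^sup>+x. \<integral>\<^sup>+t. ennreal (cmod (f (T t x))) * ennreal (cmod (g x)) \<partial>lborel \<partial>M)"
    by (rule LM.Fubini'[symmetric]) (simp add: case_prod_beta')
  \<comment> \<open>The factor l is carried on the left and absorbed by l < \<psi>(x'), the Jacobian
    of t \<mapsto> x1 + t \<psi>(x'); this avoids dividing by \<psi> in
    \<open>ennreal\<close>.\<close>
  finally have "ennreal l * I \<le> ennreal l * (\<integral>\<^sup>+x. \<integral>\<^sup>+t. ennreal (cmod (f (T t x))) * ennreal (cmod (g x)) \<partial>lborel \<partial>M)"
    by (rule mult_left_mono) simp
  also have "\<dots> = (\<integral>\<^sup>+x. ennreal l * (\<integral>\<^sup>+t. ennreal (cmod (f (T t x))) * ennreal (cmod (g x)) \<partial>lborel) \<partial>M)"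
    by (rule nn_integral_cmult[symmetric]) (rule M.borel_measurable_nn_integral lborel.borel_measurable_nn_integral, simp add: case_prod_beta')
  also have "\<dots> \<le> (\<integral>\<^sup>+x. fibre_norm f (snd x) * ennreal (cmod (g x)) \<partial>M)"
  proof (rule nn_integral_mono)
    fix x assume "x \<in> space M"
    hence x': "snd x \<in> space X" by (auto simp: Rd_measure_def space_pair_measure)
    hence psi: "l < \<psi> (snd x)" by (intro psi_gt) (simp add: space_cross_measure)
    have fm [measurable]: "(\<lambda>x1. f (x1, snd x)) \<in> borel_measurable borel"
      using measurable_compose[OF measurable_Pair2'[OF x', of lborel] f_meas] by simp
    have "(\<integral>\<^sup>+t. ennreal (cmod (f (T t x))) * ennreal (cmod (g x)) \<partial>lborel) =
        (\<integral>\<^sup>+t. ennreal (cmod (f (fst x + \<psi> (snd x) * t, snd x))) \<partial>lborel) * ennreal (cmod (g x))"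
      by (subst nn_integral_multc[symmetric]) (simp_all add: T_def mult.commute)
    hence "ennreal l * (\<integral>\<^sup>+t. ennreal (cmod (f (T t x))) * ennreal (cmod (g x)) \<partial>lborel) =
      ennreal l * (\<integral>\<^sup>+t. ennreal (cmod (f (fst x + \<psi> (snd x) * t, snd x))) \<partial>lborel) * ennreal (cmod (g x))"
      by (simp add: mult.assoc)
    also have "\<dots> \<le> ennreal \<bar>\<psi> (snd x)\<bar> * (\<integral>\<^sup>+t. ennreal (cmod (f (fst x + \<psi> (snd x) * t, snd x))) \<partial>lborel) * ennreal (cmod (g x))"
      using psi by (intro mult_right_mono ennreal_leI) auto
    also have "ennreal \<bar>\<psi> (snd x)\<bar> * (\<integral>\<^sup>+t. ennreal (cmod (f (fst x + \<psi> (snd x) * t, snd x))) \<partial>lborel) = fibre_norm f (snd x)"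
      unfolding fibre_norm_def using psi l_pos
      by (intro nn_integral_real_affine[symmetric, where f = "\<lambda>x1. ennreal (cmod (f (x1, snd x)))"]) auto
    finally show "ennreal l * (\<integral>\<^sup>+t. ennreal (cmod (f (T t x))) * ennreal (cmod (g x)) \<partial>lborel)
      \<le> fibre_norm f (snd x) * ennreal (cmod (g x))" .
  qed
  also have "\<dots> = (\<integral>\<^sup>+x'. \<integral>\<^sup>+x1. fibre_norm f x' * ennreal (cmod (g (x1, x'))) \<partial>lborel \<partial>X)"
    unfolding Rd_measure_def
    using Rd.nn_integral_snd[of "\<lambda>x. fibre_norm f (snd x) * ennreal (cmod (g x))" d] by simp
  also have "\<dots> = (\<integral>\<^sup>+x'. fibre_norm f x' * fibre_norm g x' \<partial>X)"
  proof (rule nn_integral_cong)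
    fix x' assume x': "x' \<in> space X"
    have [measurable]: "(\<lambda>x1. g (x1, x')) \<in> borel_measurable lborel"
      using measurable_compose[OF measurable_Pair2'[OF x', of lborel] g_meas] by simp
    show "(\<integral>\<^sup>+x1. fibre_norm f x' * ennreal (cmod (g (x1, x'))) \<partial>lborel) = fibre_norm f x' * fibre_norm g x'"
      unfolding fibre_norm_def[of g] by (rule nn_integral_cmult) measurable
  qed
  finally have lI: "ennreal l * I \<le> (\<integral>\<^sup>+x'. fibre_norm f x' * fibre_norm g x' \<partial>X)" .
  have "(\<integral>\<^sup>+x'. fibre_norm f x' * fibre_norm g x' \<partial>X)\<^sup>2 \<le> (\<integral>\<^sup>+x'. (fibre_norm f x')\<^sup>2 \<partial>X) * (\<integral>\<^sup>+x'. (fibre_norm g x')\<^sup>2 \<partial>X)"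
    by (rule Cauchy_Schwarz_nn_integral) measurable
  also have "\<dots> \<le> (ennreal c * ennreal (?Nf\<^sup>2)) * (ennreal c * ennreal (?Ng\<^sup>2))"
    using fibre_norm_square_le[OF f] fibre_norm_square_le[OF g] unfolding c(1) by (rule mult_mono) auto
  also have "\<dots> = (ennreal (c * (?Nf * ?Ng)))\<^sup>2"
    using c(2) N by (simp add: ennreal_power power_mult_distrib flip: ennreal_mult) (simp add: power2_eq_square mult_ac)
  finally have "(\<integral>\<^sup>+x'. fibre_norm f x' * fibre_norm g x' \<partial>X) \<le> ennreal (c * (?Nf * ?Ng))"
    using c(2) N by (intro ennreal_le_of_square) auto
  with lI have "ennreal l * I \<le> ennreal (c * (?Nf * ?Ng))" by (rule order_trans)
  hence "ennreal (1 / l) * (ennreal l * I) \<le> ennreal (1 / l) * ennreal (c * (?Nf * ?Ng))" by (rule mult_left_mono) simp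
  moreover have "ennreal (1 / l) * (ennreal l * I) = I"
    using l_pos by (simp add: mult.assoc[symmetric] flip: ennreal_mult)
  moreover have "ennreal (1 / l) * ennreal (c * (?Nf * ?Ng)) = ennreal (c / l * (?Nf * ?Ng))"
    using l_pos c N by (simp flip: ennreal_mult)
  ultimately show ?thesis unfolding I_def c_def by simp
qed

text \<open>In the constant, 1 / l comes from the Jacobian in \<open>nn_integral_correlation\<close>
  and 1 / (2 * pi) from Fourier inversion. Differentiability is stated separately because
  \<open>vector_derivative\<close> has a value even where no derivative exists.\<close>

theorem density_of_states_bound:
  assumes \<sigma>: "1 / 2 < \<sigma>" and E: "spectral_family M H E"
    and f: "f \<in> weighted_space d \<sigma>" and g: "g \<in> weighted_space d \<sigma>"
  shows "(\<lambda>\<nu>. L2_inner M (E \<nu> f) g) differentiable (at \<nu>)"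
    and "cmod (density_of_states M E \<nu> f g)
      \<le> enn2real (weight_integral \<sigma>) / (2 * pi * l) * weighted_norm d \<sigma> f * weighted_norm d \<sigma> g"
proof -
  interpret spectral_group M H E U by (rule spectral_group[OF E])
  have int: "integrable lborel (\<lambda>t. L2_inner M (U t f) g)"
    if "f \<in> weighted_space d \<sigma>" "g \<in> weighted_space d \<sigma>" for f g
    by (rule integrableI_bounded[OF correlation_measurable[OF that[THEN weighted_measurable]]])
       (rule le_less_trans[OF nn_integral_correlation[OF \<sigma> that]], simp)
  define D where "D = (\<integral>t. iexp (- (t * \<nu>)) * L2_inner M (U t f) g \<partial>lborel) / (2 * pi)"
  have der: "((\<lambda>\<nu>. L2_inner M (E \<nu> f) g) has_vector_derivative D) (at \<nu>)"
    unfolding D_def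
    by (rule spectral_family_has_density[of "weighted_space d \<sigma>"])
       (use \<sigma> in \<open>auto intro: weighted_linear weighted_L2[of \<sigma>] int f g\<close>)
  thus "(\<lambda>\<nu>. L2_inner M (E \<nu> f) g) differentiable (at \<nu>)" by (rule differentiableI_vector)
  let ?K = "enn2real (weight_integral \<sigma>) / l * (weighted_norm d \<sigma> f * weighted_norm d \<sigma> g)"
  have K: "0 \<le> ?K" using l_pos by (simp add: weighted_norm_def)
  have "cmod (\<integral>t. iexp (- (t * \<nu>)) * L2_inner M (U t f) g \<partial>lborel) \<le> (\<integral>t. cmod (L2_inner M (U t f) g) \<partial>lborel)"
    by (rule order_trans[OF integral_norm_bound]) (simp add: norm_mult)
  also have "\<dots> \<le> ?K"
  proof -
    have "ennreal (\<integral>t. cmod (L2_inner M (U t f) g) \<partial>lborel) = (\<integral>\<^sup>+t. ennreal (cmod (L2_inner M (U t f) g)) \<partial>lborel)"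
      using int[OF f g] by (intro nn_integral_eq_integral[symmetric]) auto
    also have "\<dots> \<le> ennreal ?K" by (rule nn_integral_correlation[OF \<sigma> f g])
    finally show ?thesis using K by (simp add: ennreal_le_iff)
  qed
  finally have *: "cmod (\<integral>t. iexp (- (t * \<nu>)) * L2_inner M (U t f) g \<partial>lborel) \<le> ?K" .
  have "cmod D \<le> ?K / (2 * pi)"
  proof -
    have "cmod D = cmod (\<integral>t. iexp (- (t * \<nu>)) * L2_inner M (U t f) g \<partial>lborel) / (2 * pi)"
      by (simp add: D_def norm_divide norm_mult)
    also have "\<dots> \<le> ?K / (2 * pi)" using * by (rule divide_right_mono) simp
    finally show ?thesis .
  qed
  also have "\<dots> = enn2real (weight_integral \<sigma>) / (2 * pi * l) * weighted_norm d \<sigma> f * weighted_norm d \<sigma> g"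
    by (simp add: field_simps)
  finally show "cmod (density_of_states M E \<nu> f g)
      \<le> enn2real (weight_integral \<sigma>) / (2 * pi * l) * weighted_norm d \<sigma> f * weighted_norm d \<sigma> g"
    unfolding density_of_states_def vector_derivative_at[OF der] .
qed

end

theorem theorem4p3:
  shows "\<exists>C :: real \<Rightarrow> real \<Rightarrow> real.
    \<forall>(d :: nat) (\<psi> :: (nat \<Rightarrow> real) \<Rightarrow> real) (\<l> :: real) (L :: real) (H :: point graph)
      (E :: real \<Rightarrow> (point \<Rightarrow> complex) \<Rightarrow> (point \<Rightarrow> complex)) (\<sigma> :: real) (\<nu>\<^sub>0 :: real).
      2 \<le> d \<and> regular_shear_flow d \<l> L \<psi> H \<and> spectral_family (Rd_measure d) H E \<and> 1 / 2 < \<sigma> \<longrightarrow>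
      0 < C \<sigma> \<l> * (1 + \<bar>\<nu>\<^sub>0\<bar> * L / \<l>\<^sup>2) \<and>
      (\<forall>f \<in> weighted_space d \<sigma>. \<forall>g \<in> weighted_space d \<sigma>.
        (\<lambda>\<nu>. L2_inner (Rd_measure d) (E \<nu> f) g) differentiable (at \<nu>\<^sub>0) \<and>
        cmod (density_of_states (Rd_measure d) E \<nu>\<^sub>0 f g)
          \<le> C \<sigma> \<l> * (1 + \<bar>\<nu>\<^sub>0\<bar> * L / \<l>\<^sup>2) * weighted_norm d \<sigma> f * weighted_norm d \<sigma> g)"
proof (intro exI allI impI, elim conjE)
  \<comment> \<open>The added 1 makes the constant positive without a lower bound for
    \<open>weight_integral \<sigma>\<close>.\<close>
  let ?C = "\<lambda>\<sigma> l. (enn2real (weight_integral \<sigma>) + 1) / (2 * pi * l)"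
  fix d \<psi> \<l> L H E and \<sigma> \<nu>\<^sub>0 :: real
  assume d: "2 \<le> d" and reg: "regular_shear_flow d \<l> L \<psi> H"
    and E: "spectral_family (Rd_measure d) H E" and \<sigma>: "1 / 2 < \<sigma>"
  interpret regular_shear d \<psi> \<l> L H by unfold_locales (rule reg)
  \<comment> \<open>The bound at hand is uniform in \<open>\<nu>\<^sub>0\<close>. As L \<ge> 0, the
    factor of the statement is at least 1, and multiplying by it only weakens the estimate.\<close>
  have factor: "1 \<le> 1 + \<bar>\<nu>\<^sub>0\<bar> * L / \<l>\<^sup>2" using L_nonneg[OF d] by simp
  have C: "enn2real (weight_integral \<sigma>) / (2 * pi * \<l>) \<le> ?C \<sigma> \<l>" "0 < ?C \<sigma> \<l>"
    using l_pos by (auto intro!: divide_right_mono divide_pos_pos add_nonneg_pos)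
  have CC: "?C \<sigma> \<l> \<le> ?C \<sigma> \<l> * (1 + \<bar>\<nu>\<^sub>0\<bar> * L / \<l>\<^sup>2)"
    using mult_left_mono[OF factor less_imp_le[OF C(2)]] by simp
  show "0 < ?C \<sigma> \<l> * (1 + \<bar>\<nu>\<^sub>0\<bar> * L / \<l>\<^sup>2) \<and>
      (\<forall>f \<in> weighted_space d \<sigma>. \<forall>g \<in> weighted_space d \<sigma>.
        (\<lambda>\<nu>. L2_inner (Rd_measure d) (E \<nu> f) g) differentiable (at \<nu>\<^sub>0) \<and>
        cmod (density_of_states (Rd_measure d) E \<nu>\<^sub>0 f g)
          \<le> ?C \<sigma> \<l> * (1 + \<bar>\<nu>\<^sub>0\<bar> * L / \<l>\<^sup>2) * weighted_norm d \<sigma> f * weighted_norm d \<sigma> g)"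
  proof (intro conjI ballI)
    show "0 < ?C \<sigma> \<l> * (1 + \<bar>\<nu>\<^sub>0\<bar> * L / \<l>\<^sup>2)" using CC C(2) by linarith
    fix f g assume fg: "f \<in> weighted_space d \<sigma>" "g \<in> weighted_space d \<sigma>"
    show "(\<lambda>\<nu>. L2_inner (Rd_measure d) (E \<nu> f) g) differentiable (at \<nu>\<^sub>0)"
      by (rule density_of_states_bound(1)[OF \<sigma> E fg])
    have "cmod (density_of_states (Rd_measure d) E \<nu>\<^sub>0 f g)
        \<le> enn2real (weight_integral \<sigma>) / (2 * pi * \<l>) * weighted_norm d \<sigma> f * weighted_norm d \<sigma> g"
      by (rule density_of_states_bound(2)[OF \<sigma> E fg])
    also have "\<dots> \<le> ?C \<sigma> \<l> * (1 + \<bar>\<nu>\<^sub>0\<bar> * L / \<l>\<^sup>2) * weighted_norm d \<sigma> f * weighted_norm d \<sigma> g"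
      using C(1) CC by (intro mult_right_mono) (auto simp: weighted_norm_def)
    finally show "cmod (density_of_states (Rd_measure d) E \<nu>\<^sub>0 f g) \<le> \<dots>" .
  qed
qed

end
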